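(* Let $\Psi^{ab}=\Psi^{ab}_P+\Psi^{ab}_J+\Psi^{ab}_A+\Psi^{ab}_Q+\Psi^{ab}_\lambda$ be a tensor field on $B_a\setminus\{0\}\subset\mathbb R^3$ as in the context, built from constants $A,P^a,Q^a,J^a$ and a complex smooth function $\lambda$ on $B_a\setminus\{0\}$. If $P^a=0$ and $r\lambda\in E^\infty(B_a)$, then $r^8\Psi_{ab}\Psi^{ab}\in E^\infty(B_a)$.
   Context: $\mathbb R^3$ carries the flat metric $\delta_{ab}$ in Cartesian coordinates $x^k$ with origin $0$; $r=|x|$, $n^a=x^a/r$, $B_a=\{r<a\}$, $\epsilon^{abc}$ the flat Levi-Civita symbol; indices moved with $\delta$. A function $f$ on $B_a\setminus\{0\}$ is in $E^\infty(B_a)$ if $f=f_1+rf_2$ there with $f_1,f_2\in C^\infty(B_a)$. $m^a$ is a complex vector field, independent of $r$, with $m_am^a=\bar m_a\bar m^a=n_am^a=n_a\bar m^a=0$, $m_a\bar m^a=1$; $\eth$ is the edth operator of the unit sphere (Penrose–Rindler conventions adapted to $m^a$), commuting with $\partial_r$. Set $\lambda^R=\mathrm{Re}\lambda$, $\lambda^I=i\,\mathrm{Im}\lambda$, $\lambda_2^R=\eth^2\lambda^R$, $\lambda_2^I=\eth^2\lambda^I$. $\Psi^{ab}_\lambda$ is defined by $r^3\Psi_{ab}=\xi(3n_an_b-\delta_{ab})+\sqrt2\eta_1n_{(a}\bar m_{b)}+\sqrt2\bar\eta_1n_{(a}m_{b)}+\bar\mu_2m_am_b+\mu_2\bar m_a\bar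 m_b$ with $\xi=\bar\eth^2\lambda_2^R$, $\eta_1=-2r\partial_r\bar\eth\lambda_2^R+\bar\eth\lambda_2^I$, $\mu_2=2r\partial_r(r\partial_r\lambda_2^R)-2\lambda_2^R+\eth\bar\eth\lambda_2^R-r\partial_r\lambda_2^I$. Also $\Psi_P^{ab}=\frac{3}{2r^4}(-P^an^b-P^bn^a-(\delta^{ab}-5n^an^b)P^cn_c)$, $\Psi_J^{ab}=\frac{3}{r^3}(n^a\epsilon^{bcd}J_cn_d+n^b\epsilon^{acd}J_cn_d)$, $\Psi_A^{ab}=\frac{A}{r^3}(3n^an^b-\delta^{ab})$, $\Psi_Q^{ab}=\frac{3}{2r^2}(Q^an^b+Q^bn^a-(\delta^{ab}-n^an^b)Q^cn_c)$. *)

theory Defs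
  imports "HOL-Analysis.Analysis"
begin

definition pd :: "3 \<Rightarrow> (real^3 \<Rightarrow> 'b::real_normed_vector) \<Rightarrow> real^3 \<Rightarrow> 'b" where
  "pd k f x = vector_derivative (\<lambda>t::real. f (x + t *\<^sub>R axis k 1)) (at 0)"

primrec hpd :: "3 list \<Rightarrow> (real^3 \<Rightarrow> 'b::real_normed_vector) \<Rightarrow> real^3 \<Rightarrow> 'b" where
  "hpd [] f = f"
| "hpd (k # ks) f = pd k (hpd ks f)"

definition Cinf_on :: "(real^3) set \<Rightarrow> (real^3 \<Rightarrow> 'b::real_normed_vector) \<Rightarrow> bool" where
  "Cinf_on U f \<longleftrightarrow> (\<forall>ks. continuous_on U (hpd ks f) \<and> (\<forall>x\<in>U. hpd ks f differentiable (at x)))"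

definition E_inf :: "real \<Rightarrow> (real^3 \<Rightarrow> complex) \<Rightarrow> bool" where
  "E_inf a f \<longleftrightarrow> (\<exists>f1 f2. Cinf_on (ball 0 a) f1 \<and> Cinf_on (ball 0 a) f2 \<and>
      (\<forall>x\<in>ball 0 a - {0}. f x = f1 x + complex_of_real (norm x) * f2 x))"

definition nvec :: "real^3 \<Rightarrow> real^3" where
  "nvec x = (1 / norm x) *\<^sub>R x"

definition kdelta :: "3 \<Rightarrow> 3 \<Rightarrow> real" where
  "kdelta i j = (if i = j then 1 else 0)"

text \<open>r d/dr = x^k d/dx^k.\<close>
definition radd :: "(real^3 \<Rightarrow> complex) \<Rightarrow> real^3 \<Rightarrow> complex" where
  "radd f x = (\<Sum>k\<in>UNIV. complex_of_real (x $ k) * pd k f x)"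

definition mdir :: "(real^3 \<Rightarrow> complex^3) \<Rightarrow> (real^3 \<Rightarrow> complex) \<Rightarrow> real^3 \<Rightarrow> complex" where
  "mdir m f x = (\<Sum>k\<in>UNIV. m x $ k * pd k f x)"

definition mconn :: "(real^3 \<Rightarrow> complex^3) \<Rightarrow> real^3 \<Rightarrow> complex" where
  "mconn m x = (\<Sum>b\<in>UNIV. cnj (m x $ b) * mdir m (\<lambda>y. m y $ b) x)"

text \<open>edth of the unit sphere (Penrose-Rindler convention, adapted to m) acting on a quantity
  of spin weight s, written on R^3 minus the origin (hence the factor r):
  edth eta = r (m^a d_a eta - s (mbar_b m^a d_a m^b) eta); edth-bar eta = conj (edth (conj eta)).\<close>
definition eth :: "(real^3 \<Rightarrow> complex^3) \<Rightarrow> int \<Rightarrow> (real^3 \<Rightarrow> complex) \<Rightarrow> real^3 \<Rightarrow> complex" where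
  "eth m s f x = complex_of_real (norm x) * (mdir m f x - of_int s * mconn m x * f x)"

definition ethbar :: "(real^3 \<Rightarrow> complex^3) \<Rightarrow> int \<Rightarrow> (real^3 \<Rightarrow> complex) \<Rightarrow> real^3 \<Rightarrow> complex" where
  "ethbar m s f x = cnj (eth m (- s) (\<lambda>y. cnj (f y)) x)"

definition adapted_frame :: "(real^3) set \<Rightarrow> (real^3 \<Rightarrow> complex^3) \<Rightarrow> bool" where
  "adapted_frame U m \<longleftrightarrow> open U \<and> 0 \<notin> U \<and> (\<forall>b. Cinf_on U (\<lambda>y. m y $ b)) \<and>
     (\<forall>x\<in>U. (\<Sum>b\<in>UNIV. m x $ b * m x $ b) = 0
        \<and> (\<Sum>b\<in>UNIV. cnj (m x $ b) * cnj (m x $ b)) = 0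
        \<and> (\<Sum>b\<in>UNIV. complex_of_real (nvec x $ b) * m x $ b) = 0
        \<and> (\<Sum>b\<in>UNIV. complex_of_real (nvec x $ b) * cnj (m x $ b)) = 0
        \<and> (\<Sum>b\<in>UNIV. m x $ b * cnj (m x $ b)) = 1
        \<and> (\<forall>b. radd (\<lambda>y. m y $ b) x = 0))"

definition lamR :: "(real^3 \<Rightarrow> complex) \<Rightarrow> real^3 \<Rightarrow> complex" where
  "lamR lam y = complex_of_real (Re (lam y))"

definition lamI :: "(real^3 \<Rightarrow> complex) \<Rightarrow> real^3 \<Rightarrow> complex" where
  "lamI lam y = \<i> * complex_of_real (Im (lam y))"

definition lam2R :: "(real^3 \<Rightarrow> complex^3) \<Rightarrow> (real^3 \<Rightarrow> complex) \<Rightarrow> real^3 \<Rightarrow> complex" where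
  "lam2R m lam = eth m 1 (eth m 0 (lamR lam))"

definition lam2I :: "(real^3 \<Rightarrow> complex^3) \<Rightarrow> (real^3 \<Rightarrow> complex) \<Rightarrow> real^3 \<Rightarrow> complex" where
  "lam2I m lam = eth m 1 (eth m 0 (lamI lam))"

definition xiL :: "(real^3 \<Rightarrow> complex^3) \<Rightarrow> (real^3 \<Rightarrow> complex) \<Rightarrow> real^3 \<Rightarrow> complex" where
  "xiL m lam = ethbar m 1 (ethbar m 2 (lam2R m lam))"

definition eta1L :: "(real^3 \<Rightarrow> complex^3) \<Rightarrow> (real^3 \<Rightarrow> complex) \<Rightarrow> real^3 \<Rightarrow> complex" where
  "eta1L m lam x = - 2 * radd (ethbar m 2 (lam2R m lam)) x + ethbar m 2 (lam2I m lam) x"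

definition mu2L :: "(real^3 \<Rightarrow> complex^3) \<Rightarrow> (real^3 \<Rightarrow> complex) \<Rightarrow> real^3 \<Rightarrow> complex" where
  "mu2L m lam x = 2 * radd (radd (lam2R m lam)) x - 2 * lam2R m lam x
      + eth m 1 (ethbar m 2 (lam2R m lam)) x - radd (lam2I m lam) x"

definition PsiLam :: "(real^3 \<Rightarrow> complex^3) \<Rightarrow> (real^3 \<Rightarrow> complex) \<Rightarrow> real^3 \<Rightarrow> 3 \<Rightarrow> 3 \<Rightarrow> complex" where
  "PsiLam m lam x i j =
    (let n = (\<lambda>k. complex_of_real (nvec x $ k)); mm = (\<lambda>k. m x $ k); mb = (\<lambda>k. cnj (m x $ k));
         xi = xiL m lam x; eta = eta1L m lam x; mu = mu2L m lam x
     in (1 / complex_of_real (norm x ^ 3)) *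
       (xi * (3 * n i * n j - complex_of_real (kdelta i j))
        + complex_of_real (sqrt 2) * eta * ((n i * mb j + n j * mb i) / 2)
        + complex_of_real (sqrt 2) * cnj eta * ((n i * mm j + n j * mm i) / 2)
        + cnj mu * mm i * mm j + mu * mb i * mb j))"

definition PsiP :: "real^3 \<Rightarrow> real^3 \<Rightarrow> 3 \<Rightarrow> 3 \<Rightarrow> real" where
  "PsiP P x i j = (let n = nvec x in
     3 / (2 * norm x ^ 4) * (- P $ i * n $ j - P $ j * n $ i - (kdelta i j - 5 * n $ i * n $ j) * (P \<bullet> n)))"

definition PsiJ :: "real^3 \<Rightarrow> real^3 \<Rightarrow> 3 \<Rightarrow> 3 \<Rightarrow> real" where
  "PsiJ J x i j = (let n = nvec x in
     3 / norm x ^ 3 * (n $ i * cross3 J n $ j + n $ j * cross3 J n $ i))"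

definition PsiA :: "real \<Rightarrow> real^3 \<Rightarrow> 3 \<Rightarrow> 3 \<Rightarrow> real" where
  "PsiA A x i j = (let n = nvec x in A / norm x ^ 3 * (3 * n $ i * n $ j - kdelta i j))"

definition PsiQ :: "real^3 \<Rightarrow> real^3 \<Rightarrow> 3 \<Rightarrow> 3 \<Rightarrow> real" where
  "PsiQ Q x i j = (let n = nvec x in
     3 / (2 * norm x ^ 2) * (Q $ i * n $ j + Q $ j * n $ i - (kdelta i j - n $ i * n $ j) * (Q \<bullet> n)))"

end

theory Submission
  imports Defs
begin

text \<open>On scalars the edth operators are contractions of Cartesian derivatives with the frame, and the
  commutation rules give \<open>\<xi> = L K \<lambda>\<^sup>R\<close>, \<open>\<eta>\<^sub>1 = edth g\<close>, \<open>\<mu>\<^sub>2 = edth\<^sup>2 h\<close>, where \<open>L\<close> is half the spherical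
  Laplacian, \<open>K = L + 1\<close>, and \<open>g\<close>, \<open>h\<close> arise from \<open>\<lambda>\<close> by operators commuting with multiplication by \<open>r\<close> up to
  lower order terms, so that \<open>r g\<close> and \<open>r h\<close> are again of the form \<open>f1 + r f2\<close>. Hence
  \<open>r\<^sup>8 \<Psi>\<^sub>a\<^sub>b \<Psi>\<^sup>a\<^sup>b = 6 (r \<xi>)\<^sup>2 + 2 |r \<eta>|\<^sup>2 + 2 |r \<mu>|\<^sup>2\<close> only involves such functions and the products
  \<open>r\<^sup>2 m\<^sub>a cnj m\<^sub>b = (r\<^sup>2 \<delta>\<^sub>a\<^sub>b - x\<^sub>a x\<^sub>b \<plusminus> \<i> r \<epsilon>\<^sub>a\<^sub>b\<^sub>c x\<^sup>c) / 2\<close>. The sign is the orientation of the frame, which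
  may change from one local frame to the next. If it does so arbitrarily close to the origin, then
  \<open>f1 + r f2 = 0\<close>, with \<open>f1 + r f2\<close> the difference of the two expressions, on an open set with the origin in
  its closure; the Taylor series at \<open>0\<close> satisfy \<open>f1\<^sup>2 = r\<^sup>2 f2\<^sup>2\<close>, and as \<open>r\<^sup>2\<close> is not a square of a rational
  function both \<open>f1\<close> and \<open>f2\<close> are flat at \<open>0\<close>, so that switching sign does no harm.\<close>

section \<open>Partial derivatives and smooth functions\<close>

text \<open>Frames are local, as the sphere carries no global \<open>m\<close>; the expression must
  be rewritten until only the orientation of the frame is left. Derivatives are the obstacle:
  differentiating r f2 produces x_k f2 / r, which is not of the form f1 + r f2. On scalars, edth
  contracts with \<open>m\<close>, and x_a m^a = 0 removes this term; in second order a trace term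
  remains, removed by m_a m^a = 0. The coefficient functions can therefore be chosen on the whole
  punctured ball, before any frame. The orientation enters through m_a cnj m_b and, independently,
  through J, because \<open>m\<close> is an eigenvector of the cross product with n. Smooth
  functions are not analytic: an identity on an open set accumulating at 0 yields only vanishing
  Taylor series there. That is enough, since flatness absorbs every negative power of r that
  derivatives of r f2 create. To bring the non-square argument down to one variable, Taylor
  coefficients are followed along directions v + t w, with w a unit vector orthogonal to v: the
  squared length is v.v + t^2, and the coefficients are polynomials in t.\<close>

abbreviation ex :: "3 \<Rightarrow> real^3" where "ex k \<equiv> axis k 1"

lemma pd_eq:
  assumes "(f has_derivative f') (at x)" shows "pd k f x = f' (ex k)"
proof -
  have "((\<lambda>t::real. x + t *\<^sub>R ex k) has_derivative (\<lambda>t. t *\<^sub>R ex k)) (at 0)"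
    by (auto intro!: derivative_eq_intros)
  then have "((\<lambda>t. f (x + t *\<^sub>R ex k)) has_derivative (\<lambda>t. f' (t *\<^sub>R ex k))) (at 0)"
    using diff_chain_at[of "\<lambda>t::real. x + t *\<^sub>R ex k" "\<lambda>t. t *\<^sub>R ex k" 0 f f'] assms
    by (simp add: o_def)
  moreover have "f' (t *\<^sub>R ex k) = t *\<^sub>R f' (ex k)" for t
    using assms has_derivative_linear linear_scale by blast
  ultimately show ?thesis
    unfolding pd_def by (intro vector_derivative_at) (simp add: has_vector_derivative_def)
qed

lemma pd_line:
  assumes "f differentiable (at (x + t *\<^sub>R v))"
  shows "((\<lambda>t. f (x + t *\<^sub>R v)) has_vector_derivative (\<Sum>k\<in>UNIV. v $ k *\<^sub>R pd k f (x + t *\<^sub>R v))) (at t)"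
proof -
  obtain f' where f': "(f has_derivative f') (at (x + t *\<^sub>R v))"
    using assms differentiable_def by blast
  have "((\<lambda>t::real. x + t *\<^sub>R v) has_derivative (\<lambda>t. t *\<^sub>R v)) (at t)"
    by (auto intro!: derivative_eq_intros)
  then have D: "((\<lambda>t. f (x + t *\<^sub>R v)) has_derivative (\<lambda>t. f' (t *\<^sub>R v))) (at t)"
    using diff_chain_at[of "\<lambda>t::real. x + t *\<^sub>R v" "\<lambda>t. t *\<^sub>R v" t f f'] f' by (simp add: o_def)
  have lin: "linear f'" using f' has_derivative_linear by blast
  have "v = (\<Sum>k\<in>UNIV. v $ k *\<^sub>R ex k)"
    by (simp add: vec_eq_iff axis_def if_distrib cong: if_cong)
  then have "f' v = (\<Sum>k\<in>UNIV. v $ k *\<^sub>R pd k f (x + t *\<^sub>R v))"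
    using lin by (metis (no_types, lifting) f' linear_scale linear_sum pd_eq sum.cong)
  with D lin show ?thesis
    by (simp add: has_vector_derivative_def linear_scale)
qed

lemma pd_line_axis:
  assumes "f differentiable (at (x + t *\<^sub>R ex k))"
  shows "((\<lambda>t. f (x + t *\<^sub>R ex k)) has_vector_derivative pd k f (x + t *\<^sub>R ex k)) (at t)"
proof -
  have "(\<Sum>j\<in>UNIV. ex k $ j *\<^sub>R pd j f (x + t *\<^sub>R ex k)) = (\<Sum>j\<in>UNIV. if j = k then pd k f (x + t *\<^sub>R ex k) else 0)"
    by (intro sum.cong) (auto simp: axis_def)
  with pd_line[OF assms] show ?thesis by simp
qed

lemma pd_cong:
  assumes "open U" "x \<in> U" "\<And>y. y \<in> U \<Longrightarrow> f y = g y" shows "pd k f x = pd k g x"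
proof -
  have "open ((\<lambda>t::real. x + t *\<^sub>R ex k) -` U)"
    using assms(1) by (intro open_vimage continuous_intros)
  then have "\<forall>\<^sub>F t in nhds (0::real). x + t *\<^sub>R ex k \<in> U"
    unfolding eventually_nhds using assms(2)
    by (intro exI[of _ "(\<lambda>t::real. x + t *\<^sub>R ex k) -` U"]) auto
  then have "\<forall>\<^sub>F t in nhds (0::real). f (x + t *\<^sub>R ex k) = g (x + t *\<^sub>R ex k)"
    by (rule eventually_mono) (use assms(3) in auto)
  then show ?thesis
    unfolding pd_def by (intro vector_derivative_cong_eq) (auto elim: eventually_mono)
qed

lemma differentiable_cong_open:
  assumes "open U" "x \<in> U" "\<And>y. y \<in> U \<Longrightarrow> f y = g y" "f differentiable (at x)"
  shows "g differentiable (at x)"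
  using assms unfolding differentiable_def by (meson has_derivative_transform_within_open)

lemma pd_const: "pd k (\<lambda>y. c) x = 0"
  by (rule pd_eq) (rule has_derivative_const)

lemma pd_add:
  assumes "f differentiable (at x)" "g differentiable (at x)"
  shows "pd k (\<lambda>y. f y + g y) x = pd k f x + pd k g x"
proof -
  obtain f' g' where "(f has_derivative f') (at x)" "(g has_derivative g') (at x)"
    using assms differentiable_def by blast
  then show ?thesis using pd_eq[OF has_derivative_add] by (simp add: pd_eq)
qed

lemma pd_linear:
  assumes "bounded_linear h" "f differentiable (at x)"
  shows "pd k (\<lambda>y. h (f y)) x = h (pd k f x)"
proof -
  obtain f' where "(f has_derivative f') (at x)" using assms differentiable_def by blast
  then show ?thesis using pd_eq[OF bounded_linear.has_derivative[OF assms(1)]] by (simp add: pd_eq)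
qed

lemma pd_sum:
  assumes "finite I" "\<And>i. i \<in> I \<Longrightarrow> f i differentiable (at x)"
  shows "pd k (\<lambda>y. \<Sum>i\<in>I. f i y) x = (\<Sum>i\<in>I. pd k (f i) x)"
  using assms by (induct) (auto simp: pd_const pd_add differentiable_sum)

lemma pd_mult:
  fixes f g :: "real^3 \<Rightarrow> 'b::real_normed_algebra"
  assumes "f differentiable (at x)" "g differentiable (at x)"
  shows "pd k (\<lambda>y. f y * g y) x = pd k f x * g x + f x * pd k g x"
proof -
  obtain f' g' where "(f has_derivative f') (at x)" "(g has_derivative g') (at x)"
    using assms differentiable_def by blast
  then show ?thesis using pd_eq[OF has_derivative_mult] by (simp add: pd_eq add.commute)
qed

lemma differentiable_linear:
  assumes "bounded_linear h" "f differentiable (at x)" shows "(\<lambda>y. h (f y)) differentiable (at x)"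
  using assms unfolding differentiable_def by (blast intro: bounded_linear.has_derivative)

lemma hpd_append: "hpd (ks @ [k]) f = hpd ks (pd k f)"
  by (induct ks) auto

lemma Cinf_alt: "Cinf_on U f \<longleftrightarrow> (\<forall>ks. \<forall>x\<in>U. hpd ks f differentiable (at x))"
proof -
  have "continuous_on U (hpd ks f)" if "\<forall>x\<in>U. hpd ks f differentiable (at x)" for ks
    using that by (meson continuous_at_imp_continuous_on differentiable_imp_continuous_within)
  then show ?thesis unfolding Cinf_on_def by blast
qed

text \<open>Counts derivatives instead of listing them, so that closure under products is an
  induction on the order; along \<open>hpd\<close> one would need the full Leibniz formula.
  \<open>Ck n\<close> means that all derivatives up to order \<open>n\<close> are still
  differentiable.\<close>

primrec Ck :: "nat \<Rightarrow> (real^3) set \<Rightarrow> (real^3 \<Rightarrow> 'b::real_normed_vector) \<Rightarrow> bool" where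
  "Ck 0 U f \<longleftrightarrow> (\<forall>x\<in>U. f differentiable (at x))"
| "Ck (Suc n) U f \<longleftrightarrow> (\<forall>x\<in>U. f differentiable (at x)) \<and> (\<forall>k. Ck n U (pd k f))"

lemma Ck_differentiable: "Ck n U f \<Longrightarrow> x \<in> U \<Longrightarrow> f differentiable (at x)"
  by (cases n) auto

lemma Ck_mono: "Ck (Suc n) U f \<Longrightarrow> Ck n U f"
  by (induct n arbitrary: f) auto

text \<open>\<open>hpd\<close> adds derivatives on the outside while \<open>Ck\<close> takes them
  off next to \<open>f\<close>, hence the split of the list at its last element.\<close>

lemma Ck_hpd: "Ck n U f \<longleftrightarrow> (\<forall>ks. length ks \<le> n \<longrightarrow> (\<forall>x\<in>U. hpd ks f differentiable (at x)))"
proof (induct n arbitrary: f)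
  case (Suc n)
  have "(\<forall>ks. length ks \<le> Suc n \<longrightarrow> (\<forall>x\<in>U. hpd ks f differentiable (at x))) \<longleftrightarrow>
    (\<forall>x\<in>U. f differentiable (at x)) \<and> (\<forall>k ks. length ks \<le> n \<longrightarrow> (\<forall>x\<in>U. hpd (ks @ [k]) f differentiable (at x)))"
  proof (safe, goal_cases)
    case 1 then show ?case by (metis hpd.simps(1) le0 list.size(3))
  next
    case (3 ks x) then show ?case by (cases ks rule: rev_cases) auto
  qed auto
  then show ?case using Suc by (auto simp: hpd_append)
qed simp

lemma Cinf_Ck: "Cinf_on U f \<longleftrightarrow> (\<forall>n. Ck n U f)"
  unfolding Cinf_alt Ck_hpd by blast

lemma Cinf_differentiable: "Cinf_on U f \<Longrightarrow> x \<in> U \<Longrightarrow> f differentiable (at x)"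
  unfolding Cinf_Ck using Ck_differentiable by blast

lemma Cinf_hpd: "Cinf_on U f \<Longrightarrow> Cinf_on U (hpd ks f)"
proof (induct ks)
  case (Cons k ks) then show ?case unfolding Cinf_Ck by (metis Ck.simps(2) hpd.simps(2))
qed simp

lemma Cinf_pd: "Cinf_on U f \<Longrightarrow> Cinf_on U (pd k f)"
  using Cinf_hpd[of U f "[k]"] by simp

lemma Cinf_continuous: "Cinf_on U f \<Longrightarrow> continuous_on U f"
  unfolding Cinf_on_def by (metis hpd.simps(1))

lemma Cinf_subset: "Cinf_on U f \<Longrightarrow> V \<subseteq> U \<Longrightarrow> Cinf_on V f"
  unfolding Cinf_alt by blast

lemma Cinf_local:
  assumes "\<And>x. x \<in> U \<Longrightarrow> \<exists>V. x \<in> V \<and> Cinf_on V f" shows "Cinf_on U f"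
  using assms unfolding Cinf_alt by blast

lemma hpd_cong:
  assumes "open U" "\<And>y. y \<in> U \<Longrightarrow> f y = g y" "x \<in> U" shows "hpd ks f x = hpd ks g x"
  using assms by (induct ks arbitrary: x) (auto intro: pd_cong)

lemma Cinf_cong:
  assumes "open U" "\<And>y. y \<in> U \<Longrightarrow> f y = g y" "Cinf_on U f" shows "Cinf_on U g"
  using assms differentiable_cong_open[OF assms(1)] hpd_cong[OF assms(1)]
  unfolding Cinf_alt by metis

lemma Ck_cong:
  assumes "open U" "\<And>y. y \<in> U \<Longrightarrow> f y = g y" "Ck n U f" shows "Ck n U g"
  using assms differentiable_cong_open[OF assms(1)] hpd_cong[OF assms(1)]
  unfolding Ck_hpd by metis

lemma Ck_const: "Ck n U (\<lambda>y. c)"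
proof -
  have "hpd ks (\<lambda>y. c) = (\<lambda>y. if ks = [] then c else 0)" for ks
    by (induct ks) (auto simp: pd_const cong: if_cong)
  then show ?thesis unfolding Ck_hpd by simp
qed

lemma Ck_add: "open U \<Longrightarrow> Ck n U f \<Longrightarrow> Ck n U g \<Longrightarrow> Ck n U (\<lambda>y. f y + g y)"
proof (induct n arbitrary: f g)
  case (Suc n)
  have "Ck n U (pd k (\<lambda>y. f y + g y))" for k
    by (rule Ck_cong[OF Suc(2), of "\<lambda>y. pd k f y + pd k g y"]) (use Suc in \<open>auto simp: pd_add\<close>)
  then show ?case using Suc by (auto intro: differentiable_add)
qed (auto intro: differentiable_add)

lemma Ck_linear: "bounded_linear h \<Longrightarrow> open U \<Longrightarrow> Ck n U f \<Longrightarrow> Ck n U (\<lambda>y. h (f y))"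
proof (induct n arbitrary: f)
  case (Suc n)
  have "Ck n U (pd k (\<lambda>y. h (f y)))" for k
    by (rule Ck_cong[OF Suc(3), of "\<lambda>y. h (pd k f y)"]) (use Suc in \<open>auto simp: pd_linear\<close>)
  then show ?case using Suc by (auto intro: differentiable_linear)
qed (auto intro: differentiable_linear)

text \<open>The Leibniz rule leaves one factor undifferentiated; that factor has one order to spare,
  which \<open>Ck_mono\<close> discards before the induction hypothesis is used.\<close>

lemma Ck_mult:
  fixes f g :: "real^3 \<Rightarrow> 'b::real_normed_algebra"
  shows "open U \<Longrightarrow> Ck n U f \<Longrightarrow> Ck n U g \<Longrightarrow> Ck n U (\<lambda>y. f y * g y)"
proof (induct n arbitrary: f g)
  case (Suc n)
  have "Ck n U (pd k (\<lambda>y. f y * g y))" for k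
    by (rule Ck_cong[OF Suc(2), of "\<lambda>y. pd k f y * g y + f y * pd k g y"])
      (use Suc Ck_mono[OF Suc(3)] Ck_mono[OF Suc(4)] in \<open>auto simp: pd_mult intro!: Ck_add\<close>)
  then show ?case using Suc by (auto intro: differentiable_mult)
qed (auto intro: differentiable_mult)

named_theorems cinf

lemma Cinf_const[cinf]: "Cinf_on U (\<lambda>y. c)"
  by (simp add: Cinf_Ck Ck_const)

lemma Cinf_add[cinf]: "open U \<Longrightarrow> Cinf_on U f \<Longrightarrow> Cinf_on U g \<Longrightarrow> Cinf_on U (\<lambda>y. f y + g y)"
  by (simp add: Cinf_Ck Ck_add)

lemma Cinf_mult[cinf]:
  fixes f g :: "real^3 \<Rightarrow> 'b::real_normed_algebra"
  shows "open U \<Longrightarrow> Cinf_on U f \<Longrightarrow> Cinf_on U g \<Longrightarrow> Cinf_on U (\<lambda>y. f y * g y)"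
  by (simp add: Cinf_Ck Ck_mult)

lemma Cinf_linear: "bounded_linear h \<Longrightarrow> open U \<Longrightarrow> Cinf_on U f \<Longrightarrow> Cinf_on U (\<lambda>y. h (f y))"
  by (simp add: Cinf_Ck Ck_linear)

lemma Cinf_uminus[cinf]: "open U \<Longrightarrow> Cinf_on U f \<Longrightarrow> Cinf_on U (\<lambda>y. - f y)"
  by (rule Cinf_linear[OF bounded_linear_minus[OF bounded_linear_ident]])

lemma Cinf_diff[cinf]: "open U \<Longrightarrow> Cinf_on U f \<Longrightarrow> Cinf_on U g \<Longrightarrow> Cinf_on U (\<lambda>y. f y - g y)"
  using Cinf_add[of U f "\<lambda>y. - g y"] Cinf_uminus[of U g] by simp

lemma Cinf_sum[cinf]:
  "finite I \<Longrightarrow> open U \<Longrightarrow> (\<And>i. i \<in> I \<Longrightarrow> Cinf_on U (f i)) \<Longrightarrow> Cinf_on U (\<lambda>y. \<Sum>i\<in>I. f i y)"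
  by (induct rule: finite_induct) (auto intro!: cinf)

abbreviation cx :: "3 \<Rightarrow> real^3 \<Rightarrow> complex" where "cx k y \<equiv> complex_of_real (y $ k)"

lemma coord_derivative: "(cx a has_derivative (\<lambda>v. complex_of_real (v $ a))) (at x)"
  by (intro bounded_linear_imp_has_derivative bounded_linear_compose[OF bounded_linear_of_real]
      bounded_linear_vec_nth)

lemma pd_coord: "pd k (cx a) x = (if k = a then 1 else 0)"
  using pd_eq[OF coord_derivative] by (simp add: axis_def)

lemma Cinf_coord[cinf]: "Cinf_on U (cx a)"
proof -
  have *: "(\<lambda>y::real^3. complex_of_real (y $ a)) differentiable at x" for x
    using coord_derivative differentiable_def by blast
  have "hpd ks (cx a) = cx a \<or> (\<exists>c. hpd ks (cx a) = (\<lambda>y. c))" for ks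
  proof (induct ks)
    case (Cons k ks)
    have "pd k (cx a) = (\<lambda>y. if k = a then 1 else 0)" by (simp add: fun_eq_iff pd_coord)
    moreover have "pd k (\<lambda>y. c) = (\<lambda>y. 0)" for c :: complex by (simp add: fun_eq_iff pd_const)
    ultimately show ?case using Cons by auto
  qed simp
  then show ?thesis unfolding Cinf_alt using * by (metis differentiable_const)
qed

abbreviation cr :: "real^3 \<Rightarrow> complex" where "cr y \<equiv> complex_of_real (norm y)"

lemma cr_sq: "cr x * cr x = (\<Sum>a\<in>UNIV. cx a x * cx a x)"
proof -
  have "(norm x)\<^sup>2 = (\<Sum>a\<in>UNIV. (x $ a)\<^sup>2)"
    by (simp only: power2_norm_eq_inner inner_vec_def) (simp add: power2_eq_square)
  then show ?thesis by (metis (no_types, lifting) of_real_mult of_real_sum power2_eq_square sum.cong)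
qed

lemma differentiable_cr: "x \<noteq> 0 \<Longrightarrow> cr differentiable (at x)"
  by (rule differentiable_linear[OF bounded_linear_of_real]) simp

lemma pd_cr: assumes "x \<noteq> 0" shows "pd k cr x = cx k x / cr x"
proof -
  have "(norm has_derivative (\<lambda>h. h \<bullet> sgn x)) (at x)"
    using assms by (simp add: has_derivative_norm)
  then have "(cr has_derivative (\<lambda>h. complex_of_real (h \<bullet> sgn x))) (at x)"
    by (intro bounded_linear.has_derivative[OF bounded_linear_of_real])
  from pd_eq[OF this, of k] show ?thesis
    by (simp add: sgn_div_norm inner_axis' divide_inverse mult.commute)
qed

lemma differentiable_icr: "x \<noteq> 0 \<Longrightarrow> (\<lambda>y. 1 / cr y) differentiable (at x)"
  by (intro differentiable_divide differentiable_cr) auto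

text \<open>The derivative is a polynomial in the coordinates and \<open>1 / cr\<close> itself. This
  closes the induction for the smoothness of 1/r; that of r follows by writing r as r^2 times
  1/r.\<close>

lemma pd_icr: assumes "x \<noteq> 0" shows "pd k (\<lambda>y. 1 / cr y) x = - cx k x * (1 / cr x) * (1 / cr x) * (1 / cr x)"
proof -
  have "pd k (\<lambda>y. cr y * (1 / cr y)) x = pd k (\<lambda>y. 1) x"
    by (rule pd_cong[of "-{0}"]) (use assms in auto)
  then have "pd k cr x * (1 / cr x) + cr x * pd k (\<lambda>y. 1 / cr y) x = 0"
    using pd_mult[OF differentiable_cr differentiable_icr, of x k] assms by (simp add: pd_const)
  then show ?thesis using assms by (simp add: pd_cr field_simps eq_neg_iff_add_eq_0)
qed

lemma Cinf_icr0: "Cinf_on (-{0}) (\<lambda>y. 1 / cr y)"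
proof -
  have "Ck n (-{0}) (\<lambda>y. 1 / cr y)" for n
  proof (induct n)
    case (Suc n)
    have c: "Ck n (-{0}) (\<lambda>y. - cx k y)" for k
      using Cinf_uminus[OF _ Cinf_coord, of "-{0}" k] unfolding Cinf_Ck by auto
    have "Ck n (-{0}) (pd k (\<lambda>y. 1 / cr y))" for k
    proof (rule Ck_cong)
      show "Ck n (-{0}) (\<lambda>x. - cx k x * (1 / cr x) * (1 / cr x) * (1 / cr x))"
        using Suc c by (intro Ck_mult) auto
    qed (auto simp: pd_icr)
    then show ?case by (auto intro: differentiable_icr)
  qed (auto intro: differentiable_icr)
  then show ?thesis by (simp add: Cinf_Ck)
qed

lemma Cinf_icr[cinf]: "0 \<notin> U \<Longrightarrow> Cinf_on U (\<lambda>y. 1 / cr y)"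
  by (rule Cinf_subset[OF Cinf_icr0]) auto

lemma Cinf_cr[cinf]: assumes "open U" "0 \<notin> U" shows "Cinf_on U cr"
proof (rule Cinf_cong[OF assms(1)])
  show "Cinf_on U (\<lambda>x. (\<Sum>a\<in>UNIV. cx a x * cx a x) * (1 / cr x))"
    using assms by (intro cinf) auto
  fix y assume "y \<in> U"
  then have "cr y \<noteq> 0" using assms by auto
  then show "(\<Sum>a\<in>UNIV. cx a y * cx a y) * (1 / cr y) = cr y"
    unfolding cr_sq[symmetric] by simp
qed

section \<open>Symmetry of second partial derivatives\<close>

lemma vector_derivative_bound:
  fixes f :: "real \<Rightarrow> 'b::real_normed_vector"
  assumes "0 \<le> h" "\<And>t. 0 \<le> t \<Longrightarrow> t \<le> h \<Longrightarrow> (f has_vector_derivative f' t) (at t)"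
    "\<And>t. 0 \<le> t \<Longrightarrow> t \<le> h \<Longrightarrow> norm (f' t) \<le> B"
  shows "norm (f h - f 0) \<le> B * h"
proof (cases "h = 0")
  case False
  have "continuous_on {0..h} f"
    using assms(2) by (meson atLeastAtMost_iff continuous_at_imp_continuous_on has_vector_derivative_continuous)
  moreover have "((\<lambda>t. B * t) has_vector_derivative B) (at t)" for t
    by (auto simp: has_vector_derivative_def intro!: derivative_eq_intros)
  ultimately have "norm (f h - f 0) \<le> B * h - B * 0"
    using assms False by (intro differentiable_bound_general[where f' = f' and \<phi>' = "\<lambda>_. B"]) (auto intro!: continuous_intros)
  then show ?thesis by simp
qed simp

text \<open>Two mean value estimates: \<open>in1\<close> moves along \<open>ex j\<close> and
  compares the increment of \<open>pd i f\<close> with \<open>h\<close> times the mixed derivative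
  at \<open>x\<close>, by continuity of the latter; the second moves along \<open>ex i\<close> and
  integrates this comparison.\<close>

lemma second_difference:
  assumes U: "open U" "x \<in> U" and f: "Cinf_on U f" and e: "e > 0"
  shows "\<exists>d>0. \<forall>h. 0 < h \<and> h < d \<longrightarrow>
    norm (f (x + h *\<^sub>R ex i + h *\<^sub>R ex j) - f (x + h *\<^sub>R ex i) - (f (x + h *\<^sub>R ex j) - f x) - (h * h) *\<^sub>R pd j (pd i f) x) \<le> e * (h * h)"
proof -
  let ?c = "pd j (pd i f) x"
  have "continuous_on U (pd j (pd i f))" using f Cinf_continuous Cinf_pd by blast
  then have "isCont (pd j (pd i f)) x" using U by (simp add: continuous_on_eq_continuous_at)
  then obtain d1 where d1: "d1 > 0" "\<And>y. dist y x < d1 \<Longrightarrow> dist (pd j (pd i f) y) ?c < e"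
    unfolding continuous_at_eps_delta using e by blast
  obtain d2 where d2: "d2 > 0" "ball x d2 \<subseteq> U" using U open_contains_ball by blast
  define d where "d = min d1 d2 / 2"
  have d: "d > 0" using d1 d2 by (simp add: d_def)
  have near: "x + s *\<^sub>R ex i + t *\<^sub>R ex j \<in> U" "dist (x + s *\<^sub>R ex i + t *\<^sub>R ex j) x < d1"
    if "0 \<le> s" "s < d" "0 \<le> t" "t < d" for s t
  proof -
    have "norm (s *\<^sub>R ex i + t *\<^sub>R ex j) \<le> norm (s *\<^sub>R ex i) + norm (t *\<^sub>R ex j)" by (rule norm_triangle_ineq)
    also have "\<dots> = s + t" using that by (simp add: norm_axis_1)
    also have "\<dots> < min d1 d2" using that by (simp add: d_def)
    finally have "norm (s *\<^sub>R ex i + t *\<^sub>R ex j) < min d1 d2" .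
    then have n: "dist (x + s *\<^sub>R ex i + t *\<^sub>R ex j) x < min d1 d2" by (simp add: dist_norm algebra_simps)
    then show "dist (x + s *\<^sub>R ex i + t *\<^sub>R ex j) x < d1" by simp
    have "x + s *\<^sub>R ex i + t *\<^sub>R ex j \<in> ball x d2" using n by (simp add: dist_commute)
    then show "x + s *\<^sub>R ex i + t *\<^sub>R ex j \<in> U" using d2 by blast
  qed
  show ?thesis
  proof (intro exI[of _ d] conjI d allI impI)
    fix h assume h: "0 < h \<and> h < d"
    have in1: "norm (pd i f (x + s *\<^sub>R ex i + h *\<^sub>R ex j) - pd i f (x + s *\<^sub>R ex i) - h *\<^sub>R ?c) \<le> e * h"
      if s: "0 \<le> s" "s \<le> h" for s
    proof -
      let ?g = "\<lambda>t. pd i f (x + s *\<^sub>R ex i + t *\<^sub>R ex j) - t *\<^sub>R ?c"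
      have "norm (?g h - ?g 0) \<le> e * h"
      proof (rule vector_derivative_bound[where f' = "\<lambda>t. pd j (pd i f) (x + s *\<^sub>R ex i + t *\<^sub>R ex j) - ?c"])
        fix t assume t: "0 \<le> t" "t \<le> h"
        note nr = near[of s t]
        have "pd i f differentiable (at (x + s *\<^sub>R ex i + t *\<^sub>R ex j))"
          using nr s t h Cinf_differentiable[OF Cinf_pd[OF f]] by auto
        then show "(?g has_vector_derivative pd j (pd i f) (x + s *\<^sub>R ex i + t *\<^sub>R ex j) - ?c) (at t)"
          using pd_line_axis by (auto intro!: derivative_eq_intros)
        show "norm (pd j (pd i f) (x + s *\<^sub>R ex i + t *\<^sub>R ex j) - ?c) \<le> e"
          using d1(2)[of "x + s *\<^sub>R ex i + t *\<^sub>R ex j"] nr s t h by (simp add: dist_norm)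
      qed (use h in simp)
      then show ?thesis by (simp add: algebra_simps)
    qed
    let ?g = "\<lambda>s. f (x + h *\<^sub>R ex j + s *\<^sub>R ex i) - f (x + s *\<^sub>R ex i) - s *\<^sub>R (h *\<^sub>R ?c)"
    have "norm (?g h - ?g 0) \<le> (e * h) * h"
    proof (rule vector_derivative_bound[where f' = "\<lambda>s. pd i f (x + h *\<^sub>R ex j + s *\<^sub>R ex i) - pd i f (x + s *\<^sub>R ex i) - h *\<^sub>R ?c"])
      fix s assume s: "0 \<le> s" "s \<le> h"
      have "f differentiable (at (x + h *\<^sub>R ex j + s *\<^sub>R ex i))"
        using near(1)[of s h] s h Cinf_differentiable[OF f] by (simp add: add.assoc add.commute add.left_commute)
      moreover have "f differentiable (at (x + s *\<^sub>R ex i))"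
        using near(1)[of s 0] s h Cinf_differentiable[OF f] by simp
      ultimately show "(?g has_vector_derivative pd i f (x + h *\<^sub>R ex j + s *\<^sub>R ex i) - pd i f (x + s *\<^sub>R ex i) - h *\<^sub>R ?c) (at s)"
        using pd_line_axis by (auto intro!: derivative_eq_intros)
      show "norm (pd i f (x + h *\<^sub>R ex j + s *\<^sub>R ex i) - pd i f (x + s *\<^sub>R ex i) - h *\<^sub>R ?c) \<le> e * h"
        using in1[OF s] by (simp add: add.assoc add.commute add.left_commute)
    qed (use h in simp)
    then show "norm (f (x + h *\<^sub>R ex i + h *\<^sub>R ex j) - f (x + h *\<^sub>R ex i) - (f (x + h *\<^sub>R ex j) - f x) - (h * h) *\<^sub>R ?c) \<le> e * (h * h)"
      by (simp add: algebra_simps)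
  qed
qed

text \<open>The second difference is symmetric in \<open>i\<close> and \<open>j\<close>, which forces the mixed derivatives to agree.\<close>

lemma pd_commute:
  assumes U: "open U" "x \<in> U" and f: "Cinf_on U f"
  shows "pd i (pd j f) x = pd j (pd i f) x"
proof -
  have "dist (pd i (pd j f) x) (pd j (pd i f) x) \<le> 2 * e" if e0: "e > 0" for e
  proof -
    obtain d1 where d1: "d1 > 0" "\<And>h. 0 < h \<and> h < d1 \<Longrightarrow>
      norm (f (x + h *\<^sub>R ex i + h *\<^sub>R ex j) - f (x + h *\<^sub>R ex i) - (f (x + h *\<^sub>R ex j) - f x) - (h * h) *\<^sub>R pd j (pd i f) x) \<le> e * (h * h)"
      using second_difference[OF U f e0, of i j] by blast
    obtain d2 where d2: "d2 > 0" "\<And>h. 0 < h \<and> h < d2 \<Longrightarrow>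
      norm (f (x + h *\<^sub>R ex j + h *\<^sub>R ex i) - f (x + h *\<^sub>R ex j) - (f (x + h *\<^sub>R ex i) - f x) - (h * h) *\<^sub>R pd i (pd j f) x) \<le> e * (h * h)"
      using second_difference[OF U f e0, of j i] by blast
    define h where "h = min d1 d2 / 2"
    have h: "0 < h" "h < d1" "h < d2" using d1 d2 by (auto simp: h_def)
    let ?D = "f (x + h *\<^sub>R ex i + h *\<^sub>R ex j) - f (x + h *\<^sub>R ex i) - (f (x + h *\<^sub>R ex j) - f x)"
    have 1: "norm (?D - (h * h) *\<^sub>R pd j (pd i f) x) \<le> e * (h * h)" using d1 h by blast
    have 2: "norm (?D - (h * h) *\<^sub>R pd i (pd j f) x) \<le> e * (h * h)"
      using d2(2)[of h] h by (simp add: algebra_simps)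
    have "(h * h) * dist (pd i (pd j f) x) (pd j (pd i f) x)
        = norm ((?D - (h * h) *\<^sub>R pd j (pd i f) x) - (?D - (h * h) *\<^sub>R pd i (pd j f) x))"
      using h by (simp add: dist_norm scaleR_diff_right[symmetric] abs_mult)
    also have "\<dots> \<le> e * (h * h) + e * (h * h)"
      using norm_triangle_ineq4 1 2 by (smt (verit))
    finally have "(h * h) * dist (pd i (pd j f) x) (pd j (pd i f) x) \<le> (h * h) * (2 * e)" by (simp add: algebra_simps)
    then show ?thesis using h by simp
  qed
  \<comment> \<open>With \<open>e\<close> a quarter of the distance, a positive distance would be at
    most half of itself.\<close>
  from this[of "dist (pd i (pd j f) x) (pd j (pd i f) x) / 4"] show ?thesis
    by (cases "pd i (pd j f) x = pd j (pd i f) x") (auto simp: zero_less_dist_iff)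
qed

lemma pd_uminus:
  "f differentiable (at x) \<Longrightarrow> pd k (\<lambda>y. - f y) x = - pd k f x"
  by (rule pd_linear[OF bounded_linear_minus[OF bounded_linear_ident]])

lemma pd_diff:
  "f differentiable (at x) \<Longrightarrow> g differentiable (at x) \<Longrightarrow> pd k (\<lambda>y. f y - g y) x = pd k f x - pd k g x"
  using pd_add[of f x "\<lambda>y. - g y"] by (simp add: pd_uminus)

lemma pd_cnj: "f differentiable (at x) \<Longrightarrow> pd k (\<lambda>y. cnj (f y)) x = cnj (pd k f x)"
  by (rule pd_linear[OF bounded_linear_cnj])

lemmas pd_rules = pd_const pd_add pd_diff pd_uminus pd_mult pd_coord pd_cnj

lemma sum_kd:
  fixes f :: "3 \<Rightarrow> complex"
  shows "(\<Sum>k\<in>UNIV. (if a = k then 1 else 0) * f k) = f a"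
proof -
  have "(\<Sum>k\<in>UNIV. (if a = k then 1 else 0) * f k) = (\<Sum>k\<in>UNIV. if a = k then f k else 0)"
    by (intro sum.cong) auto
  then show ?thesis by simp
qed

lemma coord_differentiable: "cx k differentiable (at x)"
  using coord_derivative differentiable_def by blast

lemma cnj_differentiable: "f differentiable (at x) \<Longrightarrow> (\<lambda>y. cnj (f y)) differentiable (at x)"
  by (rule differentiable_linear[OF bounded_linear_cnj])

lemmas diff_rules = coord_differentiable cnj_differentiable

lemma pd_commute3:
  assumes U: "open U" "x \<in> U" and f: "Cinf_on U f"
  shows "pd a (pd b (pd c f)) x = pd c (pd a (pd b f)) x"
proof -
  have "pd a (pd b (pd c f)) x = pd a (pd c (pd b f)) x"
    by (rule pd_cong[OF U]) (rule pd_commute[OF U(1) _ f])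
  also have "\<dots> = pd c (pd a (pd b f)) x" by (rule pd_commute[OF U Cinf_pd[OF f]])
  finally show ?thesis .
qed

text \<open>\<open>sq\<close> is \<open>r\<^sup>2\<close>, written as a polynomial because \<open>norm\<close> is not smooth at the origin;
  \<open>Lop\<close> is half the Laplacian of the unit sphere.\<close>

definition sq :: "real^3 \<Rightarrow> complex" where "sq y = (\<Sum>c\<in>UNIV. cx c y * cx c y)"

definition Lop :: "(real^3 \<Rightarrow> complex) \<Rightarrow> real^3 \<Rightarrow> complex" where
  "Lop u y = (1/2) * (sq y * (\<Sum>a\<in>UNIV. pd a (pd a u) y)
     - (\<Sum>a\<in>UNIV. \<Sum>c\<in>UNIV. cx a y * cx c y * pd a (pd c u) y)) - (\<Sum>a\<in>UNIV. cx a y * pd a u y)"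

lemma Cinf_sq[cinf]: "open U \<Longrightarrow> Cinf_on U sq"
  unfolding sq_def by (intro cinf) auto

lemma Cinf_radd[cinf]: "open U \<Longrightarrow> Cinf_on U f \<Longrightarrow> Cinf_on U (radd f)"
  unfolding radd_def by (intro cinf Cinf_pd) auto

lemma radd_cong:
  assumes "open U" "x \<in> U" "\<And>y. y \<in> U \<Longrightarrow> f y = g y" shows "radd f x = radd g x"
  using pd_cong[OF assms] by (simp add: radd_def)

lemma Cinf_Lop[cinf]: "open U \<Longrightarrow> Cinf_on U f \<Longrightarrow> Cinf_on U (Lop f)"
  unfolding Lop_def by (intro cinf Cinf_pd) auto

lemma sq_cr: "sq x = cr x * cr x"
  by (simp add: sq_def cr_sq)

lemma pd_sq: "pd k sq x = 2 * cx k x"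
  unfolding sq_def by (simp add: pd_sum pd_rules diff_rules sum.distrib if_distrib cong: if_cong)

lemma sq_differentiable: "sq differentiable (at x)"
  unfolding sq_def by (intro differentiable_sum) (auto intro!: differentiable_mult diff_rules)

lemma pd_radd:
  assumes U: "open U" "x \<in> U" and f: "Cinf_on U f"
  shows "pd a (radd f) x = pd a f x + radd (pd a f) x"
proof -
  have d: "pd k f differentiable (at x)" for k using Cinf_differentiable[OF Cinf_pd[OF f] U(2)] .
  have "pd a (radd f) x = (\<Sum>k\<in>UNIV. (if a = k then 1 else 0) * pd k f x + cx k x * pd a (pd k f) x)"
    unfolding radd_def by (simp add: pd_sum pd_rules diff_rules d)
  also have "\<dots> = pd a f x + (\<Sum>k\<in>UNIV. cx k x * pd a (pd k f) x)"
    by (simp add: sum.distrib sum_kd)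
  also have "(\<Sum>k\<in>UNIV. cx k x * pd a (pd k f) x) = radd (pd a f) x"
    unfolding radd_def using pd_commute[OF U f] by (intro sum.cong) auto
  finally show ?thesis .
qed

lemma pd_pd_radd:
  assumes U: "open U" "x \<in> U" and f: "Cinf_on U f"
  shows "pd b (pd a (radd f)) x = 2 * pd b (pd a f) x + radd (pd b (pd a f)) x"
proof -
  have "pd b (pd a (radd f)) x = pd b (\<lambda>y. pd a f y + radd (pd a f) y) x"
    by (rule pd_cong[OF U]) (rule pd_radd[OF U(1) _ f])
  also have "\<dots> = pd b (pd a f) x + pd b (radd (pd a f)) x"
    by (rule pd_add[OF Cinf_differentiable[OF Cinf_pd[OF f] U(2)] Cinf_differentiable[OF Cinf_radd[OF U(1) Cinf_pd[OF f]] U(2)]])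
  also have "\<dots> = 2 * pd b (pd a f) x + radd (pd b (pd a f)) x"
    using pd_radd[OF U Cinf_pd[OF f]] by simp
  finally show ?thesis .
qed

text \<open>The summand \<open>f\<close> cancels the first-order term \<open>pd b f\<close> that
  comes from the radial part of \<open>Lop f\<close>. Only derivatives of order two and three
  remain, which is the form met when edth-bar is applied to edth^2 of a scalar.\<close>

lemma pd_Lop:
  assumes U: "open U" "x \<in> U" and f: "Cinf_on U f"
  shows "pd b (\<lambda>y. Lop f y + f y) x = cx b x * (\<Sum>a\<in>UNIV. pd a (pd a f) x)
     + (1/2) * (sq x * (\<Sum>a\<in>UNIV. pd b (pd a (pd a f)) x) - (\<Sum>a\<in>UNIV. \<Sum>c\<in>UNIV. cx a x * cx c x * pd b (pd a (pd c f)) x))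
     - 2 * (\<Sum>a\<in>UNIV. cx a x * pd b (pd a f) x)"
proof -
  have d1: "f differentiable (at x)" using Cinf_differentiable[OF f U(2)] .
  have d2: "pd k f differentiable (at x)" for k using Cinf_differentiable[OF Cinf_pd[OF f] U(2)] .
  have d3: "pd j (pd k f) differentiable (at x)" for j k using Cinf_differentiable[OF Cinf_pd[OF Cinf_pd[OF f]] U(2)] .
  have e: "pd b (\<lambda>y. \<Sum>a\<in>UNIV. \<Sum>c\<in>UNIV. cx a y * cx c y * pd a (pd c f) y) x
     = 2 * (\<Sum>a\<in>UNIV. cx a x * pd b (pd a f) x) + (\<Sum>a\<in>UNIV. \<Sum>c\<in>UNIV. cx a x * cx c x * pd b (pd a (pd c f)) x)"
  proof -
    have "pd b (\<lambda>y. \<Sum>a\<in>UNIV. \<Sum>c\<in>UNIV. cx a y * cx c y * pd a (pd c f) y) x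
      = (\<Sum>a\<in>UNIV. \<Sum>c\<in>UNIV. (if b = a then cx c x * pd a (pd c f) x else 0)) 
      + (\<Sum>a\<in>UNIV. \<Sum>c\<in>UNIV. (if b = c then cx a x * pd a (pd c f) x else 0))
      + (\<Sum>a\<in>UNIV. \<Sum>c\<in>UNIV. cx a x * cx c x * pd b (pd a (pd c f)) x)"
    proof -
      have "pd b (\<lambda>y. \<Sum>a\<in>UNIV. \<Sum>c\<in>UNIV. cx a y * cx c y * pd a (pd c f) y) x
        = (\<Sum>a\<in>UNIV. \<Sum>c\<in>UNIV. ((if b = a then 1 else 0) * cx c x + cx a x * (if b = c then 1 else 0)) * pd a (pd c f) x
            + cx a x * cx c x * pd b (pd a (pd c f)) x)"
        by (simp add: pd_sum pd_rules diff_rules d3 differentiable_sum)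
      then show ?thesis unfolding sum.distrib[symmetric] by (simp only:) (intro sum.cong refl, auto simp: algebra_simps)
    qed
    moreover have "(\<Sum>a\<in>UNIV. \<Sum>c\<in>UNIV. (if b = a then cx c x * pd a (pd c f) x else 0)) = (\<Sum>c\<in>UNIV. cx c x * pd b (pd c f) x)"
      by (subst sum.swap) simp
    moreover have "(\<Sum>a\<in>UNIV. \<Sum>c\<in>UNIV. (if b = c then cx a x * pd a (pd c f) x else 0)) = (\<Sum>c\<in>UNIV. cx c x * pd b (pd c f) x)"
      using pd_commute[OF U f] by simp
    ultimately show ?thesis by simp
  qed
  have dd: "(\<lambda>y. \<Sum>a\<in>UNIV. \<Sum>c\<in>UNIV. cx a y * cx c y * pd a (pd c f) y) differentiable (at x)"
    by (simp add: differentiable_sum diff_rules d3)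
  have e2: "pd b (\<lambda>y. \<Sum>a\<in>UNIV. cx a y * pd a f y) x = pd b f x + (\<Sum>a\<in>UNIV. cx a x * pd b (pd a f) x)"
    by (simp add: pd_sum pd_rules diff_rules d2 sum.distrib sum_kd)
  show ?thesis
    unfolding Lop_def
    by (simp add: pd_rules e e2 dd differentiable_sum diff_rules d1 d2 d3 sq_differentiable pd_sum pd_sq del: times_divide_eq_left)
      (simp add: algebra_simps)
qed

text \<open>Grouped so that the derivative of r stands behind the factor \<open>cx k x\<close>:
  contraction with a vector orthogonal to \<open>x\<close> removes it at once.\<close>

lemma pd_cr_mult:
  "x \<noteq> 0 \<Longrightarrow> u differentiable (at x) \<Longrightarrow> pd k (\<lambda>y. cr y * u y) x = cx k x * (u x / cr x) + cr x * pd k u x"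
  by (simp add: pd_mult pd_cr differentiable_cr)

lemma pd_sq_mult:
  "u differentiable (at x) \<Longrightarrow> pd k (\<lambda>y. sq y * u y) x = cx k x * (2 * u x) + sq x * pd k u x"
  by (subst pd_mult) (auto simp: sq_differentiable pd_sq)

section \<open>The frame\<close>

locale frame =
  fixes U :: "(real^3) set" and m :: "real^3 \<Rightarrow> complex^3"
  assumes adapted: "adapted_frame U m"
begin

abbreviation M :: "3 \<Rightarrow> real^3 \<Rightarrow> complex" where "M a y \<equiv> m y $ a"

lemma openU: "open U" and U0: "0 \<notin> U" and Cinf_M: "Cinf_on U (M b)"
  using adapted unfolding adapted_frame_def by auto

lemma U_nz: "x \<in> U \<Longrightarrow> x \<noteq> 0" using U0 by auto

lemma cr_nz: "x \<in> U \<Longrightarrow> cr x \<noteq> 0" using U0 by auto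

lemma nvec_cx: "complex_of_real (nvec x $ b) = cx b x / cr x"
  by (simp add: nvec_def)

lemma M_rel:
  assumes "x \<in> U"
  shows "(\<Sum>b\<in>UNIV. M b x * M b x) = 0" "(\<Sum>b\<in>UNIV. cnj (M b x) * cnj (M b x)) = 0"
    "(\<Sum>b\<in>UNIV. cx b x * M b x) = 0" "(\<Sum>b\<in>UNIV. cx b x * cnj (M b x)) = 0"
    "(\<Sum>b\<in>UNIV. M b x * cnj (M b x)) = 1" "radd (M b) x = 0"
proof -
  have *: "(\<Sum>b\<in>UNIV. complex_of_real (nvec x $ b) * v b) = (\<Sum>b\<in>UNIV. cx b x * v b) / cr x" for v
    by (simp add: nvec_cx sum_divide_distrib)
  have "(\<Sum>b\<in>UNIV. M b x * M b x) = 0 \<and> (\<Sum>b\<in>UNIV. cnj (M b x) * cnj (M b x)) = 0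
      \<and> (\<Sum>b\<in>UNIV. complex_of_real (nvec x $ b) * M b x) = 0
      \<and> (\<Sum>b\<in>UNIV. complex_of_real (nvec x $ b) * cnj (M b x)) = 0
      \<and> (\<Sum>b\<in>UNIV. M b x * cnj (M b x)) = 1 \<and> (\<forall>b. radd (M b) x = 0)"
    using adapted assms unfolding adapted_frame_def by blast
  then show "(\<Sum>b\<in>UNIV. M b x * M b x) = 0" "(\<Sum>b\<in>UNIV. cnj (M b x) * cnj (M b x)) = 0"
    "(\<Sum>b\<in>UNIV. cx b x * M b x) = 0" "(\<Sum>b\<in>UNIV. cx b x * cnj (M b x)) = 0"
    "(\<Sum>b\<in>UNIV. M b x * cnj (M b x)) = 1" "radd (M b) x = 0"
    unfolding * using cr_nz[OF assms] by auto
qed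

lemma M_differentiable: "x \<in> U \<Longrightarrow> M b differentiable (at x)"
  using Cinf_differentiable[OF Cinf_M] .

text \<open>The matrix with rows \<open>n\<close>, \<open>m\<close>, \<open>cnj m\<close> and the one with columns \<open>n\<close>, \<open>cnj m\<close>, \<open>m\<close> are inverse to each other.\<close>

lemma completeness:
  assumes x: "x \<in> U"
  shows "M a x * cnj (M b x) + cnj (M a x) * M b x + cx a x * cx b x / sq x = (if a = b then 1 else 0)"
proof -
  define n where "n k = cx k x / cr x" for k
  have nn: "(\<Sum>k\<in>UNIV. n k * n k) = 1"
    using cr_nz[OF x] by (simp add: n_def sum_divide_distrib[symmetric] cr_sq[symmetric])
  have nm: "(\<Sum>k\<in>UNIV. n k * M k x) = 0" "(\<Sum>k\<in>UNIV. n k * cnj (M k x)) = 0"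
    using M_rel(3,4)[OF x] by (auto simp: n_def sum_divide_distrib[symmetric])
  define P :: "complex^3^3" where
    "P = (\<chi> i. if i = 1 then (\<chi> k. n k) else if i = 2 then (\<chi> k. M k x) else (\<chi> k. cnj (M k x)))"
  define Q :: "complex^3^3" where
    "Q = (\<chi> k. \<chi> j. if j = 1 then n k else if j = 2 then cnj (M k x) else M k x)"
  have "P ** Q = mat 1"
    using nn nm M_rel(1,2,5)[OF x]
    by (simp add: vec_eq_iff forall_3 matrix_matrix_mult_def mat_def P_def Q_def mult.commute)
  then have "Q ** P = mat 1" using matrix_left_right_inverse by blast
  then have "(Q ** P) $ a $ b = mat 1 $ a $ b" by simp
  then have "n a * n b + cnj (M a x) * M b x + M a x * cnj (M b x) = (if a = b then 1 else 0)"
    by (simp add: matrix_matrix_mult_def P_def Q_def sum_3 mat_def)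
  then show ?thesis by (simp add: n_def sq_cr algebra_simps)
qed

lemma sum_expand:
  assumes x: "x \<in> U"
  shows "d b = M b x * (\<Sum>e\<in>UNIV. cnj (M e x) * d e) + cnj (M b x) * (\<Sum>e\<in>UNIV. M e x * d e)
     + cx b x / sq x * (\<Sum>e\<in>UNIV. cx e x * d e)"
proof -
  have "d b = (\<Sum>e\<in>UNIV. (if b = e then 1 else 0) * d e)" by (simp add: sum_kd)
  also have "\<dots> = (\<Sum>e\<in>UNIV. (M b x * cnj (M e x) + cnj (M b x) * M e x + cx b x * cx e x / sq x) * d e)"
    by (intro sum.cong refl) (simp add: completeness[OF x])
  also have "\<dots> = M b x * (\<Sum>e\<in>UNIV. cnj (M e x) * d e) + cnj (M b x) * (\<Sum>e\<in>UNIV. M e x * d e)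
     + cx b x / sq x * (\<Sum>e\<in>UNIV. cx e x * d e)"
    by (simp add: sum_distrib_left sum.distrib[symmetric] algebra_simps)
  finally show ?thesis .
qed

text \<open>A symmetric tensor sees only the symmetric part of \<open>cnj (M a x) * M b x\<close>,
  which by completeness is half the projection orthogonal to \<open>x\<close>. This is the origin of
  the factor 1/2 in \<open>Lop\<close>.\<close>

lemma M_M_sym:
  assumes x: "x \<in> U" and T: "\<And>a b. T a b = T b a"
  shows "(\<Sum>a\<in>UNIV. \<Sum>b\<in>UNIV. cnj (M a x) * M b x * T a b)
    = (1/2) * ((\<Sum>a\<in>UNIV. T a a) - (\<Sum>a\<in>UNIV. \<Sum>b\<in>UNIV. cx a x * cx b x * T a b) / sq x)"
proof -
  let ?S = "\<Sum>a\<in>UNIV. \<Sum>b\<in>UNIV. cnj (M a x) * M b x * T a b"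
  have "?S = (\<Sum>a\<in>UNIV. \<Sum>b\<in>UNIV. M a x * cnj (M b x) * T a b)"
    by (subst sum.swap) (simp add: T mult.commute)
  then have "2 * ?S = (\<Sum>a\<in>UNIV. \<Sum>b\<in>UNIV. (M a x * cnj (M b x) + cnj (M a x) * M b x) * T a b)"
    by (simp add: sum.distrib distrib_right)
  also have "\<dots> = (\<Sum>a\<in>UNIV. \<Sum>b\<in>UNIV. ((if a = b then 1 else 0) - cx a x * cx b x / sq x) * T a b)"
    by (intro sum.cong refl) (simp add: completeness[OF x, symmetric])
  also have "\<dots> = (\<Sum>a\<in>UNIV. T a a) - (\<Sum>a\<in>UNIV. \<Sum>b\<in>UNIV. cx a x * cx b x * T a b) / sq x"
    unfolding left_diff_distrib sum_subtractf sum_kd by (simp add: sum_divide_distrib)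
  finally show ?thesis by (simp add: mult.commute)
qed

text \<open>The spin connection: the \<open>m\<close>-component of the derivative of
  \<open>m\<close> along \<open>v\<close>. The direction is complex and arbitrary, so that
  \<open>m\<close>, \<open>cnj m\<close> and \<open>x\<close> can all be inserted.\<close>

definition conn :: "(3 \<Rightarrow> complex) \<Rightarrow> real^3 \<Rightarrow> complex" where
  "conn v x = (\<Sum>k\<in>UNIV. v k * (\<Sum>e\<in>UNIV. cnj (M e x) * pd k (M e) x))"

lemma pd_M_rel:
  assumes x: "x \<in> U"
  shows "(\<Sum>b\<in>UNIV. M b x * pd k (M b) x) = 0"
    "(\<Sum>b\<in>UNIV. cx b x * pd k (M b) x) = - M k x"
    "(\<Sum>b\<in>UNIV. M b x * cnj (pd k (M b) x)) = - (\<Sum>b\<in>UNIV. cnj (M b x) * pd k (M b) x)"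
proof -
  have "pd k (\<lambda>y. \<Sum>b\<in>UNIV. M b y * M b y) x = pd k (\<lambda>y. 0) x"
    by (rule pd_cong[OF openU x]) (rule M_rel(1))
  then have "2 * (\<Sum>b\<in>UNIV. M b x * pd k (M b) x) = 0"
    by (simp add: pd_sum pd_rules M_differentiable x sum_distrib_left mult.commute)
  then show "(\<Sum>b\<in>UNIV. M b x * pd k (M b) x) = 0" by simp
  have "pd k (\<lambda>y. \<Sum>b\<in>UNIV. cx b y * M b y) x = pd k (\<lambda>y. 0) x"
    by (rule pd_cong[OF openU x]) (rule M_rel(3))
  then have "M k x + (\<Sum>b\<in>UNIV. cx b x * pd k (M b) x) = 0"
    by (simp add: pd_sum pd_rules diff_rules M_differentiable x sum.distrib sum_kd)
  then show "(\<Sum>b\<in>UNIV. cx b x * pd k (M b) x) = - M k x" by (simp add: add_eq_0_iff)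
  have "pd k (\<lambda>y. \<Sum>b\<in>UNIV. M b y * cnj (M b y)) x = pd k (\<lambda>y. 1) x"
    by (rule pd_cong[OF openU x]) (rule M_rel(5))
  then have "(\<Sum>b\<in>UNIV. cnj (M b x) * pd k (M b) x) + (\<Sum>b\<in>UNIV. M b x * cnj (pd k (M b) x)) = 0"
    by (simp add: pd_sum pd_rules diff_rules M_differentiable x sum.distrib mult.commute)
  then show "(\<Sum>b\<in>UNIV. M b x * cnj (pd k (M b) x)) = - (\<Sum>b\<in>UNIV. cnj (M b x) * pd k (M b) x)"
    by (simp add: add_eq_0_iff)
qed

text \<open>Frame components of the derivative of \<open>m\<close>. There is none along
  \<open>cnj m\<close>, because m_b m^b = 0 gives m_b dm^b = 0; the radial one expresses that
  \<open>m\<close> stays tangent to the spheres, x_b m^b = 0.\<close>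

lemma dir_M:
  assumes x: "x \<in> U"
  shows "(\<Sum>k\<in>UNIV. v k * pd k (M b) x) = conn v x * M b x - (\<Sum>k\<in>UNIV. v k * M k x) / sq x * cx b x"
proof -
  let ?d = "\<lambda>b. \<Sum>k\<in>UNIV. v k * pd k (M b) x"
  have sw: "(\<Sum>e\<in>UNIV. w e * ?d e) = (\<Sum>k\<in>UNIV. v k * (\<Sum>e\<in>UNIV. w e * pd k (M e) x))" for w
    by (simp add: sum_distrib_left) (subst sum.swap, simp add: algebra_simps)
  show ?thesis
    using sum_expand[OF x, of ?d b] unfolding sw
    by (simp add: pd_M_rel[OF x] conn_def sum_negf mult.commute)
qed

text \<open>The \<open>conn\<close> term is the one that edth subtracts for spin weight 1. Besides
  the derivative of the components, a radial correction remains, governed by the contraction of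
  \<open>v\<close> with \<open>m\<close>.\<close>

lemma dir_M1:
  assumes x: "x \<in> U" and W: "\<And>a. Cinf_on U (W a)"
  shows "(\<Sum>k\<in>UNIV. v k * pd k (\<lambda>y. \<Sum>a\<in>UNIV. M a y * W a y) x)
   = conn v x * (\<Sum>a\<in>UNIV. M a x * W a x) - (\<Sum>k\<in>UNIV. v k * M k x) / sq x * (\<Sum>a\<in>UNIV. cx a x * W a x)
     + (\<Sum>k\<in>UNIV. \<Sum>a\<in>UNIV. v k * M a x * pd k (W a) x)"
proof -
  have d: "W a differentiable (at x)" for a using Cinf_differentiable[OF W x] .
  have "(\<Sum>k\<in>UNIV. v k * pd k (\<lambda>y. \<Sum>a\<in>UNIV. M a y * W a y) x)
     = (\<Sum>k\<in>UNIV. \<Sum>a\<in>UNIV. v k * pd k (M a) x * W a x) + (\<Sum>k\<in>UNIV. \<Sum>a\<in>UNIV. v k * M a x * pd k (W a) x)"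
    by (simp add: pd_sum pd_rules d M_differentiable x sum_distrib_left sum.distrib algebra_simps)
  also have "(\<Sum>k\<in>UNIV. \<Sum>a\<in>UNIV. v k * pd k (M a) x * W a x) = (\<Sum>a\<in>UNIV. (\<Sum>k\<in>UNIV. v k * pd k (M a) x) * W a x)"
    by (subst sum.swap) (simp add: sum_distrib_right)
  also have "\<dots> = conn v x * (\<Sum>a\<in>UNIV. M a x * W a x) - (\<Sum>k\<in>UNIV. v k * M k x) / sq x * (\<Sum>a\<in>UNIV. cx a x * W a x)"
    unfolding dir_M[OF x] left_diff_distrib sum_subtractf sum_distrib_left by (simp add: mult.assoc)
  finally show ?thesis .
qed

text \<open>\<open>dir_M1\<close> is used once per factor of \<open>m\<close>, which yields the
  connection twice, as spin weight 2 requires. Symmetry of \<open>W\<close> identifies the two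
  radial corrections.\<close>

lemma dir_M2:
  assumes x: "x \<in> U" and W: "\<And>a b. Cinf_on U (W a b)" and sym: "\<And>a b. W a b x = W b a x"
  shows "(\<Sum>k\<in>UNIV. v k * pd k (\<lambda>y. \<Sum>a\<in>UNIV. \<Sum>b\<in>UNIV. M a y * M b y * W a b y) x)
   = 2 * conn v x * (\<Sum>a\<in>UNIV. \<Sum>b\<in>UNIV. M a x * M b x * W a b x)
     - 2 * ((\<Sum>k\<in>UNIV. v k * M k x) / sq x) * (\<Sum>a\<in>UNIV. \<Sum>b\<in>UNIV. cx a x * M b x * W a b x)
     + (\<Sum>k\<in>UNIV. \<Sum>a\<in>UNIV. \<Sum>b\<in>UNIV. v k * M a x * M b x * pd k (W a b) x)"
proof -
  let ?c = "conn v x" and ?vm = "(\<Sum>k\<in>UNIV. v k * M k x) / sq x"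
  let ?V = "\<lambda>a y. \<Sum>b\<in>UNIV. M b y * W a b y"
  have V: "Cinf_on U (?V a)" for a using W openU Cinf_M by (intro cinf) auto
  have "(\<Sum>k\<in>UNIV. v k * pd k (\<lambda>y. \<Sum>a\<in>UNIV. \<Sum>b\<in>UNIV. M a y * M b y * W a b y) x)
      = (\<Sum>k\<in>UNIV. v k * pd k (\<lambda>y. \<Sum>a\<in>UNIV. M a y * ?V a y) x)"
    by (simp add: sum_distrib_left mult.assoc)
  also have "\<dots> = ?c * (\<Sum>a\<in>UNIV. M a x * ?V a x) - ?vm * (\<Sum>a\<in>UNIV. cx a x * ?V a x)
     + (\<Sum>k\<in>UNIV. \<Sum>a\<in>UNIV. v k * M a x * pd k (?V a) x)"
    by (rule dir_M1[OF x V])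
  also have "(\<Sum>k\<in>UNIV. \<Sum>a\<in>UNIV. v k * M a x * pd k (?V a) x) = (\<Sum>a\<in>UNIV. M a x * (\<Sum>k\<in>UNIV. v k * pd k (?V a) x))"
    by (subst sum.swap) (simp add: sum_distrib_left algebra_simps)
  also have "\<dots> = ?c * (\<Sum>a\<in>UNIV. M a x * ?V a x) - ?vm * (\<Sum>a\<in>UNIV. M a x * (\<Sum>b\<in>UNIV. cx b x * W a b x))
      + (\<Sum>a\<in>UNIV. M a x * (\<Sum>k\<in>UNIV. \<Sum>b\<in>UNIV. v k * M b x * pd k (W a b) x))"
    by (simp add: dir_M1[OF x W] distrib_left right_diff_distrib sum.distrib sum_subtractf sum_distrib_left mult.left_commute)
  also have "(\<Sum>a\<in>UNIV. M a x * (\<Sum>b\<in>UNIV. cx b x * W a b x)) = (\<Sum>a\<in>UNIV. cx a x * ?V a x)"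
    unfolding sum_distrib_left by (subst sum.swap) (simp add: sym algebra_simps)
  also have "(\<Sum>a\<in>UNIV. M a x * (\<Sum>k\<in>UNIV. \<Sum>b\<in>UNIV. v k * M b x * pd k (W a b) x))
     = (\<Sum>k\<in>UNIV. \<Sum>a\<in>UNIV. \<Sum>b\<in>UNIV. v k * M a x * M b x * pd k (W a b) x)"
    unfolding sum_distrib_left by (subst sum.swap) (simp add: algebra_simps)
  also have "(\<Sum>a\<in>UNIV. M a x * ?V a x) = (\<Sum>a\<in>UNIV. \<Sum>b\<in>UNIV. M a x * M b x * W a b x)"
    by (simp add: sum_distrib_left mult.assoc)
  also have "(\<Sum>a\<in>UNIV. cx a x * ?V a x) = (\<Sum>a\<in>UNIV. \<Sum>b\<in>UNIV. cx a x * M b x * W a b x)"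
    by (simp add: sum_distrib_left mult.assoc)
  finally show ?thesis by (simp only:) (simp only: algebra_simps mult_2)
qed

lemma mconn_conn: "x \<in> U \<Longrightarrow> mconn m x = conn (\<lambda>k. M k x) x"
  unfolding mconn_def mdir_def conn_def sum_distrib_left
  by (subst sum.swap) (simp add: algebra_simps)

text \<open>Differentiating m_a cnj m^a = 1 shows that conjugation reverses the sign of the
  connection. Together with the weight \<open>- s\<close> in \<open>ethbar\<close>, this gives
  edth-bar the same shape as edth, with \<open>cnj m\<close> as direction.\<close>

lemma cnj_mconn: assumes x: "x \<in> U" shows "cnj (mconn m x) = - conn (\<lambda>k. cnj (M k x)) x"
proof -
  have "cnj (mconn m x) = (\<Sum>k\<in>UNIV. cnj (M k x) * (\<Sum>b\<in>UNIV. M b x * cnj (pd k (M b) x)))"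
    unfolding mconn_def mdir_def sum_distrib_left cnj_sum
    by (subst sum.swap) (simp add: algebra_simps)
  then show ?thesis by (simp add: pd_M_rel[OF x] conn_def sum_negf)
qed

lemma eth_dir:
  "x \<in> U \<Longrightarrow> eth m s f x = cr x * ((\<Sum>k\<in>UNIV. M k x * pd k f x) - of_int s * conn (\<lambda>k. M k x) x * f x)"
  by (simp add: eth_def mdir_def mconn_conn)

lemma ethbar_dir:
  assumes x: "x \<in> U" and f: "f differentiable (at x)"
  shows "ethbar m s f x = cr x * ((\<Sum>k\<in>UNIV. cnj (M k x) * pd k f x) - of_int s * conn (\<lambda>k. cnj (M k x)) x * f x)"
  by (simp add: ethbar_def eth_def mdir_def cnj_mconn[OF x] pd_cnj[OF f])

lemma eth_cong: "x \<in> U \<Longrightarrow> (\<And>y. y \<in> U \<Longrightarrow> f y = g y) \<Longrightarrow> eth m s f x = eth m s g x"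
  unfolding eth_def mdir_def using pd_cong[OF openU, of x f g] by simp

lemma ethbar_cong: "x \<in> U \<Longrightarrow> (\<And>y. y \<in> U \<Longrightarrow> f y = g y) \<Longrightarrow> ethbar m s f x = ethbar m s g x"
  unfolding ethbar_def using eth_cong[of x "\<lambda>y. cnj (f y)" "\<lambda>y. cnj (g y)"] by simp

lemma eth0: "eth m 0 u = (\<lambda>x. \<Sum>a\<in>UNIV. M a x * (cr x * pd a u x))"
  by (simp add: fun_eq_iff eth_def mdir_def sum_distrib_left algebra_simps)

lemma Cinf_crpd: "Cinf_on U u \<Longrightarrow> Cinf_on U (\<lambda>y. cr y * pd a u y)"
  using openU U0 by (intro cinf Cinf_pd)

lemma Cinf_sqpd: "Cinf_on U u \<Longrightarrow> Cinf_on U (\<lambda>y. sq y * pd a (pd b u) y)"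
  using openU U0 by (intro cinf Cinf_pd)

text \<open>The gradient of r is radial and \<open>v\<close> is orthogonal to \<open>x\<close>, so
  the factor r passes through the derivative.\<close>

lemma dir_W1:
  assumes x: "x \<in> U" and u: "Cinf_on U u" and v: "(\<Sum>k\<in>UNIV. cx k x * v k) = 0"
  shows "(\<Sum>k\<in>UNIV. \<Sum>a\<in>UNIV. v k * M a x * pd k (\<lambda>y. cr y * pd a u y) x)
    = cr x * (\<Sum>k\<in>UNIV. \<Sum>a\<in>UNIV. v k * M a x * pd k (pd a u) x)"
proof -
  have "(\<Sum>k\<in>UNIV. \<Sum>a\<in>UNIV. v k * M a x * pd k (\<lambda>y. cr y * pd a u y) x)
    = (\<Sum>k\<in>UNIV. cx k x * v k * (\<Sum>a\<in>UNIV. M a x * (pd a u x / cr x)))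
     + cr x * (\<Sum>k\<in>UNIV. \<Sum>a\<in>UNIV. v k * M a x * pd k (pd a u) x)"
    unfolding pd_cr_mult[OF U_nz[OF x] Cinf_differentiable[OF Cinf_pd[OF u] x]] sum_distrib_left sum.distrib[symmetric]
    by (intro sum.cong refl) (simp only: algebra_simps)
  also have "(\<Sum>k\<in>UNIV. cx k x * v k * (\<Sum>a\<in>UNIV. M a x * (pd a u x / cr x))) = 0"
    unfolding sum_distrib_right[symmetric] v by simp
  finally show ?thesis by simp
qed

lemma dir_W2:
  assumes x: "x \<in> U" and u: "Cinf_on U u" and v: "(\<Sum>k\<in>UNIV. cx k x * v k) = 0"
  shows "(\<Sum>k\<in>UNIV. \<Sum>a\<in>UNIV. \<Sum>b\<in>UNIV. v k * M a x * M b x * pd k (\<lambda>y. sq y * pd a (pd b u) y) x)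
    = sq x * (\<Sum>k\<in>UNIV. \<Sum>a\<in>UNIV. \<Sum>b\<in>UNIV. v k * M a x * M b x * pd k (pd a (pd b u)) x)"
proof -
  have "(\<Sum>k\<in>UNIV. \<Sum>a\<in>UNIV. \<Sum>b\<in>UNIV. v k * M a x * M b x * pd k (\<lambda>y. sq y * pd a (pd b u) y) x)
    = (\<Sum>k\<in>UNIV. cx k x * v k * (\<Sum>a\<in>UNIV. \<Sum>b\<in>UNIV. M a x * M b x * (2 * pd a (pd b u) x)))
     + sq x * (\<Sum>k\<in>UNIV. \<Sum>a\<in>UNIV. \<Sum>b\<in>UNIV. v k * M a x * M b x * pd k (pd a (pd b u)) x)"
    unfolding pd_sq_mult[OF Cinf_differentiable[OF Cinf_pd[OF Cinf_pd[OF u]] x]] sum_distrib_left sum.distrib[symmetric]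
    by (intro sum.cong refl) (simp only: algebra_simps)
  also have "(\<Sum>k\<in>UNIV. cx k x * v k * (\<Sum>a\<in>UNIV. \<Sum>b\<in>UNIV. M a x * M b x * (2 * pd a (pd b u) x))) = 0"
    unfolding sum_distrib_right[symmetric] v by simp
  finally show ?thesis by simp
qed

text \<open>For the direction \<open>m\<close> the radial correction of \<open>dir_M1\<close>
  carries the factor m_k m^k = 0, so no first-order term is left.\<close>

lemma eth_eth:
  assumes x: "x \<in> U" and u: "Cinf_on U u"
  shows "eth m 1 (eth m 0 u) x = (\<Sum>a\<in>UNIV. \<Sum>b\<in>UNIV. M a x * M b x * (sq x * pd a (pd b u) x))"
proof -
  have "eth m 1 (eth m 0 u) x = cr x * (cr x * (\<Sum>k\<in>UNIV. \<Sum>a\<in>UNIV. M k x * M a x * pd k (pd a u) x))"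
    unfolding eth0 eth_dir[OF x] dir_M1[OF x Cinf_crpd[OF u]] M_rel(1)[OF x] dir_W1[OF x u M_rel(3)[OF x]]
    by simp
  then show ?thesis by (simp add: sq_cr sum_distrib_left algebra_simps)
qed

text \<open>For the direction \<open>cnj m\<close> the radial correction carries the factor 1 and
  becomes the first-order term of \<open>Lop\<close>; the second-order part is a symmetric tensor,
  to which \<open>M_M_sym\<close> applies.\<close>

lemma ethbar_eth:
  assumes x: "x \<in> U" and u: "Cinf_on U u"
  shows "ethbar m 1 (eth m 0 u) x = Lop u x"
proof -
  have x0: "x \<noteq> 0" using U0 x by auto
  have C: "Cinf_on U (\<lambda>y. \<Sum>a\<in>UNIV. M a y * (cr y * pd a u y))"
    by (intro cinf Cinf_pd) (simp_all add: openU U0 Cinf_M u)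
  have "(\<Sum>k\<in>UNIV. cnj (M k x) * M k x) = 1" using M_rel(5)[OF x] by (simp add: mult.commute)
  then have "ethbar m 1 (eth m 0 u) x
     = cr x * (cr x * (\<Sum>k\<in>UNIV. \<Sum>a\<in>UNIV. cnj (M k x) * M a x * pd k (pd a u) x) - (1 / sq x) * (\<Sum>a\<in>UNIV. cx a x * (cr x * pd a u x)))"
    unfolding eth0 ethbar_dir[OF x Cinf_differentiable[OF C x]] dir_M1[OF x Cinf_crpd[OF u]] dir_W1[OF x u M_rel(4)[OF x]]
    by simp
  also have "(\<Sum>k\<in>UNIV. \<Sum>a\<in>UNIV. cnj (M k x) * M a x * pd k (pd a u) x)
    = (1/2) * ((\<Sum>a\<in>UNIV. pd a (pd a u) x) - (\<Sum>a\<in>UNIV. \<Sum>b\<in>UNIV. cx a x * cx b x * pd a (pd b u) x) / sq x)"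
    by (rule M_M_sym[OF x]) (rule pd_commute[OF openU x u])
  also have "(\<Sum>a\<in>UNIV. cx a x * (cr x * pd a u x)) = cr x * (\<Sum>a\<in>UNIV. cx a x * pd a u x)"
    by (simp add: sum_distrib_left algebra_simps)
  also have "cr x * (cr x * (1 / 2 * (A - B / sq x)) - 1 / sq x * (cr x * C)) = 1 / 2 * (sq x * A - B) - C" for A B C
    using x0 by (simp add: sq_cr field_simps)
  finally show ?thesis by (simp only: Lop_def)
qed

text \<open>The commutator of edth and edth-bar on spin weight 1, applied to edth u; the added
  \<open>u y\<close> is the Gaussian curvature 1 of the unit sphere.\<close>

lemma ethbar_eth_eth:
  assumes x: "x \<in> U" and u: "Cinf_on U u"
  shows "ethbar m 2 (eth m 1 (eth m 0 u)) x = eth m 0 (\<lambda>y. Lop u y + u y) x"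
proof -
  have C: "Cinf_on U (\<lambda>y. \<Sum>a\<in>UNIV. \<Sum>b\<in>UNIV. M a y * M b y * (sq y * pd a (pd b u) y))"
    by (intro cinf Cinf_pd) (simp_all add: openU U0 Cinf_M u)
  have one: "(\<Sum>k\<in>UNIV. cnj (M k x) * M k x) = 1" using M_rel(5)[OF x] by (simp add: mult.commute)
  have s: "sq x * pd a (pd b u) x = sq x * pd b (pd a u) x" for a b using pd_commute[OF openU x u] by simp
  have "ethbar m 2 (eth m 1 (eth m 0 u)) x = ethbar m 2 (\<lambda>y. \<Sum>a\<in>UNIV. \<Sum>b\<in>UNIV. M a y * M b y * (sq y * pd a (pd b u) y)) x"
    by (rule ethbar_cong[OF x]) (rule eth_eth[OF _ u])
  also have "\<dots> = cr x * (sq x * (\<Sum>k\<in>UNIV. \<Sum>a\<in>UNIV. \<Sum>b\<in>UNIV. cnj (M k x) * M a x * M b x * pd k (pd a (pd b u)) x)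
      - 2 * (1 / sq x) * (\<Sum>a\<in>UNIV. \<Sum>b\<in>UNIV. cx a x * M b x * (sq x * pd a (pd b u) x)))"
    unfolding ethbar_dir[OF x Cinf_differentiable[OF C x]] dir_M2[OF x Cinf_sqpd[OF u] s] dir_W2[OF x u M_rel(4)[OF x]] one
    by simp
  also have "(\<Sum>k\<in>UNIV. \<Sum>a\<in>UNIV. \<Sum>b\<in>UNIV. cnj (M k x) * M a x * M b x * pd k (pd a (pd b u)) x)
     = (\<Sum>b\<in>UNIV. M b x * (\<Sum>k\<in>UNIV. \<Sum>a\<in>UNIV. cnj (M k x) * M a x * pd k (pd a (pd b u)) x))"
  proof -
    have "(\<Sum>a\<in>UNIV. \<Sum>b\<in>UNIV. cnj (M k x) * M a x * M b x * pd k (pd a (pd b u)) x)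
      = (\<Sum>b\<in>UNIV. \<Sum>a\<in>UNIV. M b x * (cnj (M k x) * M a x * pd k (pd a (pd b u)) x))" for k
      by (subst sum.swap) (simp add: algebra_simps)
    then show ?thesis unfolding sum_distrib_left by simp (subst sum.swap, simp)
  qed
  also have "\<dots> = (\<Sum>b\<in>UNIV. M b x * ((1/2) * ((\<Sum>a\<in>UNIV. pd b (pd a (pd a u)) x)
      - (\<Sum>a\<in>UNIV. \<Sum>c\<in>UNIV. cx a x * cx c x * pd b (pd a (pd c u)) x) / sq x)))"
  proof (intro sum.cong refl arg_cong2[where f = "(*)"])
    fix b
    have p: "pd a (pd c (pd b u)) x = pd b (pd a (pd c u)) x" for a c
      by (rule pd_commute3[OF openU x u])
    show "(\<Sum>k\<in>UNIV. \<Sum>a\<in>UNIV. cnj (M k x) * M a x * pd k (pd a (pd b u)) x) = (1/2) * ((\<Sum>a\<in>UNIV. pd b (pd a (pd a u)) x)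
      - (\<Sum>a\<in>UNIV. \<Sum>c\<in>UNIV. cx a x * cx c x * pd b (pd a (pd c u)) x) / sq x)"
      using M_M_sym[OF x, of "\<lambda>k a. pd k (pd a (pd b u)) x", OF pd_commute[OF openU x Cinf_pd[OF u]]] unfolding p .
  qed
  also have "(\<Sum>a\<in>UNIV. \<Sum>b\<in>UNIV. cx a x * M b x * (sq x * pd a (pd b u) x))
     = sq x * (\<Sum>b\<in>UNIV. M b x * (\<Sum>a\<in>UNIV. cx a x * pd b (pd a u) x))"
    unfolding sum_distrib_left by (subst sum.swap) (simp add: pd_commute[OF openU x u] algebra_simps)
  also have "cr x * (sq x * (\<Sum>b\<in>UNIV. M b x * ((1/2) * ((\<Sum>a\<in>UNIV. pd b (pd a (pd a u)) x)
      - (\<Sum>a\<in>UNIV. \<Sum>c\<in>UNIV. cx a x * cx c x * pd b (pd a (pd c u)) x) / sq x)))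
      - 2 * (1 / sq x) * (sq x * (\<Sum>b\<in>UNIV. M b x * (\<Sum>a\<in>UNIV. cx a x * pd b (pd a u) x))))
     = cr x * (\<Sum>b\<in>UNIV. M b x * ((1/2) * (sq x * (\<Sum>a\<in>UNIV. pd b (pd a (pd a u)) x)
      - (\<Sum>a\<in>UNIV. \<Sum>c\<in>UNIV. cx a x * cx c x * pd b (pd a (pd c u)) x)) - 2 * (\<Sum>a\<in>UNIV. cx a x * pd b (pd a u) x)))"
  proof -
    have "sq x \<noteq> 0" using U0 x by (auto simp: sq_cr)
    then have "sq x * (\<Sum>b\<in>UNIV. M b x * ((1/2) * (F b - G b / sq x))) - 2 * (1 / sq x) * (sq x * (\<Sum>b\<in>UNIV. M b x * H b))
       = (\<Sum>b\<in>UNIV. M b x * ((1/2) * (sq x * F b - G b) - 2 * H b))" for F G H :: "3 \<Rightarrow> complex"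
      by (simp add: sum_distrib_left sum_subtractf[symmetric] algebra_simps)
    then show ?thesis by simp
  qed
  \<comment> \<open>A zero is inserted, by x_b m^b = 0: the Laplacian with factor
    \<open>cx b x\<close> is the one term of \<open>pd_Lop\<close> still missing.\<close>
  also have "\<dots> = cr x * ((\<Sum>b\<in>UNIV. cx b x * M b x) * (\<Sum>a\<in>UNIV. pd a (pd a u) x)
      + (\<Sum>b\<in>UNIV. M b x * ((1/2) * (sq x * (\<Sum>a\<in>UNIV. pd b (pd a (pd a u)) x)
      - (\<Sum>a\<in>UNIV. \<Sum>c\<in>UNIV. cx a x * cx c x * pd b (pd a (pd c u)) x)) - 2 * (\<Sum>a\<in>UNIV. cx a x * pd b (pd a u) x))))"
    by (simp add: M_rel(3)[OF x])
  also have "\<dots> = cr x * (\<Sum>b\<in>UNIV. M b x * pd b (\<lambda>y. Lop u y + u y) x)"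
    unfolding pd_Lop[OF openU x u] sum_distrib_right sum.distrib[symmetric]
    by (intro arg_cong2[where f = "(*)"] sum.cong refl) (simp only: algebra_simps)
  also have "\<dots> = eth m 0 (\<lambda>y. Lop u y + u y) x"
    unfolding eth0 sum_distrib_left by (simp only: algebra_simps)
  finally show ?thesis .
qed

lemma conn_radial: "x \<in> U \<Longrightarrow> conn (\<lambda>k. cx k x) x = 0"
  unfolding conn_def sum_distrib_left using M_rel(6)
  by (subst sum.swap) (simp add: radd_def mult.left_commute[of "cx _ _"] sum_distrib_left[symmetric])

text \<open>On scalars edth is homogeneous of degree 0: the radial derivative of its factor r makes
  up for the commutator of \<open>radd\<close> with \<open>pd a\<close>. The frame contributes
  nothing, since it does not depend on r.\<close>

lemma radd_eth:
  assumes x: "x \<in> U" and u: "Cinf_on U u"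
  shows "radd (eth m 0 u) x = eth m 0 (radd u) x"
proof -
  have x0: "x \<noteq> 0" using U0 x by auto
  have "radd (eth m 0 u) x = (\<Sum>k\<in>UNIV. \<Sum>a\<in>UNIV. cx k x * M a x * pd k (\<lambda>y. cr y * pd a u y) x)"
    unfolding radd_def eth0 dir_M1[OF x Cinf_crpd[OF u]] by (simp add: conn_radial[OF x] M_rel[OF x])
  also have "\<dots> = (\<Sum>a\<in>UNIV. M a x * (\<Sum>k\<in>UNIV. cx k x * pd k (\<lambda>y. cr y * pd a u y) x))"
    unfolding sum_distrib_left by (subst sum.swap) (simp add: algebra_simps)
  also have "\<dots> = (\<Sum>a\<in>UNIV. M a x * (sq x * (pd a u x / cr x) + cr x * radd (pd a u) x))"
    unfolding pd_cr_mult[OF U_nz[OF x] Cinf_differentiable[OF Cinf_pd[OF u] x]] sq_def radd_def sum_distrib_left sum_distrib_right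
    by (simp add: sum.distrib sum_distrib_left algebra_simps)
  also have "\<dots> = eth m 0 (radd u) x"
    unfolding eth0 pd_radd[OF openU x u] by (simp add: x0 sq_cr algebra_simps)
  finally show ?thesis .
qed

lemma radd_eth_eth:
  assumes x: "x \<in> U" and u: "Cinf_on U u"
  shows "radd (eth m 1 (eth m 0 u)) x = eth m 1 (eth m 0 (radd u)) x"
proof -
  have s: "sq x * pd a (pd b u) x = sq x * pd b (pd a u) x" for a b using pd_commute[OF openU x u] by simp
  have "radd (eth m 1 (eth m 0 u)) x = radd (\<lambda>y. \<Sum>a\<in>UNIV. \<Sum>b\<in>UNIV. M a y * M b y * (sq y * pd a (pd b u) y)) x"
    by (rule radd_cong[OF openU x]) (rule eth_eth[OF _ u])
  also have "\<dots> = (\<Sum>k\<in>UNIV. \<Sum>a\<in>UNIV. \<Sum>b\<in>UNIV. cx k x * M a x * M b x * pd k (\<lambda>y. sq y * pd a (pd b u) y) x)"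
    unfolding radd_def dir_M2[OF x Cinf_sqpd[OF u] s] by (simp add: conn_radial[OF x] M_rel[OF x])
  also have "\<dots> = (\<Sum>a\<in>UNIV. \<Sum>b\<in>UNIV. M a x * M b x * (\<Sum>k\<in>UNIV. cx k x * pd k (\<lambda>y. sq y * pd a (pd b u) y) x))"
  proof -
    have "(\<Sum>k\<in>UNIV. \<Sum>a\<in>UNIV. \<Sum>b\<in>UNIV. F k a b) = (\<Sum>a\<in>UNIV. \<Sum>b\<in>UNIV. \<Sum>k\<in>UNIV. F k a b)"
      for F :: "3 \<Rightarrow> 3 \<Rightarrow> 3 \<Rightarrow> complex"
      by (rule trans[OF sum.swap]) (rule sum.cong[OF refl], rule sum.swap)
    then show ?thesis unfolding sum_distrib_left by (simp add: algebra_simps)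
  qed
  also have "\<dots> = (\<Sum>a\<in>UNIV. \<Sum>b\<in>UNIV. M a x * M b x * (sq x * (2 * pd a (pd b u) x) + sq x * radd (pd a (pd b u)) x))"
    unfolding pd_sq_mult[OF Cinf_differentiable[OF Cinf_pd[OF Cinf_pd[OF u]] x]] radd_def sum_distrib_left
    by (simp add: sum.distrib sum_distrib_left sum_distrib_right sq_def algebra_simps)
  also have "\<dots> = eth m 1 (eth m 0 (radd u)) x"
    unfolding eth_eth[OF x Cinf_radd[OF openU u]] pd_pd_radd[OF openU x u] by (simp add: algebra_simps)
  finally show ?thesis .
qed

end

section \<open>Functions of the form \<open>f1 + r f2\<close>\<close>

named_theorems einf

lemma E_inf_smooth: "Cinf_on (ball 0 a) f \<Longrightarrow> E_inf a f"
  unfolding E_inf_def by (intro exI[of _ f] exI[of _ "\<lambda>_. 0"]) (auto intro: cinf)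

lemma E_inf_const[einf]: "E_inf a (\<lambda>x. c)"
  by (intro E_inf_smooth cinf)

lemma E_inf_coord[einf]: "E_inf a (cx k)"
  by (intro E_inf_smooth cinf)

lemma E_inf_cr[einf]: "E_inf a cr"
  unfolding E_inf_def by (intro exI[of _ "\<lambda>_. 0"] exI[of _ "\<lambda>_. 1"]) (auto intro: cinf)

lemma E_inf_add[einf]: assumes "E_inf a f" "E_inf a g" shows "E_inf a (\<lambda>x. f x + g x)"
proof -
  obtain f1 f2 g1 g2 where "Cinf_on (ball 0 a) f1" "Cinf_on (ball 0 a) f2"
    "Cinf_on (ball 0 a) g1" "Cinf_on (ball 0 a) g2"
    "\<forall>x\<in>ball 0 a - {0}. f x = f1 x + cr x * f2 x" "\<forall>x\<in>ball 0 a - {0}. g x = g1 x + cr x * g2 x"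
    using assms unfolding E_inf_def by blast
  then show ?thesis unfolding E_inf_def
    by (intro exI[of _ "\<lambda>x. f1 x + g1 x"] exI[of _ "\<lambda>x. f2 x + g2 x"]) (auto intro: cinf simp: algebra_simps)
qed

text \<open>The two parts with r multiply to r^2, which is the polynomial \<open>sq\<close> and
  hence smooth at the origin.\<close>

lemma E_inf_mult[einf]: assumes "E_inf a f" "E_inf a g" shows "E_inf a (\<lambda>x. f x * g x)"
proof -
  obtain f1 f2 g1 g2 where c: "Cinf_on (ball 0 a) f1" "Cinf_on (ball 0 a) f2"
    "Cinf_on (ball 0 a) g1" "Cinf_on (ball 0 a) g2"
    and e: "\<forall>x\<in>ball 0 a - {0}. f x = f1 x + cr x * f2 x" "\<forall>x\<in>ball 0 a - {0}. g x = g1 x + cr x * g2 x"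
    using assms unfolding E_inf_def by blast
  show ?thesis unfolding E_inf_def
  proof (intro exI conjI ballI)
    show "Cinf_on (ball 0 a) (\<lambda>x. f1 x * g1 x + sq x * (f2 x * g2 x))"
      "Cinf_on (ball 0 a) (\<lambda>x. f1 x * g2 x + f2 x * g1 x)"
      by (intro cinf c open_ball)+
    show "f x * g x = f1 x * g1 x + sq x * (f2 x * g2 x) + cr x * (f1 x * g2 x + f2 x * g1 x)"
      if "x \<in> ball 0 a - {0}" for x
      using e that by (simp add: sq_cr algebra_simps)
  qed
qed

lemma E_inf_sum[einf]: "finite I \<Longrightarrow> (\<And>i. i \<in> I \<Longrightarrow> E_inf a (f i)) \<Longrightarrow> E_inf a (\<lambda>x. \<Sum>i\<in>I. f i x)"
  by (induct rule: finite_induct) (auto intro!: einf)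

lemma E_inf_linear:
  assumes "bounded_linear h" "E_inf a f" shows "E_inf a (\<lambda>x. h (f x))"
proof -
  obtain f1 f2 where c: "Cinf_on (ball 0 a) f1" "Cinf_on (ball 0 a) f2"
    and e: "\<forall>x\<in>ball 0 a - {0}. f x = f1 x + cr x * f2 x"
    using assms unfolding E_inf_def by blast
  have "h (f x) = h (f1 x) + cr x * h (f2 x)" if "x \<in> ball 0 a - {0}" for x
    using e that by (simp add: linear_add linear_scale bounded_linear.linear[OF assms(1)] flip: scaleR_conv_of_real)
  with Cinf_linear[OF assms(1) open_ball c(1)] Cinf_linear[OF assms(1) open_ball c(2)]
  show ?thesis unfolding E_inf_def by blast
qed

lemma E_inf_cnj[einf]: "E_inf a f \<Longrightarrow> E_inf a (\<lambda>x. cnj (f x))"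
  by (rule E_inf_linear[OF bounded_linear_cnj])

lemma radd_cr_mult:
  assumes "x \<noteq> 0" "u differentiable (at x)"
  shows "radd (\<lambda>y. cr y * u y) x = cr x * u x + cr x * radd u x"
proof -
  have "radd (\<lambda>y. cr y * u y) x = sq x * (u x / cr x) + cr x * radd u x"
    unfolding radd_def pd_cr_mult[OF assms] sq_def
    by (simp add: sum.distrib sum_distrib_left sum_distrib_right algebra_simps)
  then show ?thesis using assms by (simp add: sq_cr)
qed

lemma pd_pd_cr_mult:
  assumes U: "open U" "x \<in> U" "0 \<notin> U" and u: "Cinf_on U u"
  shows "pd b (pd a (\<lambda>y. cr y * u y)) x = (if a = b then 1 else 0) * (u x / cr x)
    + cx a x * (pd b u x / cr x) + cx b x * (pd a u x / cr x) - cx a x * (cx b x * (u x / (cr x * sq x))) + cr x * pd b (pd a u) x"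
proof -
  have x0: "x \<noteq> 0" using U by auto
  have d1: "u differentiable (at x)" using Cinf_differentiable[OF u U(2)] .
  have d2: "pd k u differentiable (at x)" for k using Cinf_differentiable[OF Cinf_pd[OF u] U(2)] .
  have "pd b (pd a (\<lambda>y. cr y * u y)) x = pd b (\<lambda>y. cx a y * (u y * (1 / cr y)) + cr y * pd a u y) x"
  proof (rule pd_cong[OF U(1,2)])
    fix y assume "y \<in> U"
    then show "pd a (\<lambda>y. cr y * u y) y = cx a y * (u y * (1 / cr y)) + cr y * pd a u y"
      using pd_cr_mult[of y u a] Cinf_differentiable[OF u] U(3) by auto
  qed
  also have "\<dots> = (if b = a then 1 else 0) * (u x * (1 / cr x)) + cx a x * (pd b u x * (1 / cr x) +
      u x * (- cx b x * (1 / cr x) * (1 / cr x) * (1 / cr x))) + (cx b x * (pd a u x / cr x) + cr x * pd b (pd a u) x)"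
    using d1 d2 x0 pd_cr_mult[OF x0 d2, of b a]
    by (simp add: pd_add pd_mult[OF _ differentiable_icr] pd_mult[OF coord_differentiable] pd_icr pd_coord
        diff_rules differentiable_cr differentiable_icr del: times_divide_eq_right mult_minus_left)
  also have "\<dots> = (if a = b then 1 else 0) * (u x / cr x)
    + cx a x * (pd b u x / cr x) + cx b x * (pd a u x / cr x) - cx a x * (cx b x * (u x / (cr x * sq x))) + cr x * pd b (pd a u) x"
    by (auto simp: sq_cr algebra_simps)
  finally show ?thesis .
qed

text \<open>\<open>Lop\<close> differentiates only along the spheres, on which r is constant. In
  Cartesian form the zeroth-order terms of the Laplacian \<open>A\<close>, the radial Hessian
  \<open>B\<close> and the radial derivative \<open>C\<close> cancel.\<close>

lemma Lop_cr_mult: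
  assumes U: "open U" "x \<in> U" "0 \<notin> U" and u: "Cinf_on U u"
  shows "Lop (\<lambda>y. cr y * u y) x = cr x * Lop u x"
proof -
  have x0: "x \<noteq> 0" using U by auto
  have d1: "u differentiable (at x)" using Cinf_differentiable[OF u U(2)] .
  have three: "(\<Sum>a\<in>(UNIV::3 set). c) = 3 * c" for c :: complex by simp
  have A: "(\<Sum>a\<in>UNIV. pd a (pd a (\<lambda>y. cr y * u y)) x)
    = 3 * (u x / cr x) + 2 * (radd u x / cr x) - sq x * (u x / (cr x * sq x)) + cr x * (\<Sum>a\<in>UNIV. pd a (pd a u) x)"
    unfolding pd_pd_cr_mult[OF U u] sum.distrib sum_subtractf radd_def sq_def
    by (simp add: sum_distrib_left sum_divide_distrib sum_distrib_right algebra_simps)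
  have B: "(\<Sum>a\<in>UNIV. \<Sum>c\<in>UNIV. cx a x * cx c x * pd a (pd c (\<lambda>y. cr y * u y)) x)
    = sq x * (u x / cr x) + 2 * (sq x * (radd u x / cr x)) - sq x * sq x * (u x / (cr x * sq x))
     + cr x * (\<Sum>a\<in>UNIV. \<Sum>c\<in>UNIV. cx a x * cx c x * pd a (pd c u) x)"
  proof -
    have 1: "(\<Sum>a\<in>UNIV. \<Sum>c\<in>UNIV. cx a x * cx c x * ((if c = a then 1 else 0) * w)) = sq x * w" for w
    proof -
      have "(\<Sum>c\<in>UNIV. cx a x * cx c x * ((if c = a then 1 else 0) * w)) = cx a x * cx a x * w" for a
        using sum_kd[of a "\<lambda>c. cx a x * cx c x * w"] by (simp add: mult.left_commute mult.commute eq_commute[of a])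
      then show ?thesis by (simp add: sq_def sum_distrib_right)
    qed
    have 2: "(\<Sum>a\<in>UNIV. \<Sum>c\<in>UNIV. cx a x * cx c x * (cx c x * (pd a u x / cr x))) = sq x * (radd u x / cr x)"
      unfolding radd_def sq_def sum_divide_distrib sum_product by (subst sum.swap) (simp add: algebra_simps)
    have 3: "(\<Sum>a\<in>UNIV. \<Sum>c\<in>UNIV. cx a x * cx c x * (cx a x * (pd c u x / cr x))) = sq x * (radd u x / cr x)"
      unfolding radd_def sq_def sum_divide_distrib sum_product by (simp add: algebra_simps)
    have 4: "(\<Sum>a\<in>UNIV. \<Sum>c\<in>UNIV. cx a x * cx c x * (cx c x * (cx a x * w))) = sq x * sq x * w" for w
      unfolding sq_def sum_product by (simp add: sum_distrib_left algebra_simps)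
    show ?thesis
      unfolding pd_pd_cr_mult[OF U u] distrib_left right_diff_distrib sum.distrib sum_subtractf 1 2 3 4
      by (simp add: sum_distrib_left algebra_simps)
  qed
  have C: "(\<Sum>a\<in>UNIV. cx a x * pd a (\<lambda>y. cr y * u y) x) = cr x * u x + cr x * radd u x"
    using radd_cr_mult[OF x0 d1] by (simp add: radd_def)
  show ?thesis
    unfolding Lop_def A B C sq_cr unfolding radd_def[symmetric] using x0 by (simp add: field_simps)
qed

lemma Lop_cong:
  assumes "open U" "x \<in> U" "\<And>y. y \<in> U \<Longrightarrow> f y = g y" shows "Lop f x = Lop g x"
proof -
  have 1: "pd a f y = pd a g y" if "y \<in> U" for y a using pd_cong[OF assms(1) that] assms(3) by blast
  have "pd a (pd b f) x = pd a (pd b g) x" for a b by (rule pd_cong[OF assms(1,2)]) (rule 1)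
  with 1[OF assms(2)] show ?thesis by (simp add: Lop_def)
qed

lemma pd_pd_add:
  assumes "open U" "x \<in> U" "Cinf_on U f" "Cinf_on U g"
  shows "pd a (pd b (\<lambda>y. f y + g y)) x = pd a (pd b f) x + pd a (pd b g) x"
proof -
  have "pd a (pd b (\<lambda>y. f y + g y)) x = pd a (\<lambda>y. pd b f y + pd b g y) x"
    by (rule pd_cong[OF assms(1,2)]) (simp add: pd_add Cinf_differentiable[OF assms(3)] Cinf_differentiable[OF assms(4)])
  then show ?thesis using Cinf_differentiable[OF Cinf_pd[OF assms(3)] assms(2)] Cinf_differentiable[OF Cinf_pd[OF assms(4)] assms(2)]
    by (simp add: pd_add)
qed

lemma Lop_add:
  assumes "open U" "x \<in> U" "Cinf_on U f" "Cinf_on U g"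
  shows "Lop (\<lambda>y. f y + g y) x = Lop f x + Lop g x"
  unfolding Lop_def pd_pd_add[OF assms] pd_add[OF Cinf_differentiable[OF assms(3,2)] Cinf_differentiable[OF assms(4,2)]]
  by (simp add: sum.distrib algebra_simps)

lemma radd_add:
  assumes "f differentiable (at x)" "g differentiable (at x)"
  shows "radd (\<lambda>y. f y + g y) x = radd f x + radd g x"
  using assms by (simp add: radd_def pd_add sum.distrib algebra_simps)

text \<open>The class of \<open>lam\<close>, whose members may be singular like 1/r. It is kept by
  \<open>radd\<close> and \<open>Lop\<close>, although not by a single Cartesian derivative.\<close>

definition rE :: "real \<Rightarrow> (real^3 \<Rightarrow> complex) \<Rightarrow> bool" where
  "rE a u \<longleftrightarrow> Cinf_on (ball 0 a - {0}) u \<and> E_inf a (\<lambda>x. cr x * u x)"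

lemma open_punctured: "open (ball 0 a - {0::real^3})"
  by (simp add: open_Diff)

lemma rE_Cinf: "rE a u \<Longrightarrow> Cinf_on (ball 0 a - {0}) u"
  by (simp add: rE_def)

lemma rE_add: "rE a u \<Longrightarrow> rE a w \<Longrightarrow> rE a (\<lambda>x. u x + w x)"
  unfolding rE_def by (auto simp: distrib_left intro!: cinf einf open_punctured)

lemma rE_cmult: "rE a u \<Longrightarrow> rE a (\<lambda>x. c * u x)"
  unfolding rE_def using E_inf_mult[OF E_inf_const, of a "\<lambda>x. cr x * u x" c]
  by (auto simp: mult.left_commute intro!: cinf open_punctured)

lemma rE_linear:
  assumes h: "bounded_linear h" and u: "rE a u" shows "rE a (\<lambda>x. h (u x))"
proof -
  have "cr x * h (u x) = h (cr x * u x)" for x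
    by (simp add: linear_scale bounded_linear.linear[OF h] flip: scaleR_conv_of_real)
  then show ?thesis using u E_inf_linear[OF h] Cinf_linear[OF h open_punctured]
    unfolding rE_def by simp
qed

text \<open>Applying \<open>radd\<close> to r u gives r u + r \<open>radd u\<close>. Solved for the
  last term, the smooth part is \<open>radd f1\<close> minus \<open>f1\<close>, and the coefficient
  of r is \<open>radd f2\<close>.\<close>

lemma rE_radd: assumes u: "rE a u" shows "rE a (radd u)"
proof -
  let ?V = "ball 0 a - {0::real^3}"
  obtain f1 f2 where c: "Cinf_on (ball 0 a) f1" "Cinf_on (ball 0 a) f2"
    and e: "\<And>x. x \<in> ?V \<Longrightarrow> cr x * u x = f1 x + cr x * f2 x"
    using u unfolding rE_def E_inf_def by blast
  have "cr x * radd u x = (radd f1 x + (-1) * f1 x) + cr x * radd f2 x" if x: "x \<in> ?V" for x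
  proof -
    have d: "f1 differentiable (at x)" "f2 differentiable (at x)" "u differentiable (at x)" and x0: "x \<noteq> 0"
      using x Cinf_differentiable[OF c(1)] Cinf_differentiable[OF c(2)] Cinf_differentiable[OF rE_Cinf[OF u]] by auto
    have "cr x * u x + cr x * radd u x = radd (\<lambda>y. f1 y + cr y * f2 y) x"
      using radd_cong[OF open_punctured x, of "\<lambda>y. cr y * u y" "\<lambda>y. f1 y + cr y * f2 y", OF e] radd_cr_mult[OF x0 d(3)] by simp
    also have "\<dots> = radd f1 x + (cr x * f2 x + cr x * radd f2 x)"
      using d x0 by (subst radd_add) (auto simp: radd_cr_mult intro!: differentiable_mult differentiable_cr)
    finally show ?thesis using e[OF x] by (simp add: algebra_simps)
  qed
  then have "E_inf a (\<lambda>x. cr x * radd u x)" unfolding E_inf_def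
    using c by (intro exI[of _ "\<lambda>x. radd f1 x + (-1) * f1 x"] exI[of _ "radd f2"]) (auto intro!: cinf simp del: mult_minus1)
  then show ?thesis using Cinf_radd[OF open_punctured rE_Cinf[OF u]] by (simp add: rE_def)
qed

lemma rE_Lop: assumes u: "rE a u" shows "rE a (Lop u)"
proof -
  let ?V = "ball 0 a - {0::real^3}"
  have V: "open ?V" "0 \<notin> ?V" by (auto simp: open_punctured)
  obtain f1 f2 where c: "Cinf_on (ball 0 a) f1" "Cinf_on (ball 0 a) f2"
    and e: "\<And>x. x \<in> ?V \<Longrightarrow> cr x * u x = f1 x + cr x * f2 x"
    using u unfolding rE_def E_inf_def by blast
  have c': "Cinf_on ?V f1" "Cinf_on ?V f2" using c Cinf_subset by blast+
  have "cr x * Lop u x = Lop f1 x + cr x * Lop f2 x" if x: "x \<in> ?V" for x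
  proof -
    have "cr x * Lop u x = Lop (\<lambda>y. f1 y + cr y * f2 y) x"
      using Lop_cong[OF V(1) x, of "\<lambda>y. cr y * u y" "\<lambda>y. f1 y + cr y * f2 y", OF e] Lop_cr_mult[OF V(1) x V(2) rE_Cinf[OF u]] by simp
    also have "\<dots> = Lop f1 x + Lop (\<lambda>y. cr y * f2 y) x"
      by (rule Lop_add[OF V(1) x c'(1)]) (intro cinf c' V)
    finally show ?thesis using Lop_cr_mult[OF V(1) x V(2) c'(2)] by simp
  qed
  then have "E_inf a (\<lambda>x. cr x * Lop u x)" unfolding E_inf_def
    using c by (intro exI[of _ "Lop f1"] exI[of _ "Lop f2"]) (auto intro!: cinf)
  then show ?thesis using Cinf_Lop[OF V(1) rE_Cinf[OF u]] by (simp add: rE_def)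
qed

text \<open>In the full gradient the derivative of r would leave x_k u / r; on vectors orthogonal to
  \<open>x\<close> the gradients of \<open>f1\<close> and \<open>f2\<close> suffice.
  \<open>T\<close> does not depend on \<open>v\<close>, since it has to serve all local frames at
  once.\<close>

lemma rE_grad:
  assumes u: "rE a u"
  obtains T where "\<And>k. E_inf a (T k)"
    "\<And>x v. x \<in> ball 0 a - {0} \<Longrightarrow> (\<Sum>k\<in>UNIV. cx k x * v k) = 0 \<Longrightarrow>
      cr x * (\<Sum>k\<in>UNIV. v k * pd k u x) = (\<Sum>k\<in>UNIV. v k * T k x)"
proof -
  let ?V = "ball 0 a - {0::real^3}"
  obtain f1 f2 where c: "Cinf_on (ball 0 a) f1" "Cinf_on (ball 0 a) f2"
    and e: "\<And>x. x \<in> ?V \<Longrightarrow> cr x * u x = f1 x + cr x * f2 x"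
    using u unfolding rE_def E_inf_def by blast
  let ?T = "\<lambda>k x. pd k f1 x + cr x * pd k f2 x"
  show ?thesis
  proof (rule that[of ?T])
    show "E_inf a (?T k)" for k
      unfolding E_inf_def using c by (intro exI[of _ "pd k f1"] exI[of _ "pd k f2"]) (auto intro: Cinf_pd)
    fix x :: "real^3" and v :: "3 \<Rightarrow> complex" assume x: "x \<in> ?V" and v: "(\<Sum>k\<in>UNIV. cx k x * v k) = 0"
    have d: "f1 differentiable (at x)" "f2 differentiable (at x)" "u differentiable (at x)" and x0: "x \<noteq> 0"
      using x Cinf_differentiable[OF c(1)] Cinf_differentiable[OF c(2)] Cinf_differentiable[OF rE_Cinf[OF u]] by auto
    have z: "(\<Sum>k\<in>UNIV. v k * (cx k x * w)) = 0" for w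
      using v by (simp add: mult.assoc[symmetric] mult.commute[of "v _"] sum_distrib_right[symmetric])
    have "pd k (\<lambda>y. cr y * u y) x = pd k (\<lambda>y. f1 y + cr y * f2 y) x" for k
      by (rule pd_cong[OF open_punctured x e])
    also have "pd k (\<lambda>y. f1 y + cr y * f2 y) x = pd k f1 x + pd k (\<lambda>y. cr y * f2 y) x" for k
      using d x0 by (intro pd_add) (auto intro!: differentiable_mult differentiable_cr)
    finally have "(\<Sum>k\<in>UNIV. v k * (cx k x * (u x / cr x) + cr x * pd k u x))
      = (\<Sum>k\<in>UNIV. v k * (pd k f1 x + (cx k x * (f2 x / cr x) + cr x * pd k f2 x)))"
      by (simp only: pd_cr_mult[OF x0 d(3)] pd_cr_mult[OF x0 d(2)])
    then show "cr x * (\<Sum>k\<in>UNIV. v k * pd k u x) = (\<Sum>k\<in>UNIV. v k * ?T k x)"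
      unfolding distrib_left sum.distrib z by (simp add: sum_distrib_left mult.left_commute)
  qed
qed

text \<open>The Hessian of r u contains radial terms, removed by x_k v^k = 0, and the trace term u /
  r, removed because \<open>v\<close> is null. Both conditions hold for \<open>m\<close>.\<close>

lemma rE_hess:
  assumes u: "rE a u"
  obtains T where "\<And>j k. E_inf a (T j k)"
    "\<And>x v. x \<in> ball 0 a - {0} \<Longrightarrow> (\<Sum>k\<in>UNIV. cx k x * v k) = 0 \<Longrightarrow> (\<Sum>k\<in>UNIV. v k * v k) = 0 \<Longrightarrow>
      cr x * (\<Sum>j\<in>UNIV. \<Sum>k\<in>UNIV. v j * v k * pd j (pd k u) x) = (\<Sum>j\<in>UNIV. \<Sum>k\<in>UNIV. v j * v k * T j k x)"
proof -
  let ?V = "ball 0 a - {0::real^3}"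
  have V: "open ?V" "0 \<notin> ?V" by (auto simp: open_punctured)
  obtain f1 f2 where c: "Cinf_on (ball 0 a) f1" "Cinf_on (ball 0 a) f2"
    and e: "\<And>x. x \<in> ?V \<Longrightarrow> cr x * u x = f1 x + cr x * f2 x"
    using u unfolding rE_def E_inf_def by blast
  have c': "Cinf_on ?V f1" "Cinf_on ?V f2" using c Cinf_subset by blast+
  let ?T = "\<lambda>j k x. pd j (pd k f1) x + cr x * pd j (pd k f2) x"
  show ?thesis
  proof (rule that[of ?T])
    show "E_inf a (?T j k)" for j k
      unfolding E_inf_def using c by (intro exI[of _ "pd j (pd k f1)"] exI[of _ "pd j (pd k f2)"]) (auto intro: Cinf_pd)
    fix x :: "real^3" and v :: "3 \<Rightarrow> complex" assume x: "x \<in> ?V" and v: "(\<Sum>k\<in>UNIV. cx k x * v k) = 0"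
      and vv: "(\<Sum>k\<in>UNIV. v k * v k) = 0"
    have contr: "(\<Sum>j\<in>UNIV. \<Sum>k\<in>UNIV. v j * v k * pd j (pd k (\<lambda>y. cr y * w y)) x)
       = cr x * (\<Sum>j\<in>UNIV. \<Sum>k\<in>UNIV. v j * v k * pd j (pd k w) x)" if w: "Cinf_on ?V w" for w
    proof -
      have z1: "(\<Sum>j\<in>UNIV. \<Sum>k\<in>UNIV. v j * v k * (cx k x * F j)) = 0" for F :: "3 \<Rightarrow> complex"
      proof -
        have "(\<Sum>j\<in>UNIV. \<Sum>k\<in>UNIV. v j * v k * (cx k x * F j)) = (\<Sum>j\<in>UNIV. v j * F j) * (\<Sum>k\<in>UNIV. cx k x * v k)"
          unfolding sum_product by (simp add: algebra_simps)
        then show ?thesis using v by simp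
      qed
      have z2: "(\<Sum>j\<in>UNIV. \<Sum>k\<in>UNIV. v j * v k * (cx j x * F k)) = 0" for F :: "3 \<Rightarrow> complex"
        using z1[of F] by (subst sum.swap) (simp add: mult.commute mult.left_commute)
      have z3: "(\<Sum>j\<in>UNIV. \<Sum>k\<in>UNIV. v j * v k * ((if k = j then 1 else 0) * w)) = 0" for w
      proof -
        have "(\<Sum>k\<in>UNIV. v j * v k * ((if k = j then 1 else 0) * w)) = v j * v j * w" for j
          using sum_kd[of j "\<lambda>k. v j * v k * w"] by (simp add: mult.left_commute mult.commute eq_commute[of j])
        then show ?thesis using vv by (simp add: sum_distrib_right[symmetric])
      qed
      show ?thesis
        unfolding pd_pd_cr_mult[OF V(1) x V(2) w] distrib_left right_diff_distrib sum.distrib sum_subtractf z1 z2 z3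
        by (simp add: sum_distrib_left mult.left_commute)
    qed
    have "pd j (pd k (\<lambda>y. cr y * u y)) x = pd j (pd k (\<lambda>y. f1 y + cr y * f2 y)) x" for j k
      by (rule pd_cong[OF V(1) x], rule pd_cong[OF V(1)]) (auto simp: e)
    also have "pd j (pd k (\<lambda>y. f1 y + cr y * f2 y)) x = pd j (pd k f1) x + pd j (pd k (\<lambda>y. cr y * f2 y)) x" for j k
      by (rule pd_pd_add[OF V(1) x c'(1)]) (intro cinf V c')
    finally have "(\<Sum>j\<in>UNIV. \<Sum>k\<in>UNIV. v j * v k * pd j (pd k (\<lambda>y. cr y * u y)) x)
      = (\<Sum>j\<in>UNIV. \<Sum>k\<in>UNIV. v j * v k * pd j (pd k f1) x) + (\<Sum>j\<in>UNIV. \<Sum>k\<in>UNIV. v j * v k * pd j (pd k (\<lambda>y. cr y * f2 y)) x)"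
      by (simp add: distrib_left sum.distrib)
    then show "cr x * (\<Sum>j\<in>UNIV. \<Sum>k\<in>UNIV. v j * v k * pd j (pd k u) x) = (\<Sum>j\<in>UNIV. \<Sum>k\<in>UNIV. v j * v k * ?T j k x)"
      unfolding contr[OF rE_Cinf[OF u]] contr[OF c'(2)] by (simp add: distrib_left sum.distrib sum_distrib_left mult.left_commute)
  qed
qed

section \<open>Contractions in an oriented frame\<close>

text \<open>This is epsilon_abc x^c, read off the cross product of two basis vectors.\<close>

definition eps :: "3 \<Rightarrow> 3 \<Rightarrow> real^3 \<Rightarrow> complex" where
  "eps a b x = (\<Sum>c\<in>UNIV. complex_of_real (cross3 (ex a) (ex b) $ c) * cx c x)"

text \<open>In a frame of orientation \<open>t\<close> this is \<open>r\<^sup>2 m\<^sub>a cnj m\<^sub>b\<close>.\<close>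

definition proj :: "complex \<Rightarrow> 3 \<Rightarrow> 3 \<Rightarrow> real^3 \<Rightarrow> complex" where
  "proj t a b x = (1/2) * (sq x * (if a = b then 1 else 0) - cx a x * cx b x + t * cr x * eps a b x)"

lemma E_inf_proj[einf]: "E_inf R (proj t a b)"
proof -
  have "E_inf R (\<lambda>x. (1/2) * (sq x * (if a = b then 1 else 0) + (-1) * (cx a x * cx b x) + t * cr x * eps a b x))"
    unfolding sq_def eps_def by (intro einf) auto
  then show ?thesis unfolding proj_def by simp
qed

text \<open>\<open>X\<close> is contracted with itself one product of frame vectors at a time.
  \<open>Q\<close> evaluates \<open>X\<close> on pairs of vectors, and \<open>T\<close> says that
  \<open>X\<close> is trace-free, which disposes of the \<open>kdelta\<close> part. Only bilinear
  relations enter, so \<open>b\<close>, \<open>e'\<close> and \<open>u'\<close> are free variables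
  in place of the conjugates.\<close>

lemma tensor_norm:
  fixes n m b :: "3 \<Rightarrow> complex" and z e e' u u' s :: complex
  assumes r: "(\<Sum>i\<in>UNIV. n i * n i) = 1" "(\<Sum>i\<in>UNIV. n i * m i) = 0" "(\<Sum>i\<in>UNIV. n i * b i) = 0"
     "(\<Sum>i\<in>UNIV. m i * m i) = 0" "(\<Sum>i\<in>UNIV. b i * b i) = 0" "(\<Sum>i\<in>UNIV. m i * b i) = 1"
    and s: "s * s = 2"
  defines "X \<equiv> \<lambda>i j. z * (3 * n i * n j - complex_of_real (kdelta i j)) + s * e * ((n i * b j + n j * b i) / 2)
     + s * e' * ((n i * m j + n j * m i) / 2) + u' * m i * m j + u * b i * b j"
  shows "(\<Sum>i\<in>UNIV. \<Sum>j\<in>UNIV. X i j * X i j) = 6 * (z * z) + 2 * (e * e') + 2 * (u * u')"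
proof -
  define dot :: "(3 \<Rightarrow> complex) \<Rightarrow> (3 \<Rightarrow> complex) \<Rightarrow> complex" where "dot p q = (\<Sum>i\<in>UNIV. p i * q i)" for p q
  have dc: "dot p q = dot q p" for p q by (simp add: dot_def mult.commute)
  have r': "dot n n = 1" "dot n m = 0" "dot n b = 0" "dot m m = 0" "dot b b = 0" "dot m b = 1"
    "dot m n = 0" "dot b n = 0" "dot b m = 1"
    using r dc unfolding dot_def by (auto simp: mult.commute)
  have tens: "(\<Sum>i\<in>UNIV. \<Sum>j\<in>UNIV. p i * q j * (p' i * q' j)) = dot p p' * dot q q'" for p q p' q'
    unfolding dot_def sum_product by (simp add: algebra_simps)
  have kd: "complex_of_real (kdelta i j) = (if i = j then 1 else 0)" for i j by (simp add: kdelta_def)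
  have tr: "(\<Sum>i\<in>UNIV. \<Sum>j\<in>UNIV. p i * q j * complex_of_real (kdelta i j)) = dot p q" for p q
  proof -
    have "(\<Sum>j\<in>UNIV. p i * q j * complex_of_real (kdelta i j)) = p i * q i" for i
      using sum_kd[of i "\<lambda>j. p i * q j"] by (simp add: kd mult.commute)
    then show ?thesis by (simp add: dot_def)
  qed
  have Q: "(\<Sum>i\<in>UNIV. \<Sum>j\<in>UNIV. p i * q j * X i j) = z * (3 * dot p n * dot q n - dot p q)
      + s * e * ((dot p n * dot q b + dot p b * dot q n) / 2) + s * e' * ((dot p n * dot q m + dot p m * dot q n) / 2)
      + u' * dot p m * dot q m + u * dot p b * dot q b" for p q
  proof -
    have "p i * q j * X i j = (3 * z) * (p i * q j * (n i * n j)) - z * (p i * q j * complex_of_real (kdelta i j))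
       + (s * e / 2) * (p i * q j * (n i * b j)) + (s * e / 2) * (p i * q j * (b i * n j))
       + (s * e' / 2) * (p i * q j * (n i * m j)) + (s * e' / 2) * (p i * q j * (m i * n j))
       + u' * (p i * q j * (m i * m j)) + u * (p i * q j * (b i * b j))" for i j
      by (simp add: X_def field_simps)
    then show ?thesis
      by (simp only: sum.distrib sum_subtractf sum_distrib_left[symmetric] tens tr) (simp add: field_simps)
  qed
  have T: "(\<Sum>i\<in>UNIV. \<Sum>j\<in>UNIV. complex_of_real (kdelta i j) * X i j) = 0"
  proof -
    have "(\<Sum>j\<in>UNIV. complex_of_real (kdelta i j) * X i j) = X i i" for i
      using sum_kd[of i "X i"] by (simp add: kd)
    then have "(\<Sum>i\<in>UNIV. \<Sum>j\<in>UNIV. complex_of_real (kdelta i j) * X i j) = (\<Sum>i\<in>UNIV. X i i)" by simp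
    also have "\<dots> = z * (3 * dot n n - 3) + s * e * dot n b + s * e' * dot n m + u' * dot m m + u * dot b b"
      unfolding X_def dot_def by (simp add: sum_3 kdelta_def field_simps)
    finally show ?thesis by (simp add: r')
  qed
  have "X i j * X i j = (3 * z) * (n i * n j * X i j) - z * (complex_of_real (kdelta i j) * X i j)
       + (s * e / 2) * (n i * b j * X i j) + (s * e / 2) * (b i * n j * X i j)
       + (s * e' / 2) * (n i * m j * X i j) + (s * e' / 2) * (m i * n j * X i j)
       + u' * (m i * m j * X i j) + u * (b i * b j * X i j)" for i j
  proof -
    have "X i j = (3 * z) * (n i * n j) - z * complex_of_real (kdelta i j)
       + (s * e / 2) * (n i * b j) + (s * e / 2) * (b i * n j)
       + (s * e' / 2) * (n i * m j) + (s * e' / 2) * (m i * n j)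
       + u' * (m i * m j) + u * (b i * b j)" by (simp add: X_def field_simps)
    then have "X i j * X i j = ((3 * z) * (n i * n j) - z * complex_of_real (kdelta i j)
       + (s * e / 2) * (n i * b j) + (s * e / 2) * (b i * n j)
       + (s * e' / 2) * (n i * m j) + (s * e' / 2) * (m i * n j)
       + u' * (m i * m j) + u * (b i * b j)) * X i j" by (rule arg_cong)
    then show ?thesis by (simp only: distrib_right left_diff_distrib mult.assoc)
  qed
  \<comment> \<open>\<open>X\<close> takes the value \<open>2 * z\<close> on (n, n),
    \<open>s * e' / 2\<close> on (n, b), \<open>s * e / 2\<close> on (n, m), \<open>u\<close> on (m,
    m) and \<open>u'\<close> on (b, b): each coefficient meets its partner.\<close>
  then have "(\<Sum>i\<in>UNIV. \<Sum>j\<in>UNIV. X i j * X i j) = (3 * z) * (2 * z) + (s * e / 2) * (s * e' / 2) + (s * e / 2) * (s * e' / 2)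
    + (s * e' / 2) * (s * e / 2) + (s * e' / 2) * (s * e / 2) + u' * u + u * u'"
    by (simp only: sum.distrib sum_subtractf sum_distrib_left[symmetric] Q T r') (simp add: field_simps)
  also have "\<dots> = 6 * (z * z) + (s * s) * (e * e') + 2 * (u * u')" by (simp add: field_simps)
  finally show ?thesis by (simp add: s)
qed

lemma pd_cmult: "f differentiable (at x) \<Longrightarrow> pd k (\<lambda>y. (c::complex) * f y) x = c * pd k f x"
  by (rule pd_linear[OF bounded_linear_mult_right])

context frame
begin

text \<open>The cross product of \<open>m\<close> and \<open>cnj m\<close>, in components because
  \<open>cross3\<close> is real.\<close>

definition crs :: "3 \<Rightarrow> real^3 \<Rightarrow> complex" where
  "crs a x = (if a = 1 then M 2 x * cnj (M 3 x) - M 3 x * cnj (M 2 x)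
    else if a = 2 then M 3 x * cnj (M 1 x) - M 1 x * cnj (M 3 x) else M 1 x * cnj (M 2 x) - M 2 x * cnj (M 1 x))"

text \<open>The orientation of the frame: the determinant of \<open>(n, m, cnj m)\<close>.\<close>

definition orient :: "real^3 \<Rightarrow> complex" where
  "orient x = (\<Sum>a\<in>UNIV. cx a x * crs a x) / cr x"

text \<open>A cross product is orthogonal to both factors, so of the frame components only the
  radial one is left.\<close>

lemma crs_orient: assumes x: "x \<in> U" shows "crs b x = cx b x / cr x * orient x"
proof -
  have "(\<Sum>e\<in>UNIV. M e x * crs e x) = 0" "(\<Sum>e\<in>UNIV. cnj (M e x) * crs e x) = 0"
    by (simp_all add: sum_3 crs_def algebra_simps)
  then have "crs b x = cx b x / sq x * (\<Sum>e\<in>UNIV. cx e x * crs e x)"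
    using sum_expand[OF x, of "\<lambda>e. crs e x" b] by simp
  then show ?thesis using U_nz[OF x] by (simp add: orient_def sq_cr)
qed

text \<open>Lagrange's identity for the square of the cross product: m_a m^a = 0 leaves minus the
  square of m_a cnj m^a = 1.\<close>

lemma orient_sq: assumes x: "x \<in> U" shows "orient x * orient x = -1"
proof -
  have "(\<Sum>b\<in>UNIV. crs b x * crs b x) = (\<Sum>b\<in>UNIV. M b x * M b x) * (\<Sum>b\<in>UNIV. cnj (M b x) * cnj (M b x))
     - (\<Sum>b\<in>UNIV. M b x * cnj (M b x)) * (\<Sum>b\<in>UNIV. M b x * cnj (M b x))"
    by (simp add: sum_3 crs_def algebra_simps)
  then have "(\<Sum>b\<in>UNIV. crs b x * crs b x) = -1" by (simp add: M_rel[OF x])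
  moreover have "(\<Sum>b\<in>UNIV. crs b x * crs b x) = (sq x / (cr x * cr x)) * (orient x * orient x)"
    unfolding crs_orient[OF x] sq_def sum_divide_distrib sum_distrib_right by (simp add: algebra_simps)
  ultimately show ?thesis using U_nz[OF x] by (simp add: sq_cr)
qed

lemma orient_cases: assumes "x \<in> U" shows "orient x = \<i> \<or> orient x = - \<i>"
proof -
  have "(orient x)\<^sup>2 = \<i>\<^sup>2" using orient_sq[OF assms] by (simp add: power2_eq_square)
  then show ?thesis by (simp only: power2_eq_iff)
qed

lemma orient_continuous: "continuous_on U orient"
proof -
  have "continuous_on U (\<lambda>y. \<chi> b. M b y)"
    by (intro continuous_on_vec_lambda Cinf_continuous[OF Cinf_M])
  then have "continuous_on U m" by simp
  then show ?thesis unfolding orient_def crs_def sum_3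
    using U0 by (auto intro!: continuous_intros)
qed

lemma eps_orient:
  assumes x: "x \<in> U"
  shows "cr x * (M a x * cnj (M b x) - cnj (M a x) * M b x) = orient x * eps a b x"
proof -
  have "M a x * cnj (M b x) - cnj (M a x) * M b x = (\<Sum>c\<in>UNIV. complex_of_real (cross3 (ex a) (ex b) $ c) * crs c x)"
    using exhaust_3[of a] exhaust_3[of b] by (auto simp: sum_3 crs_def cross3_def axis_def algebra_simps)
  then show ?thesis using U_nz[OF x] unfolding crs_orient[OF x] eps_def
    by (simp add: sum_distrib_left algebra_simps)
qed

text \<open>Completeness determines the symmetric part of the product, the orientation its
  antisymmetric part.\<close>

lemma M_M_proj:
  assumes x: "x \<in> U" shows "sq x * (M a x * cnj (M b x)) = proj (orient x) a b x"
proof -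
  have "sq x * (M a x * cnj (M b x) + cnj (M a x) * M b x) = sq x * (if a = b then 1 else 0) - cx a x * cx b x"
    using completeness[OF x, of a b] U_nz[OF x] by (simp add: sq_cr field_simps split: if_splits)
  moreover have "sq x * (M a x * cnj (M b x) - cnj (M a x) * M b x) = cr x * (orient x * eps a b x)"
    unfolding eps_orient[OF x, symmetric] by (simp add: sq_cr)
  moreover have "2 * (sq x * (M a x * cnj (M b x))) = sq x * (M a x * cnj (M b x) + cnj (M a x) * M b x)
      + sq x * (M a x * cnj (M b x) - cnj (M a x) * M b x)"
    by (simp add: algebra_simps)
  ultimately have "2 * (sq x * (M a x * cnj (M b x))) = sq x * (if a = b then 1 else 0) - cx a x * cx b x + cr x * (orient x * eps a b x)"
    by (simp only:)
  from arg_cong[OF this, of "\<lambda>z. (1/2) * z"] show ?thesis by (simp add: proj_def algebra_simps)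
qed

text \<open>\<open>m\<close> is an eigenvector of the cross product with n, with the orientation as
  eigenvalue. Through this identity the vector J brings in a sign of its own.\<close>

lemma cross_contract:
  assumes x: "x \<in> U"
  shows "(\<Sum>a\<in>UNIV. M a x * complex_of_real (cross3 J x $ a)) = cr x * orient x * (\<Sum>a\<in>UNIV. M a x * complex_of_real (J $ a))"
proof -
  let ?j = "\<lambda>b. complex_of_real (J $ b)"
  define p q w where "p = (\<Sum>e\<in>UNIV. cnj (M e x) * ?j e)" and "q = (\<Sum>e\<in>UNIV. M e x * ?j e)"
    and "w = (\<Sum>e\<in>UNIV. cx e x * ?j e) / sq x"
  have J: "?j b = M b x * p + cnj (M b x) * q + cx b x * w" for b
    using sum_expand[OF x, of ?j b] by (simp add: p_def q_def w_def)
  have "(\<Sum>a\<in>UNIV. M a x * complex_of_real (cross3 J x $ a))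
    = M 1 x * (?j 2 * cx 3 x - ?j 3 * cx 2 x) + M 2 x * (?j 3 * cx 1 x - ?j 1 * cx 3 x) + M 3 x * (?j 1 * cx 2 x - ?j 2 * cx 1 x)"
    by (simp add: sum_3 cross3_def)
  also have "\<dots> = q * (\<Sum>a\<in>UNIV. cx a x * crs a x)"
    unfolding J by (simp add: sum_3 crs_def algebra_simps)
  also have "(\<Sum>a\<in>UNIV. cx a x * crs a x) = cr x * orient x" using U_nz[OF x] by (simp add: orient_def)
  finally show ?thesis by (simp add: q_def algebra_simps)
qed

lemma Cinf_eth0: "Cinf_on U u \<Longrightarrow> Cinf_on U (eth m 0 u)"
  unfolding eth0 by (intro cinf Cinf_pd) (simp_all add: openU U0 Cinf_M)

lemma eth_add:
  assumes "f differentiable (at x)" "g differentiable (at x)"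
  shows "eth m s (\<lambda>y. f y + g y) x = eth m s f x + eth m s g x"
  using assms by (simp add: eth_def mdir_def pd_add sum.distrib algebra_simps)

lemma eth_cmult:
  assumes "f differentiable (at x)" shows "eth m s (\<lambda>y. c * f y) x = c * eth m s f x"
  using assms by (simp add: eth_def mdir_def pd_cmult sum_distrib_left algebra_simps)

lemma eth2_add:
  assumes x: "x \<in> U" and f: "Cinf_on U f" and g: "Cinf_on U g"
  shows "eth m 1 (eth m 0 (\<lambda>y. f y + g y)) x = eth m 1 (eth m 0 f) x + eth m 1 (eth m 0 g) x"
proof -
  have "eth m 1 (eth m 0 (\<lambda>y. f y + g y)) x = eth m 1 (\<lambda>y. eth m 0 f y + eth m 0 g y) x"
    by (rule eth_cong[OF x]) (simp add: eth_add Cinf_differentiable[OF f] Cinf_differentiable[OF g])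
  then show ?thesis using Cinf_differentiable[OF Cinf_eth0[OF f] x] Cinf_differentiable[OF Cinf_eth0[OF g] x] by (simp add: eth_add)
qed

lemma eth2_cmult:
  assumes x: "x \<in> U" and f: "Cinf_on U f"
  shows "eth m 1 (eth m 0 (\<lambda>y. c * f y)) x = c * eth m 1 (eth m 0 f) x"
proof -
  have "eth m 1 (eth m 0 (\<lambda>y. c * f y)) x = eth m 1 (\<lambda>y. c * eth m 0 f y) x"
    by (rule eth_cong[OF x]) (simp add: eth_cmult Cinf_differentiable[OF f])
  then show ?thesis using Cinf_differentiable[OF Cinf_eth0[OF f] x] by (simp add: eth_cmult)
qed

end

section \<open>Potentials for the coefficients of the lambda part\<close>

definition Kop :: "(real^3 \<Rightarrow> complex) \<Rightarrow> real^3 \<Rightarrow> complex" where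
  "Kop u y = Lop u y + u y"

text \<open>\<open>gpot\<close> and \<open>hpot\<close> arise by drawing all edth operators to the
  outside; edth-bar edth^2 becomes edth after \<open>Kop\<close>. Signs are written as factors to
  suit \<open>rE_cmult\<close>.\<close>

definition gpot :: "(real^3 \<Rightarrow> complex) \<Rightarrow> real^3 \<Rightarrow> complex" where
  "gpot lam y = (-2) * radd (Kop (lamR lam)) y + Kop (lamI lam) y"

definition hpot :: "(real^3 \<Rightarrow> complex) \<Rightarrow> real^3 \<Rightarrow> complex" where
  "hpot lam y = 2 * radd (radd (lamR lam)) y + (-2) * lamR lam y + Kop (lamR lam) y + (-1) * radd (lamI lam) y"

lemma Kop_eta: "Kop u = (\<lambda>y. Lop u y + u y)" by (simp add: fun_eq_iff Kop_def)

lemma Cinf_Kop[cinf]: "open U \<Longrightarrow> Cinf_on U f \<Longrightarrow> Cinf_on U (Kop f)"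
  unfolding Kop_eta by (intro cinf)

lemma bounded_linear_of_real_Re: "bounded_linear (\<lambda>z. complex_of_real (Re z))"
  by (rule bounded_linear_compose[OF bounded_linear_of_real bounded_linear_Re])

lemma bounded_linear_ii_Im: "bounded_linear (\<lambda>z. \<i> * complex_of_real (Im z))"
  by (rule bounded_linear_compose[OF bounded_linear_mult_right])
    (rule bounded_linear_compose[OF bounded_linear_of_real bounded_linear_Im])

lemma lamR_eta: "lamR lam = (\<lambda>y. complex_of_real (Re (lam y)))" by (simp add: fun_eq_iff lamR_def)
lemma lamI_eta: "lamI lam = (\<lambda>y. \<i> * complex_of_real (Im (lam y)))" by (simp add: fun_eq_iff lamI_def)

lemma Cinf_lamR[cinf]: "open U \<Longrightarrow> Cinf_on U lam \<Longrightarrow> Cinf_on U (lamR lam)"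
  unfolding lamR_eta by (rule Cinf_linear[OF bounded_linear_of_real_Re])

lemma Cinf_lamI[cinf]: "open U \<Longrightarrow> Cinf_on U lam \<Longrightarrow> Cinf_on U (lamI lam)"
  unfolding lamI_eta by (rule Cinf_linear[OF bounded_linear_ii_Im])

context frame
begin

lemma xiL_Lop:
  assumes x: "x \<in> U" and lam: "Cinf_on U lam"
  shows "xiL m lam x = Lop (Kop (lamR lam)) x"
proof -
  have R: "Cinf_on U (lamR lam)" using Cinf_lamR[OF openU lam] .
  have "xiL m lam x = ethbar m 1 (eth m 0 (Kop (lamR lam))) x"
    unfolding xiL_def lam2R_def by (rule ethbar_cong[OF x]) (simp add: ethbar_eth_eth[OF _ R] Kop_eta)
  then show ?thesis using ethbar_eth[OF x Cinf_Kop[OF openU R]] by simp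
qed

lemma eta1L_eth:
  assumes x: "x \<in> U" and lam: "Cinf_on U lam"
  shows "eta1L m lam x = eth m 0 (gpot lam) x"
proof -
  have R: "Cinf_on U (lamR lam)" and I: "Cinf_on U (lamI lam)"
    using Cinf_lamR[OF openU lam] Cinf_lamI[OF openU lam] .
  have K: "Cinf_on U (Kop (lamR lam))" "Cinf_on U (Kop (lamI lam))" "Cinf_on U (radd (Kop (lamR lam)))"
    by (intro cinf openU R I)+
  have "radd (ethbar m 2 (lam2R m lam)) x = radd (eth m 0 (Kop (lamR lam))) x"
    unfolding lam2R_def by (rule radd_cong[OF openU x]) (simp add: ethbar_eth_eth[OF _ R] Kop_eta)
  also have "\<dots> = eth m 0 (radd (Kop (lamR lam))) x" by (rule radd_eth[OF x K(1)])
  finally have 1: "radd (ethbar m 2 (lam2R m lam)) x = eth m 0 (radd (Kop (lamR lam))) x" .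
  have 2: "ethbar m 2 (lam2I m lam) x = eth m 0 (Kop (lamI lam)) x"
    unfolding lam2I_def Kop_eta by (rule ethbar_eth_eth[OF x I])
  have "gpot lam = (\<lambda>y. (-2) * radd (Kop (lamR lam)) y + Kop (lamI lam) y)" by (simp add: fun_eq_iff gpot_def)
  then have "eth m 0 (gpot lam) x = eth m 0 (\<lambda>y. (-2) * radd (Kop (lamR lam)) y) x + eth m 0 (Kop (lamI lam)) x"
    using Cinf_differentiable[OF K(3) x] Cinf_differentiable[OF K(2) x] by (simp only: eth_add differentiable_mult differentiable_const)
  also have "eth m 0 (\<lambda>y. (-2) * radd (Kop (lamR lam)) y) x = (-2) * eth m 0 (radd (Kop (lamR lam))) x"
    by (rule eth_cmult[OF Cinf_differentiable[OF K(3) x]])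
  finally show ?thesis unfolding eta1L_def 1 2 by simp
qed

lemma mu2L_eth:
  assumes x: "x \<in> U" and lam: "Cinf_on U lam"
  shows "mu2L m lam x = eth m 1 (eth m 0 (hpot lam)) x"
proof -
  let ?D = "\<lambda>u. eth m 1 (eth m 0 u) x"
  have R: "Cinf_on U (lamR lam)" and I: "Cinf_on U (lamI lam)"
    using Cinf_lamR[OF openU lam] Cinf_lamI[OF openU lam] .
  have rR: "Cinf_on U (radd (lamR lam))" by (intro cinf openU R)
  have "radd (radd (lam2R m lam)) x = radd (eth m 1 (eth m 0 (radd (lamR lam)))) x"
    unfolding lam2R_def by (rule radd_cong[OF openU x]) (rule radd_eth_eth[OF _ R])
  also have "\<dots> = ?D (radd (radd (lamR lam)))" by (rule radd_eth_eth[OF x rR])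
  finally have 1: "radd (radd (lam2R m lam)) x = ?D (radd (radd (lamR lam)))" .
  have 2: "eth m 1 (ethbar m 2 (lam2R m lam)) x = ?D (Kop (lamR lam))"
    unfolding lam2R_def by (rule eth_cong[OF x]) (simp add: ethbar_eth_eth[OF _ R] Kop_eta)
  have 3: "radd (lam2I m lam) x = ?D (radd (lamI lam))"
    unfolding lam2I_def by (rule radd_eth_eth[OF x I])
  have C: "Cinf_on U (\<lambda>y. 2 * radd (radd (lamR lam)) y)" "Cinf_on U (\<lambda>y. (-2) * lamR lam y)"
    "Cinf_on U (Kop (lamR lam))" "Cinf_on U (\<lambda>y. (-1) * radd (lamI lam) y)"
    "Cinf_on U (radd (radd (lamR lam)))" "Cinf_on U (radd (lamI lam))"
    by (intro cinf openU R I)+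
  have "hpot lam = (\<lambda>y. ((2 * radd (radd (lamR lam)) y + (-2) * lamR lam y) + Kop (lamR lam) y) + (-1) * radd (lamI lam) y)"
    by (simp add: fun_eq_iff hpot_def)
  then have "?D (hpot lam) = ?D (\<lambda>y. ((2 * radd (radd (lamR lam)) y + (-2) * lamR lam y) + Kop (lamR lam) y) + (-1) * radd (lamI lam) y)"
    by (simp only:)
  also have "\<dots> = 2 * ?D (radd (radd (lamR lam))) + (-2) * ?D (lamR lam) + ?D (Kop (lamR lam)) + (-1) * ?D (radd (lamI lam))"
    unfolding eth2_add[OF x Cinf_add[OF openU Cinf_add[OF openU C(1,2)] C(3)] C(4)] eth2_add[OF x Cinf_add[OF openU C(1,2)] C(3)]
      eth2_add[OF x C(1,2)] eth2_cmult[OF x C(5)] eth2_cmult[OF x R] eth2_cmult[OF x C(6)] ..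
  finally show ?thesis unfolding mu2L_def 1 2 3 by (simp add: lam2R_def)
qed

end

section \<open>The contracted tensor for a given orientation\<close>

abbreviation cv :: "real^3 \<Rightarrow> 3 \<Rightarrow> complex" where "cv Q k \<equiv> complex_of_real (Q $ k)"

text \<open>r times the total coefficient of 3 n_a n_b - delta_ab. The radial component of Q belongs
  here: for Q parallel to n, Psi_Q has exactly this shape.\<close>

definition xi_tot :: "real \<Rightarrow> real^3 \<Rightarrow> (real^3 \<Rightarrow> complex) \<Rightarrow> real^3 \<Rightarrow> complex" where
  "xi_tot A Q lam x = cr x * Lop (Kop (lamR lam)) x + cr x * complex_of_real A + (3/2) * cr x * (\<Sum>k\<in>UNIV. cx k x * cv Q k)"

text \<open>Its contraction with \<open>m\<close> is the total coefficient in the place of eta_1.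
  The constants are 6 for J and 3 for Q, divided by the sqrt 2 that stands before eta_1.\<close>

definition eta_tot :: "real^3 \<Rightarrow> real^3 \<Rightarrow> (3 \<Rightarrow> real^3 \<Rightarrow> complex) \<Rightarrow> complex \<Rightarrow> 3 \<Rightarrow> real^3 \<Rightarrow> complex" where
  "eta_tot J Q T t k x = T k x + 3 * complex_of_real (sqrt 2) * t * cv J k + (3/2) * complex_of_real (sqrt 2) * cr x * cv Q k"

text \<open>No frame occurs any more, only its orientation \<open>t\<close>: for each of the two
  values this is a single function on the whole punctured ball. The powers of r that make m_a cnj
  m_b regular sit in \<open>proj\<close>.\<close>

definition density :: "(real^3 \<Rightarrow> complex) \<Rightarrow> (complex \<Rightarrow> 3 \<Rightarrow> real^3 \<Rightarrow> complex) \<Rightarrow> (3 \<Rightarrow> 3 \<Rightarrow> real^3 \<Rightarrow> complex) \<Rightarrow> complex \<Rightarrow> real^3 \<Rightarrow> complex" where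
  "density xi T V t x = 6 * (xi x * xi x) + 2 * (\<Sum>a\<in>UNIV. \<Sum>b\<in>UNIV. proj t a b x * (T t a x * cnj (T t b x)))
    + 2 * (\<Sum>a\<in>UNIV. \<Sum>b\<in>UNIV. \<Sum>c\<in>UNIV. \<Sum>d\<in>UNIV. proj t a c x * proj t b d x * (V a b x * cnj (V c d x)))"

lemma E_inf_density:
  assumes "E_inf R xi" "\<And>k. E_inf R (T t k)" "\<And>j k. E_inf R (V j k)"
  shows "E_inf R (density xi T V t)"
proof -
  have "E_inf R (\<lambda>x. density xi T V t x)" unfolding density_def by (intro einf assms finite)
  then show ?thesis by simp
qed

lemma E_inf_eta_tot: "E_inf R (T k) \<Longrightarrow> E_inf R (eta_tot J Q T t k)"
proof -
  assume "E_inf R (T k)"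
  then have "E_inf R (\<lambda>x. eta_tot J Q T t k x)" unfolding eta_tot_def by (intro einf)
  then show ?thesis by simp
qed

lemma rE_Kop: "rE a u \<Longrightarrow> rE a (Kop u)"
  unfolding Kop_eta by (intro rE_add rE_Lop)

lemma rE_lamR: "rE a u \<Longrightarrow> rE a (lamR u)"
  unfolding lamR_eta by (rule rE_linear[OF bounded_linear_of_real_Re])

lemma rE_lamI: "rE a u \<Longrightarrow> rE a (lamI u)"
  unfolding lamI_eta by (rule rE_linear[OF bounded_linear_ii_Im])

lemma rE_gpot: "rE a u \<Longrightarrow> rE a (gpot u)"
proof -
  assume "rE a u"
  then have "rE a (\<lambda>y. gpot u y)" unfolding gpot_def
    by (intro rE_add rE_cmult rE_radd rE_Kop rE_lamR rE_lamI)
  then show ?thesis by simp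
qed

lemma rE_hpot: "rE a u \<Longrightarrow> rE a (hpot u)"
proof -
  assume "rE a u"
  then have "rE a (\<lambda>y. hpot u y)" unfolding hpot_def
    by (intro rE_add rE_cmult rE_radd rE_Kop rE_lamR rE_lamI)
  then show ?thesis by simp
qed

lemma E_inf_xi_tot: assumes "rE a u" shows "E_inf a (xi_tot A Q u)"
proof -
  have "E_inf a (\<lambda>x. cr x * Lop (Kop (lamR u)) x)"
    using rE_Lop[OF rE_Kop[OF rE_lamR[OF assms]]] by (simp add: rE_def)
  then have "E_inf a (\<lambda>x. xi_tot A Q u x)" unfolding xi_tot_def
    by (rule E_inf_add[OF E_inf_add]) (intro einf finite)+
  then show ?thesis by simp
qed

context frame
begin

lemma decompose_real:
  assumes x: "x \<in> U" 
  shows "cv v b = M b x * cnj (\<Sum>e\<in>UNIV. M e x * cv v e) + cnj (M b x) * (\<Sum>e\<in>UNIV. M e x * cv v e)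
     + cx b x / cr x * (\<Sum>e\<in>UNIV. cx e x / cr x * cv v e)"
  using sum_expand[OF x, of "cv v" b] U_nz[OF x]
  by (simp add: sq_cr sum_divide_distrib[symmetric] sum_distrib_left)

text \<open>Psi_J and Psi_Q take the algebraic form of the lambda part once J x n and Q are expanded
  in the frame. Tangential components go into eta, the radial component of Q into xi; J x n has no
  radial component, and mu receives nothing.\<close>

lemma Psi_frame:
  assumes x: "x \<in> U" and lam: "Cinf_on U lam"
    and Psi: "\<Psi> = complex_of_real (PsiP 0 x i j + PsiJ J x i j + PsiA A x i j + PsiQ Q x i j) + PsiLam m lam x i j"
  defines "n \<equiv> \<lambda>k. cx k x / cr x" and "s \<equiv> complex_of_real (sqrt 2)"
  defines "z \<equiv> xiL m lam x + complex_of_real A + (3/2) * (\<Sum>k\<in>UNIV. cx k x * cv Q k)"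
    and "e \<equiv> eta1L m lam x + 3 * s * orient x * (\<Sum>k\<in>UNIV. M k x * cv J k) + (3/2) * s * cr x * (\<Sum>k\<in>UNIV. M k x * cv Q k)"
    and "u \<equiv> mu2L m lam x"
  shows "cr x * (cr x * cr x) * \<Psi> = z * (3 * n i * n j - complex_of_real (kdelta i j)) + s * e * ((n i * cnj (M j x) + n j * cnj (M i x)) / 2)
     + s * cnj e * ((n i * M j x + n j * M i x) / 2) + cnj u * M i x * M j x + u * cnj (M i x) * cnj (M j x)"
proof -
  let ?r = "cr x"
  have r0: "?r \<noteq> 0" using cr_nz[OF x] .
  have ss: "s * s = 2" by (simp add: s_def flip: of_real_mult)
  have cs: "cnj s = s" by (simp add: s_def)
  define k where "k = complex_of_real (kdelta i j)"
  define mJ mQ nQ where "mJ = (\<Sum>k\<in>UNIV. M k x * cv J k)" and "mQ = (\<Sum>k\<in>UNIV. M k x * cv Q k)"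
    and "nQ = (\<Sum>k\<in>UNIV. n k * cv Q k)"
  have nv: "complex_of_real (nvec x $ b) = n b" for b by (simp add: nvec_cx n_def)
  define v where "v = cross3 J (nvec x)"
  have vm: "(\<Sum>k\<in>UNIV. M k x * cv v k) = orient x * mJ"
  proof -
    have "cv v k = complex_of_real (cross3 J x $ k) / ?r" for k
      by (simp add: v_def nvec_def cross_mult_right)
    then have "(\<Sum>k\<in>UNIV. M k x * cv v k) = (\<Sum>k\<in>UNIV. M k x * complex_of_real (cross3 J x $ k)) / ?r"
      by (simp add: sum_divide_distrib)
    then show ?thesis using cross_contract[OF x, of J] r0 by (simp add: mJ_def)
  qed
  have nvv: "(\<Sum>k\<in>UNIV. cx k x / ?r * cv v k) = 0"
  proof -
    have "(\<Sum>k\<in>UNIV. cx k x * complex_of_real (cross3 J x $ k)) = 0"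
      by (simp add: sum_3 cross3_def algebra_simps)
    moreover have "cx k x / ?r * cv v k = cx k x * complex_of_real (cross3 J x $ k) / (?r * ?r)" for k
      by (simp add: v_def nvec_def cross_mult_right)
    ultimately show ?thesis by (simp only: sum_divide_distrib[symmetric]) simp
  qed
  have V: "cv v b = M b x * cnj (orient x * mJ) + cnj (M b x) * (orient x * mJ)" for b
    using decompose_real[OF x, of v b] unfolding vm nvv by simp
  have Q: "cv Q b = M b x * cnj mQ + cnj (M b x) * mQ + n b * nQ" for b
    using decompose_real[OF x, of Q b] unfolding mQ_def nQ_def n_def .
  have Qx: "(\<Sum>k\<in>UNIV. cx k x * cv Q k) = ?r * nQ"
    using r0 by (simp add: nQ_def n_def sum_distrib_left)
  have Qn: "complex_of_real (Q \<bullet> nvec x) = nQ"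
    by (simp add: inner_vec_def nQ_def nv[symmetric] mult.commute)
  have P: "PsiP 0 x i j = 0" by (simp add: PsiP_def)
  have J: "?r * (?r * ?r) * complex_of_real (PsiJ J x i j) = 3 * (n i * cv v j + n j * cv v i)"
    using r0 by (simp add: PsiJ_def Let_def v_def[symmetric] nv[symmetric] power3_eq_cube)
  have A: "?r * (?r * ?r) * complex_of_real (PsiA A x i j) = complex_of_real A * (3 * n i * n j - k)"
    using r0 by (simp add: PsiA_def Let_def nv[symmetric] power3_eq_cube k_def)
  have Q': "?r * (?r * ?r) * complex_of_real (PsiQ Q x i j) = (3/2) * ?r * (cv Q i * n j + cv Q j * n i - (k - n i * n j) * nQ)"
    using r0 by (simp add: PsiQ_def Let_def nv[symmetric] Qn[symmetric] power2_eq_square k_def)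
  have L: "?r * (?r * ?r) * PsiLam m lam x i j = xiL m lam x * (3 * n i * n j - k)
     + s * eta1L m lam x * ((n i * cnj (M j x) + n j * cnj (M i x)) / 2)
     + s * cnj (eta1L m lam x) * ((n i * M j x + n j * M i x) / 2) + cnj u * M i x * M j x + u * cnj (M i x) * cnj (M j x)"
    using r0 by (simp add: PsiLam_def Let_def nv power3_eq_cube k_def u_def s_def)
  have e: "e = eta1L m lam x + 3 * s * (orient x * mJ) + (3/2) * s * ?r * mQ"
    and e': "cnj e = cnj (eta1L m lam x) + 3 * s * cnj (orient x * mJ) + (3/2) * s * ?r * cnj mQ"
    by (simp_all add: e_def mJ_def mQ_def cs)
  have se: "s * e = s * eta1L m lam x + 6 * (orient x * mJ) + 3 * ?r * mQ"
    "s * cnj e = s * cnj (eta1L m lam x) + 6 * cnj (orient x * mJ) + 3 * ?r * cnj mQ"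
  proof -
    have "s * (p + 3 * s * q + (3/2) * s * ?r * w) = s * p + 3 * (s * s) * q + (3/2) * (s * s) * ?r * w" for p q w
      by (simp add: algebra_simps)
    then show "s * e = s * eta1L m lam x + 6 * (orient x * mJ) + 3 * ?r * mQ"
      "s * cnj e = s * cnj (eta1L m lam x) + 6 * cnj (orient x * mJ) + 3 * ?r * cnj mQ"
      unfolding e e' ss by (simp_all add: cs)
  qed
  have "?r * (?r * ?r) * \<Psi> = 3 * (n i * cv v j + n j * cv v i) + complex_of_real A * (3 * n i * n j - k)
     + (3/2) * ?r * (cv Q i * n j + cv Q j * n i - (k - n i * n j) * nQ)
     + ?r * (?r * ?r) * PsiLam m lam x i j"
    unfolding Psi P of_real_add distrib_left J A Q' by simp
  also have "\<dots> = (xiL m lam x + complex_of_real A + (3/2) * (?r * nQ)) * (3 * n i * n j - k)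
     + (s * eta1L m lam x + 6 * (orient x * mJ) + 3 * ?r * mQ) * ((n i * cnj (M j x) + n j * cnj (M i x)) / 2)
     + (s * cnj (eta1L m lam x) + 6 * cnj (orient x * mJ) + 3 * ?r * cnj mQ) * ((n i * M j x + n j * M i x) / 2)
     + cnj u * M i x * M j x + u * cnj (M i x) * cnj (M j x)"
    unfolding L V Q by (simp add: field_simps)
  finally show ?thesis unfolding se z_def Qx k_def by simp
qed

text \<open>r^8 is r^2 times the square of r^3: the cubes clear the prefactors of the two tensors,
  and r^2 supplies one factor r to each of xi, eta and mu.\<close>

lemma Psi_density:
  assumes x: "x \<in> U" and lam: "Cinf_on U lam"
    and Psi: "\<And>i j. Psi i j = complex_of_real (PsiP 0 x i j + PsiJ J x i j + PsiA A x i j + PsiQ Q x i j) + PsiLam m lam x i j"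
    and T: "cr x * (\<Sum>k\<in>UNIV. M k x * pd k (gpot lam) x) = (\<Sum>k\<in>UNIV. M k x * T k x)"
    and V: "cr x * (\<Sum>j\<in>UNIV. \<Sum>k\<in>UNIV. M j x * M k x * pd j (pd k (hpot lam)) x) = (\<Sum>j\<in>UNIV. \<Sum>k\<in>UNIV. M j x * M k x * V j k x)"
  shows "complex_of_real (norm x ^ 8) * (\<Sum>i\<in>UNIV. \<Sum>j\<in>UNIV. Psi i j * Psi i j)
    = density (xi_tot A Q lam) (eta_tot J Q T) V (orient x) x"
proof -
  let ?r = "cr x"
  have r0: "?r \<noteq> 0" using cr_nz[OF x] .
  define n where "n = (\<lambda>k. cx k x / ?r)"
  define s where "s = complex_of_real (sqrt 2)"
  define z where "z = xiL m lam x + complex_of_real A + (3/2) * (\<Sum>k\<in>UNIV. cx k x * cv Q k)"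
  define e where "e = eta1L m lam x + 3 * s * orient x * (\<Sum>k\<in>UNIV. M k x * cv J k) + (3/2) * s * ?r * (\<Sum>k\<in>UNIV. M k x * cv Q k)"
  define u where "u = mu2L m lam x"
  have h: "Cinf_on U (hpot lam)"
  proof -
    have "Cinf_on U (\<lambda>y. hpot lam y)" unfolding hpot_def by (intro cinf openU lam)
    then show ?thesis by simp
  qed
  have ss: "s * s = 2" by (simp add: s_def flip: of_real_mult)
  have n: "(\<Sum>i\<in>UNIV. n i * n i) = 1" "(\<Sum>i\<in>UNIV. n i * M i x) = 0" "(\<Sum>i\<in>UNIV. n i * cnj (M i x)) = 0"
    using r0 M_rel(3,4)[OF x] by (simp_all add: n_def sum_divide_distrib[symmetric] cr_sq[symmetric])
  have "(\<Sum>i\<in>UNIV. \<Sum>j\<in>UNIV. (?r * (?r * ?r) * Psi i j) * (?r * (?r * ?r) * Psi i j)) = 6 * (z * z) + 2 * (e * cnj e) + 2 * (u * cnj u)"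
  proof -
    have X: "?r * (?r * ?r) * Psi i j = z * (3 * n i * n j - complex_of_real (kdelta i j)) + s * e * ((n i * cnj (M j x) + n j * cnj (M i x)) / 2)
     + s * cnj e * ((n i * M j x + n j * M i x) / 2) + cnj u * M i x * M j x + u * cnj (M i x) * cnj (M j x)" for i j
      using Psi_frame[OF x lam Psi, of i j] unfolding n_def s_def z_def e_def u_def .
    show ?thesis unfolding X by (rule tensor_norm[OF n M_rel(1,2,5)[OF x] ss])
  qed
  moreover have "complex_of_real (norm x ^ 8) * (\<Sum>i\<in>UNIV. \<Sum>j\<in>UNIV. Psi i j * Psi i j)
    = ?r * ?r * (\<Sum>i\<in>UNIV. \<Sum>j\<in>UNIV. (?r * (?r * ?r) * Psi i j) * (?r * (?r * ?r) * Psi i j))"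
    unfolding sum_distrib_left by (simp add: eval_nat_numeral algebra_simps)
  ultimately have "complex_of_real (norm x ^ 8) * (\<Sum>i\<in>UNIV. \<Sum>j\<in>UNIV. Psi i j * Psi i j)
    = 6 * ((?r * z) * (?r * z)) + 2 * ((?r * e) * cnj (?r * e)) + 2 * ((?r * u) * cnj (?r * u))"
    by (simp add: algebra_simps)
  also have "?r * z = xi_tot A Q lam x"
    by (simp add: z_def xi_tot_def xiL_Lop[OF x lam] algebra_simps)
  \<comment> \<open>The factor r inside edth is consumed by \<open>T\<close>; the outer one is left
    for \<open>proj\<close>.\<close>
  also have re: "?r * e = ?r * (\<Sum>k\<in>UNIV. M k x * eta_tot J Q T (orient x) k x)"
  proof -
    have "eta1L m lam x = (\<Sum>k\<in>UNIV. M k x * T k x)"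
      unfolding eta1L_eth[OF x lam] eth0 T[symmetric] by (simp add: sum_distrib_left algebra_simps)
    then have "e = (\<Sum>k\<in>UNIV. M k x * eta_tot J Q T (orient x) k x)"
      unfolding e_def eta_tot_def s_def by (simp add: distrib_left sum.distrib sum_distrib_left algebra_simps)
    then show ?thesis by simp
  qed
  also have "(?r * (\<Sum>k\<in>UNIV. M k x * eta_tot J Q T (orient x) k x)) * cnj (?r * (\<Sum>k\<in>UNIV. M k x * eta_tot J Q T (orient x) k x))
    = (\<Sum>a\<in>UNIV. \<Sum>b\<in>UNIV. proj (orient x) a b x * (eta_tot J Q T (orient x) a x * cnj (eta_tot J Q T (orient x) b x)))"
  proof -
    have "(?r * (\<Sum>k\<in>UNIV. M k x * F k)) * cnj (?r * (\<Sum>k\<in>UNIV. M k x * F k))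
      = (\<Sum>a\<in>UNIV. \<Sum>b\<in>UNIV. sq x * (M a x * cnj (M b x)) * (F a * cnj (F b)))" for F
    proof -
      have "(?r * (\<Sum>k\<in>UNIV. M k x * F k)) * cnj (?r * (\<Sum>k\<in>UNIV. M k x * F k))
        = sq x * ((\<Sum>k\<in>UNIV. M k x * F k) * (\<Sum>k\<in>UNIV. cnj (M k x) * cnj (F k)))"
        by (simp add: sq_cr)
      also have "\<dots> = (\<Sum>a\<in>UNIV. \<Sum>b\<in>UNIV. sq x * (M a x * cnj (M b x)) * (F a * cnj (F b)))"
        unfolding sum_product by (simp add: sum_distrib_left algebra_simps)
      finally show ?thesis .
    qed
    then show ?thesis by (simp only: M_M_proj[OF x])
  qed
  \<comment> \<open>Here edth^2 supplies r^2 and the outer r is consumed by \<open>V\<close>, so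
    that two factors \<open>proj\<close> come out of the squared modulus.\<close>
  also have ru: "?r * u = sq x * (\<Sum>j\<in>UNIV. \<Sum>k\<in>UNIV. M j x * M k x * V j k x)"
    unfolding u_def mu2L_eth[OF x lam] eth_eth[OF x h] V[symmetric] by (simp add: sum_distrib_left algebra_simps)
  also have "(sq x * (\<Sum>j\<in>UNIV. \<Sum>k\<in>UNIV. M j x * M k x * V j k x)) * cnj (sq x * (\<Sum>j\<in>UNIV. \<Sum>k\<in>UNIV. M j x * M k x * V j k x))
    = (\<Sum>a\<in>UNIV. \<Sum>b\<in>UNIV. \<Sum>c\<in>UNIV. \<Sum>d\<in>UNIV. proj (orient x) a c x * proj (orient x) b d x * (V a b x * cnj (V c d x)))"
  proof -
    have c: "cnj (sq x) = sq x" by (simp add: sq_cr)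
    have "(sq x * (\<Sum>j\<in>UNIV. \<Sum>k\<in>UNIV. M j x * M k x * V j k x)) * cnj (sq x * (\<Sum>j\<in>UNIV. \<Sum>k\<in>UNIV. M j x * M k x * V j k x))
      = (\<Sum>a\<in>UNIV. \<Sum>b\<in>UNIV. sq x * (M a x * M b x * V a b x)) * (\<Sum>c\<in>UNIV. \<Sum>d\<in>UNIV. sq x * (cnj (M c x) * cnj (M d x) * cnj (V c d x)))"
      by (simp add: c sum_distrib_left)
    also have "\<dots> = (\<Sum>a\<in>UNIV. \<Sum>b\<in>UNIV. \<Sum>c\<in>UNIV. \<Sum>d\<in>UNIV. (sq x * (M a x * cnj (M c x))) * (sq x * (M b x * cnj (M d x))) * (V a b x * cnj (V c d x)))"
    proof -
      have prod4: "(\<Sum>a\<in>UNIV. \<Sum>b\<in>UNIV. F a b) * (\<Sum>c\<in>UNIV. \<Sum>d\<in>UNIV. G c d)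
          = (\<Sum>a\<in>UNIV. \<Sum>b\<in>UNIV. \<Sum>c\<in>UNIV. \<Sum>d\<in>UNIV. F a b * G c d)" for F G :: "3 \<Rightarrow> 3 \<Rightarrow> complex"
        by (simp only: sum_distrib_right) (simp only: sum_distrib_left)
      show ?thesis unfolding prod4 by (intro sum.cong refl) (simp add: algebra_simps)
    qed
    finally show ?thesis unfolding M_M_proj[OF x] .
  qed
  finally show ?thesis unfolding density_def .
qed

end

section \<open>Flat functions\<close>

text \<open>Decay faster than every power of r, with no condition on derivatives; for smooth
  functions these inherit the decay by \<open>flat_pd\<close>.\<close>

definition flat :: "(real^3 \<Rightarrow> complex) \<Rightarrow> bool" where
  "flat f \<longleftrightarrow> (\<forall>N. \<exists>C d. 0 < d \<and> 0 \<le> C \<and> (\<forall>x. 0 < norm x \<and> norm x < d \<longrightarrow> norm (f x) \<le> C * norm x ^ N))"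

lemma flatD:
  assumes "flat f"
  obtains C d where "0 < d" "0 \<le> C" "\<And>x. 0 < norm x \<Longrightarrow> norm x < d \<Longrightarrow> norm (f x) \<le> C * norm x ^ N"
  using assms unfolding flat_def by blast

lemma flat_add: assumes "flat f" "flat g" shows "flat (\<lambda>x. f x + g x)"
  unfolding flat_def
proof
  fix N :: nat
  obtain C d where 1: "0 < d" "0 \<le> C" "\<And>x. 0 < norm x \<Longrightarrow> norm x < d \<Longrightarrow> norm (f x) \<le> C * norm x ^ N"
    using flatD[OF assms(1)] by blast
  obtain D e where 2: "0 < e" "0 \<le> D" "\<And>x. 0 < norm x \<Longrightarrow> norm x < e \<Longrightarrow> norm (g x) \<le> D * norm x ^ N"
    using flatD[OF assms(2)] by blast
  show "\<exists>C d. 0 < d \<and> 0 \<le> C \<and> (\<forall>x. 0 < norm x \<and> norm x < d \<longrightarrow> norm (f x + g x) \<le> C * norm x ^ N)"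
  proof (rule exI[of _ "C + D"], rule exI[of _ "min d e"], intro conjI allI impI)
    fix x :: "real^3" assume "0 < norm x \<and> norm x < min d e"
    then have "norm (f x) \<le> C * norm x ^ N" "norm (g x) \<le> D * norm x ^ N" using 1 2 by auto
    then show "norm (f x + g x) \<le> (C + D) * norm x ^ N"
      using norm_triangle_ineq[of "f x" "g x"] by (simp add: distrib_right)
  qed (use 1 2 in auto)
qed

lemma Cinf_bounded:
  assumes "Cinf_on (ball 0 a) f" "0 < d" "d < a"
  obtains B where "0 \<le> B" "\<And>x. norm x \<le> d \<Longrightarrow> norm (f x) \<le> B"
proof -
  have "continuous_on (cball 0 d) f"
    using Cinf_continuous[OF assms(1)] by (rule continuous_on_subset) (use assms in auto)
  then have "compact (f ` cball 0 d)" by (rule compact_continuous_image) simp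
  then obtain B where "\<And>y. y \<in> f ` cball 0 d \<Longrightarrow> norm y \<le> B"
    using compact_imp_bounded bounded_iff by metis
  then have "norm (f x) \<le> max B 0" if "norm x \<le> d" for x using that by (simp add: le_max_iff_disj)
  then show ?thesis using that[of "max B 0"] by simp
qed

lemma flat_mult:
  assumes f: "flat f" and g: "Cinf_on (ball 0 a) g" and a: "0 < a" shows "flat (\<lambda>x. g x * f x)"
  unfolding flat_def
proof
  fix N :: nat
  obtain C d where 1: "0 < d" "0 \<le> C" "\<And>x. 0 < norm x \<Longrightarrow> norm x < d \<Longrightarrow> norm (f x) \<le> C * norm x ^ N"
    using flatD[OF f] by blast
  obtain B where B: "0 \<le> B" "\<And>x. norm x \<le> a/2 \<Longrightarrow> norm (g x) \<le> B"
    using Cinf_bounded[OF g, of "a/2"] a by auto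
  show "\<exists>C d. 0 < d \<and> 0 \<le> C \<and> (\<forall>x. 0 < norm x \<and> norm x < d \<longrightarrow> norm (g x * f x) \<le> C * norm x ^ N)"
  proof (rule exI[of _ "B * C"], rule exI[of _ "min d (a/2)"], intro conjI allI impI)
    fix x :: "real^3" assume "0 < norm x \<and> norm x < min d (a/2)"
    then have "norm (f x) \<le> C * norm x ^ N" "norm (g x) \<le> B" using 1 B by auto
    then have "norm (g x) * norm (f x) \<le> B * (C * norm x ^ N)" using B by (intro mult_mono) auto
    then show "norm (g x * f x) \<le> B * C * norm x ^ N" by (simp add: norm_mult mult.assoc)
  qed (use 1 B a in auto)
qed

text \<open>Flatness passes to derivatives by comparing \<open>f\<close> at points at distance \<open>norm x ^ N\<close>.\<close>

lemma flat_pd: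
  assumes f: "Cinf_on (ball 0 a) f" and fl: "flat f" and a: "0 < a" shows "flat (pd k f)"
  unfolding flat_def
proof
  fix N0 :: nat
  define N where "N = Suc N0"
  \<comment> \<open>Order \<open>2 * N\<close> is chosen with the division by the step
    \<open>norm x ^ Suc N\<close> in view: the exponent left is \<open>N - 1\<close>, that is
    \<open>N0\<close>. The quadratic remainder \<open>B * h * h\<close> is of at least this order
    too.\<close>
  obtain C d where C: "0 < d" "0 \<le> C" "\<And>x. 0 < norm x \<Longrightarrow> norm x < d \<Longrightarrow> norm (f x) \<le> C * norm x ^ (2 * N)"
    using flatD[OF fl] by blast
  obtain B where B: "0 \<le> B" "\<And>x. norm x \<le> a/2 \<Longrightarrow> norm (pd k (pd k f) x) \<le> B"
    using Cinf_bounded[OF Cinf_pd[OF Cinf_pd[OF f]], of "a/2"] a by auto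
  define r where "r = min (min d (a/2)) (1/2) / 4"
  have r: "0 < r" "r \<le> 1/8" "4 * r \<le> d" "4 * r \<le> a/2" using C a by (auto simp: r_def)
  show "\<exists>C d. 0 < d \<and> 0 \<le> C \<and> (\<forall>x. 0 < norm x \<and> norm x < d \<longrightarrow> norm (pd k f x) \<le> C * norm x ^ N0)"
  proof (rule exI[of _ "C * 2 ^ (2 * N) + C + B"], rule exI[of _ r], intro conjI allI impI)
    fix x :: "real^3" assume x: "0 < norm x \<and> norm x < r"
    \<comment> \<open>the step is at most \<open>norm x / 8\<close> so that \<open>x + t e\<^sub>k\<close> stays away from the origin\<close>
    define h where "h = norm x ^ (Suc N)"
    have "norm x * (norm x * norm x ^ N0) \<le> norm x * (1/8 * 1)"
      using x r by (intro mult_left_mono mult_mono power_le_one) auto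
    then have h8: "h \<le> norm x / 8" by (simp add: h_def N_def)
    have h0: "0 < h" using x by (simp add: h_def)
    have near: "norm (x + t *\<^sub>R ex k) \<le> a/2" "norm (x + t *\<^sub>R ex k) < a" if "0 \<le> t" "t \<le> h" for t
    proof -
      have "norm (x + t *\<^sub>R ex k) \<le> norm x + t" using norm_triangle_ineq[of x "t *\<^sub>R ex k"] that by (simp add: norm_axis_1)
      then show "norm (x + t *\<^sub>R ex k) \<le> a/2" "norm (x + t *\<^sub>R ex k) < a" using that h8 x r a by auto
    qed
    have D1: "norm (pd k f (x + t *\<^sub>R ex k) - pd k f x) \<le> B * h" if t: "0 \<le> t" "t \<le> h" for t
    proof -
      have "norm (pd k f (x + t *\<^sub>R ex k) - pd k f (x + 0 *\<^sub>R ex k)) \<le> B * t"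
      proof (rule vector_derivative_bound[where f = "\<lambda>t. pd k f (x + t *\<^sub>R ex k)"])
        fix s assume s: "0 \<le> s" "s \<le> t"
        show "((\<lambda>t. pd k f (x + t *\<^sub>R ex k)) has_vector_derivative pd k (pd k f) (x + s *\<^sub>R ex k)) (at s)"
          using near(2)[of s] s t by (intro pd_line_axis Cinf_differentiable[OF Cinf_pd[OF f]]) auto
        show "norm (pd k (pd k f) (x + s *\<^sub>R ex k)) \<le> B" using near(1)[of s] s t B by auto
      qed (use t in auto)
      also have "B * t \<le> B * h" using B t by (intro mult_left_mono) auto
      finally show ?thesis by simp
    qed
    let ?g = "\<lambda>t. f (x + t *\<^sub>R ex k) - t *\<^sub>R pd k f x"
    have "norm (?g h - ?g 0) \<le> (B * h) * h"
    proof (rule vector_derivative_bound[where f' = "\<lambda>t. pd k f (x + t *\<^sub>R ex k) - pd k f x"])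
      fix t assume t: "0 \<le> t" "t \<le> h"
      have "f differentiable (at (x + t *\<^sub>R ex k))" using near(2)[OF t] by (intro Cinf_differentiable[OF f]) auto
      then show "(?g has_vector_derivative pd k f (x + t *\<^sub>R ex k) - pd k f x) (at t)"
        using pd_line_axis by (auto intro!: derivative_eq_intros)
      show "norm (pd k f (x + t *\<^sub>R ex k) - pd k f x) \<le> B * h" using D1[OF t] .
    qed (use h0 in auto)
    then have g: "norm (f (x + h *\<^sub>R ex k) - f x - h *\<^sub>R pd k f x) \<le> B * h * h" by (simp add: algebra_simps)
    have y: "0 < norm (x + h *\<^sub>R ex k)" "norm (x + h *\<^sub>R ex k) < d" "norm (x + h *\<^sub>R ex k) \<le> 2 * norm x"
    proof -
      have "norm x - h \<le> norm (x + h *\<^sub>R ex k)" "norm (x + h *\<^sub>R ex k) \<le> norm x + h"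
        using norm_diff_ineq[of x "h *\<^sub>R ex k"] norm_triangle_ineq[of x "h *\<^sub>R ex k"] h0 by (auto simp: norm_axis_1)
      moreover have "h < norm x" "norm x + h \<le> 2 * norm x" "2 * norm x < d"
        using h8 conjunct1[OF x] conjunct2[OF x] r by linarith+
      ultimately show "0 < norm (x + h *\<^sub>R ex k)" "norm (x + h *\<^sub>R ex k) < d" "norm (x + h *\<^sub>R ex k) \<le> 2 * norm x" by auto
    qed
    have f1: "norm (f (x + h *\<^sub>R ex k)) \<le> C * (2 ^ (2 * N) * norm x ^ (2 * N))"
    proof -
      have "norm (f (x + h *\<^sub>R ex k)) \<le> C * norm (x + h *\<^sub>R ex k) ^ (2 * N)" by (rule C(3)[OF y(1,2)])
      also have "\<dots> \<le> C * (2 * norm x) ^ (2 * N)" using C y by (intro mult_left_mono power_mono) auto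
      finally show ?thesis by (simp add: power_mult_distrib)
    qed
    have f2: "norm (f x) \<le> C * norm x ^ (2 * N)" using C x r by auto
    have hh: "h * h \<le> norm x ^ (2 * N)"
    proof -
      have "h * h = norm x ^ (2 * Suc N)" by (simp add: h_def power_add[symmetric] mult_2)
      also have "\<dots> \<le> norm x ^ (2 * N)" using x r by (intro power_decreasing) auto
      finally show ?thesis .
    qed
    have "norm (h *\<^sub>R pd k f x) \<le> norm (f (x + h *\<^sub>R ex k) - f x) + norm (f (x + h *\<^sub>R ex k) - f x - h *\<^sub>R pd k f x)"
      using norm_triangle_ineq4[of "f (x + h *\<^sub>R ex k) - f x" "f (x + h *\<^sub>R ex k) - f x - h *\<^sub>R pd k f x"] by simp
    also have "\<dots> \<le> (norm (f (x + h *\<^sub>R ex k)) + norm (f x)) + B * h * h"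
      using norm_triangle_ineq4[of "f (x + h *\<^sub>R ex k)" "f x"] g by simp
    also have "\<dots> \<le> (C * 2 ^ (2 * N) + C + B) * norm x ^ (2 * N)"
      using f1 f2 mult_left_mono[OF hh B(1)] by (simp add: algebra_simps)
    also have "\<dots> = h * ((C * 2 ^ (2 * N) + C + B) * norm x ^ N0)"
    proof -
      have "norm x ^ (2 * N) = h * norm x ^ N0"
        by (simp only: h_def N_def power_add[symmetric]) (simp add: mult_2)
      then show ?thesis by (simp only:) (simp add: mult_ac)
    qed
    finally have "h * norm (pd k f x) \<le> h * ((C * 2 ^ (2 * N) + C + B) * norm x ^ N0)" using h0 by simp
    then show "norm (pd k f x) \<le> (C * 2 ^ (2 * N) + C + B) * norm x ^ N0" using h0 by simp
  qed (use r C B in auto)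
qed

text \<open>Each derivative of r brings a factor 1/r, which r^2 turns back into r. These squares
  accumulate as \<open>sq x ^ m\<close>, whose own derivative only changes the coefficients of
  \<open>g1\<close> and \<open>g2\<close>; hence the new parts are again smooth and flat.\<close>

lemma flat_quotient_pd:
  assumes a: "0 < a" and h: "Cinf_on (ball 0 a - {0}) h"
    and g: "Cinf_on (ball 0 a) g1" "Cinf_on (ball 0 a) g2" "flat g1" "flat g2"
    and e: "\<And>x. x \<in> ball 0 a - {0} \<Longrightarrow> sq x ^ m * h x = g1 x + cr x * g2 x"
  shows "\<exists>G1 G2. Cinf_on (ball 0 a) G1 \<and> Cinf_on (ball 0 a) G2 \<and> flat G1 \<and> flat G2 \<and>
    (\<forall>x\<in>ball 0 a - {0}. sq x ^ Suc m * pd k h x = G1 x + cr x * G2 x)"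
proof -
  let ?V = "ball 0 a - {0::real^3}"
  let ?c = "2 * complex_of_nat m"
  let ?G1 = "\<lambda>x. sq x * pd k g1 x + (- ?c * cx k x) * g1 x"
  let ?G2 = "\<lambda>x. sq x * pd k g2 x + ((1 - ?c) * cx k x) * g2 x"
  have S: "Cinf_on (ball 0 a) sq" "Cinf_on (ball 0 a) (\<lambda>x. c * cx k x)" for c
    by (intro cinf open_ball)+
  have "Cinf_on (ball 0 a) ?G1" "Cinf_on (ball 0 a) ?G2"
    by (intro cinf open_ball g Cinf_pd)+
  moreover have "flat ?G1" "flat ?G2"
    by (intro flat_add flat_mult[OF flat_pd[OF g(1,3) a] S(1) a] flat_mult[OF flat_pd[OF g(2,4) a] S(1) a]
        flat_mult[OF g(3) S(2) a] flat_mult[OF g(4) S(2) a])+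
  moreover have "sq x ^ Suc m * pd k h x = ?G1 x + cr x * ?G2 x" if x: "x \<in> ?V" for x
  proof -
    have x0: "x \<noteq> 0" using x by simp
    have d: "g1 differentiable (at x)" "g2 differentiable (at x)" "h differentiable (at x)"
      using x Cinf_differentiable[OF g(1)] Cinf_differentiable[OF g(2)] Cinf_differentiable[OF h] by auto
    have Cp: "Cinf_on ?V (\<lambda>y. sq y ^ j)" for j
      by (induct j) (auto intro!: cinf open_punctured)
    have dp: "(\<lambda>y. sq y ^ j) differentiable (at x)" for j using Cinf_differentiable[OF Cp x] .
    have pw: "sq x * pd k (\<lambda>y. sq y ^ j) x = 2 * of_nat j * cx k x * sq x ^ j" for j
    proof (induct j)
      case (Suc j)
      have "pd k (\<lambda>y. sq y ^ Suc j) x = 2 * cx k x * sq x ^ j + sq x * pd k (\<lambda>y. sq y ^ j) x"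
        using pd_mult[OF sq_differentiable dp, of k j] by (simp add: pd_sq)
      then show ?case using Suc by (simp add: algebra_simps)
    qed (simp add: pd_const)
    have "pd k (\<lambda>y. sq y ^ m * h y) x = pd k (\<lambda>y. g1 y + cr y * g2 y) x"
      by (rule pd_cong[OF open_punctured x e])
    then have "pd k (\<lambda>y. sq y ^ m) x * h x + sq x ^ m * pd k h x = pd k g1 x + (cx k x * (g2 x / cr x) + cr x * pd k g2 x)"
      using d x0 by (simp add: pd_mult[OF dp d(3)] pd_add differentiable_mult differentiable_cr pd_cr_mult)
    then have "(sq x * pd k (\<lambda>y. sq y ^ m) x) * h x + sq x ^ Suc m * pd k h x
      = sq x * pd k g1 x + (cx k x * (sq x * (g2 x / cr x)) + sq x * (cr x * pd k g2 x))"
      by (metis (no_types, lifting) distrib_left mult.assoc mult.left_commute power_Suc)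
    moreover have "sq x * (g2 x / cr x) = cr x * g2 x" using x0 by (simp add: sq_cr)
    ultimately have E: "(2 * of_nat m * cx k x * sq x ^ m) * h x + sq x ^ Suc m * pd k h x
      = sq x * pd k g1 x + (cx k x * (cr x * g2 x) + sq x * (cr x * pd k g2 x))"
      unfolding pw by (simp only:)
    then have "?c * cx k x * (sq x ^ m * h x) + sq x ^ Suc m * pd k h x
      = sq x * pd k g1 x + (cx k x * (cr x * g2 x) + sq x * (cr x * pd k g2 x))"
      by (simp only: mult.assoc)
    then show ?thesis unfolding e[OF x] by (simp add: algebra_simps)
  qed
  ultimately show ?thesis by blast
qed

lemma flat_quotient_hpd:
  assumes a: "0 < a" and h: "Cinf_on (ball 0 a - {0}) h"
    and g: "Cinf_on (ball 0 a) g1" "Cinf_on (ball 0 a) g2" "flat g1" "flat g2"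
    and e: "\<And>x. x \<in> ball 0 a - {0} \<Longrightarrow> h x = g1 x + cr x * g2 x"
  shows "\<exists>G1 G2. Cinf_on (ball 0 a) G1 \<and> Cinf_on (ball 0 a) G2 \<and> flat G1 \<and> flat G2 \<and>
    (\<forall>x\<in>ball 0 a - {0}. sq x ^ length ks * hpd ks h x = G1 x + cr x * G2 x)"
proof (induct ks)
  case Nil then show ?case using g e by (intro exI[of _ g1] exI[of _ g2]) simp
next
  case (Cons k ks)
  then obtain G1 G2 where "Cinf_on (ball 0 a) G1" "Cinf_on (ball 0 a) G2" "flat G1" "flat G2"
    "\<And>x. x \<in> ball 0 a - {0} \<Longrightarrow> sq x ^ length ks * hpd ks h x = G1 x + cr x * G2 x" by blast
  from flat_quotient_pd[OF a Cinf_hpd[OF h] this] show ?case by simp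
qed

definition vanishing :: "(real^3 \<Rightarrow> complex) \<Rightarrow> bool" where
  "vanishing f \<longleftrightarrow> (\<forall>e>0. \<exists>d>0. \<forall>x. 0 < norm x \<and> norm x < d \<longrightarrow> norm (f x) \<le> e)"

lemma flat_hpd_vanishing:
  assumes a: "0 < a" and h: "Cinf_on (ball 0 a - {0}) h"
    and g: "Cinf_on (ball 0 a) g1" "Cinf_on (ball 0 a) g2" "flat g1" "flat g2"
    and e: "\<And>x. x \<in> ball 0 a - {0} \<Longrightarrow> h x = g1 x + cr x * g2 x"
  shows "vanishing (hpd ks h)"
  unfolding vanishing_def
proof (intro allI impI)
  fix \<epsilon> :: real assume \<epsilon>: "\<epsilon> > 0"
  let ?m = "length ks"
  obtain G1 G2 where G: "flat G1" "flat G2"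
    and E: "\<And>x. x \<in> ball 0 a - {0} \<Longrightarrow> sq x ^ ?m * hpd ks h x = G1 x + cr x * G2 x"
    using flat_quotient_hpd[OF a h g e] by blast
  \<comment> \<open>Order \<open>2 * ?m + 1\<close> beats the factor \<open>sq x ^ ?m\<close> by one
    power of r, and this power gives the limit 0.\<close>
  obtain C1 d1 where 1: "0 < d1" "0 \<le> C1" "\<And>x. 0 < norm x \<Longrightarrow> norm x < d1 \<Longrightarrow> norm (G1 x) \<le> C1 * norm x ^ Suc (2 * ?m)"
    using flatD[OF G(1)] by blast
  obtain C2 d2 where 2: "0 < d2" "0 \<le> C2" "\<And>x. 0 < norm x \<Longrightarrow> norm x < d2 \<Longrightarrow> norm (G2 x) \<le> C2 * norm x ^ Suc (2 * ?m)"
    using flatD[OF G(2)] by blast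
  define d where "d = Min {d1, d2, a, 1, \<epsilon> / (C1 + C2 + 1)}"
  have d: "0 < d" "d \<le> d1" "d \<le> d2" "d \<le> a" "d \<le> 1" "d \<le> \<epsilon> / (C1 + C2 + 1)"
    using 1 2 a \<epsilon> by (auto simp: d_def)
  show "\<exists>d>0. \<forall>x. 0 < norm x \<and> norm x < d \<longrightarrow> norm (hpd ks h x) \<le> \<epsilon>"
  proof (intro exI[of _ d] conjI allI impI d(1))
    fix x :: "real^3" assume x: "0 < norm x \<and> norm x < d"
    let ?r = "norm x"
    have "norm (G1 x + cr x * G2 x) \<le> norm (G1 x) + ?r * norm (G2 x)"
      using norm_triangle_ineq[of "G1 x" "cr x * G2 x"] by (simp add: norm_mult)
    also have "\<dots> \<le> norm (G1 x) + 1 * norm (G2 x)" using x d by (intro add_left_mono mult_right_mono) auto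
    also have "\<dots> \<le> (C1 + C2) * ?r ^ Suc (2 * ?m)" using 1(3)[of x] 2(3)[of x] x d by (simp add: distrib_right)
    finally have "norm (sq x ^ ?m * hpd ks h x) \<le> (C1 + C2) * ?r ^ Suc (2 * ?m)" using E[of x] x d by simp
    moreover have "norm (sq x ^ ?m * hpd ks h x) = ?r ^ (2 * ?m) * norm (hpd ks h x)"
      by (simp add: sq_cr norm_mult norm_power power_mult power2_eq_square)
    ultimately have "?r ^ (2 * ?m) * norm (hpd ks h x) \<le> ?r ^ (2 * ?m) * ((C1 + C2) * ?r)" by (simp add: mult_ac)
    then have "norm (hpd ks h x) \<le> (C1 + C2) * ?r" using x by simp
    also have "\<dots> \<le> (C1 + C2 + 1) * (\<epsilon> / (C1 + C2 + 1))" using x d 1 2 by (intro mult_mono) auto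
    also have "\<dots> = \<epsilon>" using 1 2 by simp
    finally show "norm (hpd ks h x) \<le> \<epsilon>" .
  qed
qed

section \<open>Removing a singularity at the origin\<close>

text \<open>A mean value estimate on the segment from the origin to \<open>y\<close>. The derivative
  along it is available only for positive \<open>t\<close>; at \<open>t = 0\<close> continuity
  suffices, and this is the vanishing of \<open>h\<close> itself.\<close>

lemma extend_derivative:
  assumes a: "0 < a" and h: "\<And>x. x \<in> ball 0 a - {0} \<Longrightarrow> h differentiable (at x)"
    and v: "vanishing h" "\<And>k. vanishing (pd k h)"
  shows "((\<lambda>x. if x = 0 then 0 else h x) has_derivative (\<lambda>_. 0)) (at 0)"
  unfolding has_derivative_at_alt
proof (intro conjI allI impI bounded_linear_zero)
  let ?h = "\<lambda>x. if x = 0 then 0 else h x"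
  fix e :: real assume e: "e > 0"
  \<comment> \<open>A third of \<open>e\<close> for each of the three partial derivatives.\<close>
  have "\<exists>d>0. \<forall>x. 0 < norm x \<and> norm x < d \<longrightarrow> norm (pd k h x) \<le> e / 3" for k
    by (rule v(2)[unfolded vanishing_def, THEN spec, THEN mp]) (use e in simp)
  then obtain dd where dd: "\<And>k. 0 < dd k" "\<And>k x. 0 < norm x \<Longrightarrow> norm x < dd k \<Longrightarrow> norm (pd k h x) \<le> e / 3"
    by metis
  define d where "d = min a (Min (range dd))"
  have d: "0 < d" "d \<le> a" "\<And>k. d \<le> dd k" using a dd(1) by (auto simp: d_def intro: min.coboundedI2)
  show "\<exists>d>0. \<forall>y. norm (y - 0) < d \<longrightarrow> norm (?h y - ?h 0 - 0) \<le> e * norm (y - 0)"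
  proof (intro exI[of _ d] conjI d(1) allI impI)
    fix y :: "real^3" assume y: "norm (y - 0) < d"
    show "norm (?h y - ?h 0 - 0) \<le> e * norm (y - 0)"
    proof (cases "y = 0")
      case False
      have pos: "0 < norm (t *\<^sub>R y)" "norm (t *\<^sub>R y) < d" "t *\<^sub>R y \<in> ball 0 a - {0}" if "0 < t" "t \<le> 1" for t
      proof -
        have "norm (t *\<^sub>R y) \<le> 1 * norm y" using mult_right_mono[of t 1 "norm y"] that by simp
        moreover have "norm y < d" "norm y < a" using y d by auto
        ultimately have "norm (t *\<^sub>R y) < d" "norm (t *\<^sub>R y) < a" by auto
        then show "0 < norm (t *\<^sub>R y)" "norm (t *\<^sub>R y) < d" "t *\<^sub>R y \<in> ball 0 a - {0}" using that False by auto
      qed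
      have der: "((\<lambda>t. ?h (t *\<^sub>R y)) has_vector_derivative (\<Sum>k\<in>UNIV. y $ k *\<^sub>R pd k h (t *\<^sub>R y))) (at t)"
        if t: "0 < t" "t \<le> 1" for t
      proof -
        have "((\<lambda>t. h (0 + t *\<^sub>R y)) has_vector_derivative (\<Sum>k\<in>UNIV. y $ k *\<^sub>R pd k h (0 + t *\<^sub>R y))) (at t)"
          using h pos[OF t] by (intro pd_line) simp
        then have "((\<lambda>t. h (t *\<^sub>R y)) has_vector_derivative (\<Sum>k\<in>UNIV. y $ k *\<^sub>R pd k h (t *\<^sub>R y))) (at t)" by simp
        then show ?thesis
          by (rule has_vector_derivative_transform_within_open[where S = "{0<..}"]) (use t False in auto)
      qed
      have cont: "continuous_on {0..1} (\<lambda>t. ?h (t *\<^sub>R y))"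
      proof (rule continuous_at_imp_continuous_on, rule ballI)
        fix t :: real assume t: "t \<in> {0..1}"
        show "isCont (\<lambda>t. ?h (t *\<^sub>R y)) t"
        proof (cases "t = 0")
          case True
          show ?thesis unfolding True continuous_at_eps_delta
          proof (intro allI impI)
            fix c :: real assume c: "c > 0"
            then obtain \<delta> where \<delta>: "\<delta> > 0" "\<And>x. 0 < norm x \<Longrightarrow> norm x < \<delta> \<Longrightarrow> norm (h x) \<le> c / 2"
              using v(1) unfolding vanishing_def by (meson half_gt_zero)
            show "\<exists>\<delta>>0. \<forall>s. dist s 0 < \<delta> \<longrightarrow> dist (?h (s *\<^sub>R y)) (?h (0 *\<^sub>R y)) < c"
            proof (intro exI[of _ "\<delta> / norm y"] conjI allI impI)
              fix s :: real assume "dist s 0 < \<delta> / norm y"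
              then have "norm (s *\<^sub>R y) < \<delta>" using False by (simp add: field_simps)
              then show "dist (?h (s *\<^sub>R y)) (?h (0 *\<^sub>R y)) < c"
                using \<delta>(2)[of "s *\<^sub>R y"] c False by (cases "s = 0") auto
            qed (use \<delta> False in auto)
          qed
        next
          case False
          then show ?thesis using der[of t] t has_vector_derivative_continuous by auto
        qed
      qed
      have "norm (?h (1 *\<^sub>R y) - ?h (0 *\<^sub>R y)) \<le> e * norm y * 1 - e * norm y * 0"
      proof (rule differentiable_bound_general[where f = "\<lambda>t. ?h (t *\<^sub>R y)" and \<phi>' = "\<lambda>_. e * norm y" and \<phi> = "\<lambda>t. e * norm y * t",
            OF zero_less_one cont _ der])
        show "continuous_on {0..1} (\<lambda>t. e * norm y * t)" by (intro continuous_intros)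
        fix t :: real assume t: "0 < t" "t < 1"
        then show "0 < t" "t \<le> 1" by auto
        show "((\<lambda>t. e * norm y * t) has_vector_derivative e * norm y) (at t)"
          by (auto simp: has_vector_derivative_def intro!: derivative_eq_intros)
        have "norm (\<Sum>k\<in>UNIV. y $ k *\<^sub>R pd k h (t *\<^sub>R y)) \<le> (\<Sum>k\<in>(UNIV::3 set). norm y * (e / 3))"
        proof (rule sum_norm_le)
          fix k :: 3
          have "norm (pd k h (t *\<^sub>R y)) \<le> e / 3" using dd(2)[of "t *\<^sub>R y" k] pos[of t] t d(3)[of k] by auto
          then show "norm (y $ k *\<^sub>R pd k h (t *\<^sub>R y)) \<le> norm y * (e / 3)"
            unfolding norm_scaleR using component_le_norm_cart[of y k] by (intro mult_mono) auto
        qed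
        then show "norm (\<Sum>k\<in>UNIV. y $ k *\<^sub>R pd k h (t *\<^sub>R y)) \<le> e * norm y" by (simp add: mult.commute)
      qed
      then show ?thesis using False by (simp only: scaleR_one scaleR_zero_left) simp
    qed simp
  qed
qed

text \<open>Extension by 0 commutes with partial derivatives, as all of them vanish at the origin;
  hence \<open>extend_derivative\<close> applies at every order.\<close>

lemma Cinf_extend:
  assumes a: "0 < a" and h: "Cinf_on (ball 0 a - {0}) h" and v: "\<And>ks. vanishing (hpd ks h)"
  shows "Cinf_on (ball 0 a) (\<lambda>x. if x = 0 then 0 else h x)"
proof -
  let ?e = "\<lambda>f (x::real^3). if x = 0 then 0 else f x :: complex"
  have der0: "(?e (hpd ks h) has_derivative (\<lambda>_. 0)) (at 0)" for ks
    using extend_derivative[OF a Cinf_differentiable[OF Cinf_hpd[OF h]] v, of ks] v[of "_ # ks"] by simp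
  have der: "?e (hpd ks h) differentiable (at x)" if "x \<in> ball 0 a" for ks x
  proof (cases "x = 0")
    case True then show ?thesis using der0 differentiable_def by blast
  next
    case False
    then have x: "x \<in> ball 0 a - {0}" using that by simp
    show ?thesis
      by (rule differentiable_cong_open[OF open_punctured x _ Cinf_differentiable[OF Cinf_hpd[OF h] x]]) auto
  qed
  have pd: "pd k (?e (hpd ks h)) x = ?e (hpd (k # ks) h) x" if "x \<in> ball 0 a" for k ks x
  proof (cases "x = 0")
    case True then show ?thesis using pd_eq[OF der0] by simp
  next
    case False
    then have x: "x \<in> ball 0 a - {0}" using that by simp
    have "pd k (?e (hpd ks h)) x = pd k (hpd ks h) x" by (rule pd_cong[OF open_punctured x]) auto
    then show ?thesis using False by simp
  qed
  have hpd: "\<forall>x\<in>ball 0 a. hpd ks (?e h) x = ?e (hpd ks h) x" for ks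
  proof (induct ks)
    case (Cons k ks)
    have "pd k (hpd ks (?e h)) x = pd k (?e (hpd ks h)) x" if "x \<in> ball 0 a" for x
      by (rule pd_cong[OF open_ball that]) (use Cons in auto)
    then show ?case using pd by simp
  qed simp
  show ?thesis unfolding Cinf_alt
  proof (intro allI ballI)
    fix ks and x :: "real^3" assume x: "x \<in> ball 0 a"
    show "hpd ks (?e h) differentiable (at x)"
      by (rule differentiable_cong_open[OF open_ball x _ der[OF x]]) (use hpd in auto)
  qed
qed

section \<open>Taylor series along lines\<close>

definition dird :: "real^3 \<Rightarrow> (real^3 \<Rightarrow> complex) \<Rightarrow> real^3 \<Rightarrow> complex" where
  "dird v f x = (\<Sum>k\<in>UNIV. cv v k * pd k f x)"

definition dirn :: "nat \<Rightarrow> real^3 \<Rightarrow> (real^3 \<Rightarrow> complex) \<Rightarrow> real^3 \<Rightarrow> complex" where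
  "dirn n v = dird v ^^ n"

lemma dirn_0: "dirn 0 v f = f" by (simp add: dirn_def)

lemma dirn_Suc: "dirn (Suc n) v f = dirn n v (dird v f)"
  by (simp add: dirn_def funpow_swap1)

lemma dirn_Suc_outer: "dirn (Suc n) v f = dird v (dirn n v f)"
  by (simp add: dirn_def)

lemma Cinf_dird: "open U \<Longrightarrow> Cinf_on U f \<Longrightarrow> Cinf_on U (dird v f)"
  unfolding dird_def by (intro cinf Cinf_pd) auto

lemma Cinf_dirn: "open U \<Longrightarrow> Cinf_on U f \<Longrightarrow> Cinf_on U (dirn n v f)"
  by (induct n) (auto simp: dirn_0 dirn_Suc_outer Cinf_dird)

lemma dirn_cong:
  assumes "open U" "\<And>y. y \<in> U \<Longrightarrow> f y = g y" "x \<in> U" shows "dirn n v f x = dirn n v g x"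
  using assms(3)
proof (induct n arbitrary: x)
  case (Suc n)
  have "pd k (dirn n v f) x = pd k (dirn n v g) x" for k
    by (rule pd_cong[OF assms(1) Suc(2) Suc(1)])
  then show ?case by (simp add: dirn_Suc_outer dird_def)
qed (simp add: dirn_0 assms(2))

lemma dird_add:
  "f differentiable (at x) \<Longrightarrow> g differentiable (at x) \<Longrightarrow> dird v (\<lambda>y. f y + g y) x = dird v f x + dird v g x"
  by (simp add: dird_def pd_add sum.distrib distrib_left)

lemma dird_cmult: "f differentiable (at x) \<Longrightarrow> dird v (\<lambda>y. c * f y) x = c * dird v f x"
  by (simp add: dird_def pd_cmult sum_distrib_left mult.left_commute)

lemma dird_mult:
  "f differentiable (at x) \<Longrightarrow> g differentiable (at x) \<Longrightarrow>
    dird v (\<lambda>y. f y * g y) x = dird v f x * g x + f x * dird v g x"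
  by (simp add: dird_def pd_mult sum.distrib sum_distrib_left sum_distrib_right algebra_simps)

lemma dirn_add:
  assumes U: "open U" and fg: "Cinf_on U f" "Cinf_on U g" and x: "x \<in> U"
  shows "dirn n v (\<lambda>y. f y + g y) x = dirn n v f x + dirn n v g x"
  using x
proof (induct n arbitrary: x)
  case (Suc n)
  have "dirn (Suc n) v (\<lambda>y. f y + g y) x = dird v (\<lambda>y. dirn n v f y + dirn n v g y) x"
    unfolding dirn_Suc_outer dird_def using pd_cong[OF U Suc(2) Suc(1)] by simp
  also have "\<dots> = dirn (Suc n) v f x + dirn (Suc n) v g x"
    unfolding dirn_Suc_outer using Suc(2) by (intro dird_add Cinf_differentiable[OF Cinf_dirn[OF U]] fg)
  finally show ?case .
qed (simp add: dirn_0)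

lemma dirn_cmult:
  assumes U: "open U" and f: "Cinf_on U f" and x: "x \<in> U"
  shows "dirn n v (\<lambda>y. c * f y) x = c * dirn n v f x"
  using x
proof (induct n arbitrary: x)
  case (Suc n)
  have "dirn (Suc n) v (\<lambda>y. c * f y) x = dird v (\<lambda>y. c * dirn n v f y) x"
    unfolding dirn_Suc_outer dird_def using pd_cong[OF U Suc(2) Suc(1)] by simp
  also have "\<dots> = c * dirn (Suc n) v f x"
    unfolding dirn_Suc_outer using Suc(2) by (intro dird_cmult Cinf_differentiable[OF Cinf_dirn[OF U]] f)
  finally show ?case .
qed (simp add: dirn_0)

text \<open>Trades the innermost directional derivative for partial ones, so that later inductions
  on the order run with \<open>pd k f\<close> in place of \<open>f\<close>.\<close>

lemma dirn_Suc_sum: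
  assumes U: "open U" and f: "Cinf_on U f" and x: "x \<in> U"
  shows "dirn (Suc n) v f x = (\<Sum>k\<in>UNIV. cv v k * dirn n v (pd k f) x)"
proof -
  have C: "Cinf_on U (\<lambda>y. cv v k * pd k f y)" for k using U f by (intro cinf Cinf_pd)
  have "dirn (Suc n) v f x = dirn n v (\<lambda>y. (cv v 1 * pd 1 f y + cv v 2 * pd 2 f y) + cv v 3 * pd 3 f y) x"
    unfolding dirn_Suc dird_def sum_3 ..
  also have "\<dots> = (\<Sum>k\<in>UNIV. cv v k * dirn n v (pd k f) x)"
    by (simp only: dirn_add[OF U Cinf_add[OF U C C] C x] dirn_add[OF U C C x] dirn_cmult[OF U Cinf_pd[OF f] x] sum_3)
  finally show ?thesis .
qed

lemma dirn_zero:
  assumes "open U" "x \<in> U" "Cinf_on U f" "\<And>ks. hpd ks f x = 0" shows "dirn n v f x = 0"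
  using assms(3,4)
proof (induct n arbitrary: f)
  case 0 then show ?case using 0(2)[of "[]"] by (simp add: dirn_0)
next
  case (Suc n)
  have "dirn n v (pd k f) x = 0" for k
    using Suc(1)[OF Cinf_pd[OF Suc(2)]] Suc(3)[of "_ @ [k]"] by (simp add: hpd_append)
  then show ?case using dirn_Suc_sum[OF assms(1) Suc(2) assms(2)] by simp
qed

text \<open>A Taylor coefficient is a homogeneous polynomial in the direction, here restricted to a
  line of directions; every order contributes linear factors
  \<open>[:cv v k, cv w k:]\<close>.\<close>

lemma dirn_poly:
  assumes "open U" "x \<in> U" "Cinf_on U f"
  shows "\<exists>P. \<forall>t. dirn n (v + t *\<^sub>R w) f x = poly P (complex_of_real t)"
  using assms(3)
proof (induct n arbitrary: f)
  case 0 show ?case by (rule exI[of _ "[:f x:]"]) (simp add: dirn_0)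
next
  case (Suc n)
  have "\<forall>k. \<exists>P. \<forall>t. dirn n (v + t *\<^sub>R w) (pd k f) x = poly P (complex_of_real t)"
    using Suc(1)[OF Cinf_pd[OF Suc(2)]] by blast
  then obtain P where P: "\<And>k t. dirn n (v + t *\<^sub>R w) (pd k f) x = poly (P k) (complex_of_real t)" by metis
  show ?case
    by (rule exI[of _ "\<Sum>k\<in>UNIV. [:cv v k, cv w k:] * P k"])
      (simp add: dirn_Suc_sum[OF assms(1) Suc(2) assms(2)] P poly_sum algebra_simps)
qed

lemma dirn_bound:
  assumes "0 < d" "d < a" "Cinf_on (ball 0 a) f"
  shows "\<exists>C\<ge>0. \<forall>v x. norm x \<le> d \<longrightarrow> norm (dirn n v f x) \<le> C * norm v ^ n"
  using assms(3)
proof (induct n arbitrary: f)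
  case 0
  obtain B where "0 \<le> B" "\<And>x. norm x \<le> d \<Longrightarrow> norm (f x) \<le> B" using Cinf_bounded[OF 0 assms(1,2)] by blast
  then show ?case by (intro exI[of _ B]) (simp add: dirn_0)
next
  case (Suc n)
  have "\<forall>k. \<exists>C\<ge>0. \<forall>v x. norm x \<le> d \<longrightarrow> norm (dirn n v (pd k f) x) \<le> C * norm v ^ n"
    using Suc(1)[OF Cinf_pd[OF Suc(2)]] by blast
  then obtain C where C: "\<And>k. 0 \<le> C k" "\<And>k v x. norm x \<le> d \<Longrightarrow> norm (dirn n v (pd k f) x) \<le> C k * norm v ^ n" by metis
  show ?case
  proof (intro exI[of _ "\<Sum>k\<in>UNIV. C k"] conjI allI impI)
    show "0 \<le> (\<Sum>k\<in>UNIV. C k)" by (rule sum_nonneg) (rule C(1))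
    fix v x :: "real^3" assume x: "norm x \<le> d"
    then have xb: "x \<in> ball 0 a" using assms by simp
    have "norm (dirn (Suc n) v f x) \<le> (\<Sum>k\<in>UNIV. norm v * (C k * norm v ^ n))"
      unfolding dirn_Suc_sum[OF open_ball Suc(2) xb]
    proof (rule sum_norm_le)
      fix k :: 3
      show "norm (cv v k * dirn n v (pd k f) x) \<le> norm v * (C k * norm v ^ n)"
        unfolding norm_mult using C(2)[OF x, of v k] component_le_norm_cart[of v k] by (intro mult_mono) auto
    qed
    then show "norm (dirn (Suc n) v f x) \<le> (\<Sum>k\<in>UNIV. C k) * norm v ^ Suc n"
      by (simp add: sum_distrib_right sum_distrib_left algebra_simps)
  qed
qed

text \<open>Taylor's theorem with zero Taylor polynomial. The derivative of order \<open>N\<close>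
  along \<open>v\<close> is at most \<open>C * norm v ^ N\<close>; going down one order at a time,
  the mean value estimate from the origin keeps this bound since \<open>t \<le> 1\<close>.\<close>

lemma flat_dirn:
  assumes a: "0 < a" and f: "Cinf_on (ball 0 a) f" and z: "\<And>v n. v \<noteq> 0 \<Longrightarrow> dirn n v f 0 = 0"
  shows "flat f"
  unfolding flat_def
proof
  fix N :: nat
  obtain C where C: "0 \<le> C" "\<And>v x. norm x \<le> a/2 \<Longrightarrow> norm (dirn N v f x) \<le> C * norm v ^ N"
    using dirn_bound[of "a/2" a f N] a f by auto
  show "\<exists>C d. 0 < d \<and> 0 \<le> C \<and> (\<forall>x. 0 < norm x \<and> norm x < d \<longrightarrow> norm (f x) \<le> C * norm x ^ N)"
  proof (rule exI[of _ C], rule exI[of _ "a/2"], intro conjI allI impI)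
    fix v :: "real^3" assume v: "0 < norm v \<and> norm v < a/2"
    have tv: "norm (t *\<^sub>R v) \<le> a/2" if "0 \<le> t" "t \<le> 1" for t
    proof -
      have "norm (t *\<^sub>R v) \<le> norm v" using mult_right_mono[of t 1 "norm v"] that by simp
      with v show ?thesis by linarith
    qed
    have "\<forall>t. 0 \<le> t \<and> t \<le> 1 \<longrightarrow> norm (dirn (N - n) v f (t *\<^sub>R v)) \<le> C * norm v ^ N" if "n \<le> N" for n
      using that
    proof (induct n)
      case 0 then show ?case using C tv by simp
    next
      case (Suc n)
      define k where "k = N - Suc n"
      have k: "N - n = Suc k" using Suc(2) by (simp add: k_def)
      show ?case
      proof (intro allI impI)
        fix t :: real assume t: "0 \<le> t \<and> t \<le> 1"
        have "norm (dirn k v f (t *\<^sub>R v) - dirn k v f (0 *\<^sub>R v)) \<le> (C * norm v ^ N) * t"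
        proof (rule vector_derivative_bound[where f = "\<lambda>t. dirn k v f (t *\<^sub>R v)" and f' = "\<lambda>t. dirn (Suc k) v f (t *\<^sub>R v)"])
          fix s assume s: "0 \<le> s" "s \<le> t"
          have "s *\<^sub>R v \<in> ball 0 a" using tv[of s] s t a by auto
          then have "((\<lambda>t. dirn k v f (0 + t *\<^sub>R v)) has_vector_derivative (\<Sum>j\<in>UNIV. v $ j *\<^sub>R pd j (dirn k v f) (0 + s *\<^sub>R v))) (at s)"
            by (intro pd_line Cinf_differentiable[OF Cinf_dirn[OF open_ball f]]) simp
          then show "((\<lambda>t. dirn k v f (t *\<^sub>R v)) has_vector_derivative dirn (Suc k) v f (s *\<^sub>R v)) (at s)"
            by (simp add: dirn_Suc_outer dird_def scaleR_conv_of_real)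
          show "norm (dirn (Suc k) v f (s *\<^sub>R v)) \<le> C * norm v ^ N"
            using Suc s t k by auto
        qed (use t in auto)
        then have "norm (dirn k v f (t *\<^sub>R v)) \<le> (C * norm v ^ N) * t" using z[of v k] v by simp
        also have "\<dots> \<le> (C * norm v ^ N) * 1" using C t by (intro mult_left_mono) auto
        finally show "norm (dirn (N - Suc n) v f (t *\<^sub>R v)) \<le> C * norm v ^ N" by (simp add: k_def)
      qed
    qed
    from this[of N] show "norm (f v) \<le> C * norm v ^ N" by (auto simp: dirn_0 dest: spec[of _ 1])
  qed (use C a in auto)
qed

text \<open>The Taylor series at 0 of f along the line through \<open>v\<close>, as a formal series,
  since for a smooth function it may diverge.\<close>

definition taylor :: "real^3 \<Rightarrow> (real^3 \<Rightarrow> complex) \<Rightarrow> complex fps" where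
  "taylor v f = Abs_fps (\<lambda>n. dirn n v f 0 / fact n)"

lemma taylor_nth: "fps_nth (taylor v f) n = dirn n v f 0 / fact n"
  by (simp add: taylor_def)

lemma taylor_deriv: "fps_deriv (taylor v f) = taylor v (dird v f)"
  by (simp add: fps_eq_iff taylor_nth dirn_Suc field_simps del: of_nat_Suc)

context
  fixes U :: "(real^3) set"
  assumes U: "open U" "0 \<in> U"
begin

lemma taylor_cong: "(\<And>y. y \<in> U \<Longrightarrow> f y = g y) \<Longrightarrow> taylor v f = taylor v g"
  using dirn_cong[OF U(1) _ U(2), of f g] by (simp add: fps_eq_iff taylor_nth)

lemma taylor_add: "Cinf_on U f \<Longrightarrow> Cinf_on U g \<Longrightarrow> taylor v (\<lambda>y. f y + g y) = taylor v f + taylor v g"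
  by (simp add: fps_eq_iff taylor_nth dirn_add[OF U(1) _ _ U(2)] add_divide_distrib)

text \<open>A coefficient of order n + 1 is determined by the coefficient of order n of the
  derivative, and both sides obey the Leibniz rule. This replaces the binomial formula for higher
  derivatives of a product.\<close>

lemma taylor_mult:
  assumes "Cinf_on U f" "Cinf_on U g" shows "taylor v (\<lambda>y. f y * g y) = taylor v f * taylor v g"
proof (rule fps_ext)
  fix n show "fps_nth (taylor v (\<lambda>y. f y * g y)) n = fps_nth (taylor v f * taylor v g) n"
    using assms
  proof (induct n arbitrary: f g)
    case 0 then show ?case by (simp add: taylor_nth dirn_0)
  next
    case (Suc n)
    note D = Cinf_dird[OF U(1) Suc(2), of v] Cinf_dird[OF U(1) Suc(3), of v]
    have "taylor v (dird v (\<lambda>y. f y * g y)) = taylor v (\<lambda>y. dird v f y * g y + f y * dird v g y)"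
      by (rule taylor_cong) (rule dird_mult[OF Cinf_differentiable[OF Suc(2)] Cinf_differentiable[OF Suc(3)]])
    also have "\<dots> = taylor v (\<lambda>y. dird v f y * g y) + taylor v (\<lambda>y. f y * dird v g y)"
      by (rule taylor_add) (intro cinf U D Suc)+
    finally have "fps_nth (fps_deriv (taylor v (\<lambda>y. f y * g y))) n
       = fps_nth (taylor v (dird v f) * taylor v g) n + fps_nth (taylor v f * taylor v (dird v g)) n"
      using Suc(1)[OF D(1) Suc(3)] Suc(1)[OF Suc(2) D(2)] by (simp add: taylor_deriv)
    also have "\<dots> = fps_nth (fps_deriv (taylor v f * taylor v g)) n"
      by (simp add: taylor_deriv algebra_simps)
    finally show ?case
      unfolding fps_deriv_nth by (metis Suc_eq_plus1 mult_left_cancel of_nat_neq_0)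
  qed
qed

lemma taylor_coord: "taylor v (cx k) = fps_const (cv v k) * fps_X"
proof (rule fps_ext)
  fix n
  have d1: "dird v (cx k) = (\<lambda>y. cv v k)"
    using sum_kd[of k "\<lambda>j. cv v j"] by (simp add: fun_eq_iff dird_def pd_coord mult.commute eq_commute[of _ k])
  have d2: "dird v (\<lambda>y. c) = (\<lambda>y. 0)" for c by (simp add: fun_eq_iff dird_def pd_const)
  have d3: "dirn m v (\<lambda>y. 0) = (\<lambda>y. 0)" for m by (induct m) (simp_all add: dirn_0 dirn_Suc d2)
  show "fps_nth (taylor v (cx k)) n = fps_nth (fps_const (cv v k) * fps_X) n"
    by (cases n; cases "n - 1") (auto simp: taylor_nth dirn_0 dirn_Suc d1 d2 d3)
qed

lemma taylor_sq: "taylor v sq = fps_const (complex_of_real (v \<bullet> v)) * fps_X ^ 2"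
proof -
  have c: "Cinf_on U (\<lambda>y. cx k y * cx k y)" for k by (intro cinf U)
  have "taylor v sq = taylor v (\<lambda>y. (cx 1 y * cx 1 y + cx 2 y * cx 2 y) + cx 3 y * cx 3 y)"
    unfolding sq_def sum_3 ..
  also have "\<dots> = (\<Sum>k\<in>UNIV. taylor v (cx k) * taylor v (cx k))"
    by (simp add: taylor_add[OF Cinf_add[OF U(1) c c] c] taylor_add[OF c c] taylor_mult[OF Cinf_coord Cinf_coord] sum_3)
  also have "\<dots> = (\<Sum>k\<in>UNIV. fps_const (cv v k * cv v k)) * fps_X ^ 2"
    by (simp add: taylor_coord sum_3 power2_eq_square algebra_simps fps_const_mult[symmetric] del: fps_const_mult)
  also have "(\<Sum>k\<in>UNIV. fps_const (cv v k * cv v k)) = fps_const (complex_of_real (v \<bullet> v))"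
    by (simp add: sum_3 inner_vec_def fps_const_add)
  finally show ?thesis .
qed

end

text \<open>\<open>c + t\<^sup>2\<close> is not a square of a rational function: its root \<open>\<i> \<surd>c\<close> is simple.\<close>

lemma square_poly_zero:
  fixes P Q :: "complex poly"
  assumes c: "(0::real) < c" and e: "P * P = [:complex_of_real c, 0, 1:] * (Q * Q)"
  shows "P = 0"
proof (rule ccontr)
  assume P: "P \<noteq> 0"
  let ?z = "\<i> * complex_of_real (sqrt c)"
  have z: "?z * ?z = - complex_of_real c"
  proof -
    have "?z * ?z = - (complex_of_real (sqrt c) * complex_of_real (sqrt c))" by (simp add: algebra_simps)
    then show ?thesis using c by (simp flip: of_real_mult)
  qed
  have R: "[:complex_of_real c, 0, 1:] = [:- ?z, 1:] * [:?z, 1:]"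
    using z by simp
  have Q: "Q \<noteq> 0" using P e by auto
  have z2: "?z \<noteq> - ?z" using c by (simp add: eq_neg_iff_add_eq_0)
  have "order ?z [:?z, 1:] = 0" using z2 by (intro order_0I) (simp add: eq_neg_iff_add_eq_0)
  moreover have "order ?z [:- ?z, 1:] = 1" using order_power_n_n[of ?z 1] by simp
  ultimately have "order ?z [:complex_of_real c, 0, 1:] = 1" unfolding R by (subst order_mult) auto
  moreover have "order ?z (P * P) = 2 * order ?z P" using P by (subst order_mult) auto
  moreover have "order ?z ([:complex_of_real c, 0, 1:] * (Q * Q)) = order ?z [:complex_of_real c, 0, 1:] + 2 * order ?z Q"
    using Q order_mult[of "[:complex_of_real c, 0, 1:]" "Q * Q" ?z] order_mult[of Q Q ?z]
    by (simp del: mult_pCons_left)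
  ultimately have "2 * order ?z P = 1 + 2 * order ?z Q" using e by simp
  then show False by presburger
qed

text \<open>Lowest-order terms decide: comparing subdegrees, \<open>F\<close> starts one order above
  \<open>G\<close>, and the two leading coefficients satisfy the polynomial identity excluded by
  \<open>square_poly_zero\<close>.\<close>

lemma square_fps_zero:
  fixes F G :: "complex poly fps"
  assumes c: "(0::real) < c" and e: "F * F = fps_const [:complex_of_real c, 0, 1:] * fps_X ^ 2 * (G * G)"
  shows "F = 0" "G = 0"
proof -
  let ?R = "[:complex_of_real c, 0, 1:]"
  have RX: "fps_const ?R * fps_X ^ 2 \<noteq> (0 :: complex poly fps)" by simp
  show F: "F = 0"
  proof (rule ccontr)
    assume F: "F \<noteq> 0"
    then have G: "G \<noteq> 0" using e by auto
    have "subdegree (F * F) = 2 * subdegree F" using F by simp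
    moreover have "subdegree (fps_const ?R * fps_X ^ 2 * (G * G)) = 2 + 2 * subdegree G"
      using G by (simp add: subdegree_mult)
    ultimately have k: "subdegree F = Suc (subdegree G)" using e by simp
    have "fps_nth (F * F) (2 * subdegree F) = fps_nth F (subdegree F) * fps_nth F (subdegree F)"
      by (simp add: mult_2)
    moreover have "fps_nth (fps_const ?R * fps_X ^ 2 * (G * G)) (2 * subdegree F)
       = ?R * (fps_nth G (subdegree G) * fps_nth G (subdegree G))"
    proof -
      have "fps_const ?R * fps_X ^ 2 * (G * G) = fps_const ?R * (fps_X ^ 2 * (G * G))" by (simp only: mult.assoc)
      moreover have "fps_nth (fps_X ^ 2 * (G * G)) (2 * subdegree F) = fps_nth (G * G) (2 * subdegree F - 2)"
        unfolding fps_X_power_mult_nth using k by simp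
      moreover have "fps_nth (G * G) (2 * subdegree F - 2) = fps_nth G (subdegree G) * fps_nth G (subdegree G)"
        using k by (simp add: mult_2[symmetric]) (simp add: mult_2)
      ultimately show ?thesis by (simp only: fps_mult_left_const_nth)
    qed
    ultimately have "fps_nth F (subdegree F) = 0"
      using square_poly_zero[OF c] e by metis
    then show False using F by simp
  qed
  show "G = 0" using e RX unfolding F by simp
qed

text \<open>The identities in t come from real directions only, but infinitely many points determine
  a polynomial.\<close>

lemma poly_eq_real:
  fixes P Q :: "complex poly"
  assumes "\<And>t::real. poly P (complex_of_real t) = poly Q (complex_of_real t)" shows "P = Q"
proof (rule ccontr)
  assume "P \<noteq> Q"
  then have "finite {z. poly (P - Q) z = 0}" by (intro poly_roots_finite) simp
  moreover have "range complex_of_real \<subseteq> {z. poly (P - Q) z = 0}" using assms by auto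
  ultimately have "finite (range complex_of_real)" by (rule finite_subset[rotated])
  then show False using finite_imageD[of complex_of_real UNIV] by (simp add: inj_on_def infinite_UNIV_char_0)
qed

text \<open>For fixed \<open>v\<close>, the hypothesis at all directions
  \<open>v + t *\<^sub>R w\<close> becomes a single identity between power series with coefficients
  polynomial in t, and r^2 becomes \<open>v \<bullet> v + t * t\<close> times the square of the
  formal variable.\<close>

lemma flat_of_square:
  assumes a: "0 < a" and f: "Cinf_on (ball 0 a) f1" "Cinf_on (ball 0 a) f2"
    and e: "\<And>v. taylor v f1 * taylor v f1 = taylor v sq * (taylor v f2 * taylor v f2)"
  shows "flat f1" "flat f2"
proof -
  have U: "open (ball 0 a)" "0 \<in> ball (0::real^3) a" using a by auto
  have "taylor v f1 = 0 \<and> taylor v f2 = 0" if v: "v \<noteq> 0" for v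
  proof -
    obtain w0 :: "real^3" where w0: "w0 \<noteq> 0" "orthogonal v w0"
      using orthogonal_to_vector_exists[of v] by auto
    define w where "w = sgn w0"
    have w: "v \<bullet> w = 0" "w \<bullet> w = 1"
      using w0 by (auto simp: w_def orthogonal_def sgn_div_norm dot_square_norm power2_eq_square)
    have vw: "(v + t *\<^sub>R w) \<bullet> (v + t *\<^sub>R w) = v \<bullet> v + t * t" for t
      using w by (simp add: inner_add_left inner_add_right inner_commute)
    have "\<exists>P. \<forall>t. fps_nth (taylor (v + t *\<^sub>R w) f) n = poly P (complex_of_real t)" if f: "Cinf_on (ball 0 a) f" for f n
    proof -
      obtain P where "\<forall>t. dirn n (v + t *\<^sub>R w) f 0 = poly P (complex_of_real t)"
        using dirn_poly[OF U f] by blast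
      then show ?thesis by (intro exI[of _ "smult (1 / fact n) P"]) (simp add: taylor_nth)
    qed
    then obtain P Q where P: "\<And>n t. fps_nth (taylor (v + t *\<^sub>R w) f1) n = poly (P n) (complex_of_real t)"
      and Q: "\<And>n t. fps_nth (taylor (v + t *\<^sub>R w) f2) n = poly (Q n) (complex_of_real t)"
      using f by metis
    let ?R = "[:complex_of_real (v \<bullet> v), 0, 1:]"
    have "Abs_fps P * Abs_fps P = fps_const ?R * fps_X ^ 2 * (Abs_fps Q * Abs_fps Q)"
    proof (rule fps_ext, rule poly_eq_real)
      fix n and t :: real
      let ?t = "complex_of_real t" and ?v = "v + t *\<^sub>R w"
      have sqm: "poly (fps_nth (Abs_fps P * Abs_fps P) n) ?t = fps_nth (taylor ?v f1 * taylor ?v f1) n"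
        "poly (fps_nth (Abs_fps Q * Abs_fps Q) n) ?t = fps_nth (taylor ?v f2 * taylor ?v f2) n" for n
        by (simp_all add: fps_mult_nth poly_sum P Q)
      have "poly (fps_nth (Abs_fps P * Abs_fps P) n) ?t = fps_nth (fps_const (poly ?R ?t) * (fps_X ^ 2 * (taylor ?v f2 * taylor ?v f2))) n"
        unfolding sqm(1) e taylor_sq[OF U] vw by (simp only: mult.assoc) (simp add: power2_eq_square)
      also have "\<dots> = poly (fps_nth (fps_const ?R * (fps_X ^ 2 * (Abs_fps Q * Abs_fps Q))) n) ?t"
        unfolding fps_mult_left_const_nth fps_X_power_mult_nth poly_mult by (simp add: sqm(2) del: fps_mult_nth)
      finally show "poly (fps_nth (Abs_fps P * Abs_fps P) n) ?t
          = poly (fps_nth (fps_const ?R * fps_X ^ 2 * (Abs_fps Q * Abs_fps Q)) n) ?t"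
        by (simp only: mult.assoc)
    qed
    moreover have "0 < v \<bullet> v" using v by simp
    ultimately have "Abs_fps P = 0" "Abs_fps Q = 0" using square_fps_zero by blast+
    then have "P n = 0" "Q n = 0" for n by (metis fps_nth_Abs_fps fps_zero_nth)+
    \<comment> \<open>At \<open>t = 0\<close> the direction is \<open>v\<close> itself.\<close>
    then show ?thesis using P[of 0] Q[of 0] by (simp add: fps_eq_iff)
  qed
  then have "dirn n v f1 0 = 0" "dirn n v f2 0 = 0" if "v \<noteq> 0" for v n
    using that taylor_nth[of v f1 n] taylor_nth[of v f2 n] by auto
  then show "flat f1" "flat f2" using flat_dirn[OF a f(1)] flat_dirn[OF a f(2)] by auto
qed

text \<open>Squaring eliminates r: f1^2 - r^2 f2^2 is smooth at the origin as well. On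
  \<open>W\<close> it vanishes with all derivatives, and by continuity these vanish at 0, which lies
  in the closure.\<close>

lemma flat_of_vanishing:
  assumes a: "0 < a" and f: "Cinf_on (ball 0 a) f1" "Cinf_on (ball 0 a) f2"
    and W: "open W" "W \<subseteq> ball 0 a" "0 \<in> closure W"
    and e: "\<And>x. x \<in> W \<Longrightarrow> f1 x + cr x * f2 x = 0"
  shows "flat f1" "flat f2"
proof -
  have U: "open (ball 0 a)" "0 \<in> ball (0::real^3) a" using a by auto
  let ?g = "\<lambda>x. f1 x * f1 x + (-1) * (sq x * (f2 x * f2 x))"
  have C: "Cinf_on (ball 0 a) ?g" by (intro cinf open_ball f)
  have gW: "?g x = 0" if "x \<in> W" for x
  proof -
    have "f1 x = - (cr x * f2 x)" using e[OF that] by (simp add: eq_neg_iff_add_eq_0)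
    then show ?thesis by (simp add: sq_cr algebra_simps)
  qed
  have h0: "hpd ks (\<lambda>y. 0 :: complex) x = 0" for ks and x :: "real^3"
  proof -
    have "pd k (\<lambda>y. 0 :: complex) = (\<lambda>y. 0)" for k by (simp add: fun_eq_iff pd_const)
    then have "hpd ks (\<lambda>y. 0 :: complex) = (\<lambda>y. 0)" by (induct ks) simp_all
    then show ?thesis by simp
  qed
  have "hpd ks ?g x = 0" if "x \<in> W" for ks x
    using hpd_cong[OF W(1) gW that] h0 by simp
  have z: "hpd ks ?g 0 = 0" for ks
  proof -
    have "isCont (hpd ks ?g) 0"
      using Cinf_continuous[OF Cinf_hpd[OF C]] U by (simp add: continuous_on_eq_continuous_at)
    obtain s where s: "\<And>n. s n \<in> W" "s \<longlonglongrightarrow> 0" using W(3) closure_sequential by metis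
    have "(\<lambda>n. hpd ks ?g (s n)) \<longlonglongrightarrow> hpd ks ?g 0"
      by (rule isCont_tendsto_compose[OF \<open>isCont (hpd ks ?g) 0\<close> s(2)])
    then have "(\<lambda>n. 0) \<longlonglongrightarrow> hpd ks ?g 0"
      using \<open>\<And>x ks. x \<in> W \<Longrightarrow> hpd ks ?g x = 0\<close> s(1) by simp
    then show ?thesis using LIMSEQ_unique tendsto_const by blast
  qed
  have "taylor v f1 * taylor v f1 = taylor v sq * (taylor v f2 * taylor v f2)" for v
  proof -
    have 0: "taylor v ?g = 0"
      using dirn_zero[OF U C z] by (simp add: fps_eq_iff taylor_nth)
    have c: "Cinf_on (ball 0 a) (\<lambda>x. f1 x * f1 x)" "Cinf_on (ball 0 a) (\<lambda>x. f2 x * f2 x)"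
      "Cinf_on (ball 0 a) (\<lambda>x. sq x * (f2 x * f2 x))" "Cinf_on (ball 0 a) (\<lambda>x. (-1) * (sq x * (f2 x * f2 x)))"
      "Cinf_on (ball 0 a) sq"
      by (intro cinf open_ball f)+
    have m: "taylor v (\<lambda>x. (-1) * (sq x * (f2 x * f2 x))) = - taylor v (\<lambda>x. sq x * (f2 x * f2 x))"
      by (simp only: fps_eq_iff fps_neg_nth taylor_nth dirn_cmult[OF U(1) c(3) U(2)]) simp
    have "taylor v ?g = taylor v f1 * taylor v f1 - taylor v sq * (taylor v f2 * taylor v f2)"
      by (simp only: taylor_add[OF U c(1,4)] m taylor_mult[OF U f(1) f(1)] taylor_mult[OF U c(5) c(2)] taylor_mult[OF U f(2) f(2)]) simp
    with 0 show ?thesis by simp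
  qed
  then show "flat f1" "flat f2" using flat_of_square[OF a f] by blast+
qed

section \<open>Gluing\<close>

text \<open>Extended by 0, the error \<open>e\<close> is smooth on the whole ball and can be
  absorbed into the smooth part.\<close>

lemma E_inf_vanishing_difference:
  assumes a: "0 < a" and p: "Cinf_on (ball 0 a) p1" "Cinf_on (ball 0 a) p2"
    and e: "Cinf_on (ball 0 a - {0}) e" "\<And>ks. vanishing (hpd ks e)"
    and f: "\<And>x. x \<in> ball 0 a - {0} \<Longrightarrow> f x = p1 x + cr x * p2 x + e x"
  shows "E_inf a f"
proof -
  let ?e = "\<lambda>x. if x = 0 then 0 else e x"
  have "Cinf_on (ball 0 a) (\<lambda>x. p1 x + ?e x)"
    by (rule Cinf_add[OF open_ball p(1) Cinf_extend[OF a e]])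
  moreover have "f x = (p1 x + ?e x) + cr x * p2 x" if "x \<in> ball 0 a - {0}" for x
    using f[OF that] that by simp
  ultimately show ?thesis unfolding E_inf_def using p(2) by blast
qed

lemma hpd_zero_open:
  assumes "open W" "x \<in> W" "\<And>y. y \<in> W \<Longrightarrow> e y = (0::complex)" shows "hpd ks e x = 0"
proof -
  have "pd k (\<lambda>y. 0 :: complex) = (\<lambda>y. 0)" for k by (simp add: fun_eq_iff pd_const)
  then have "hpd ks (\<lambda>y. 0 :: complex) = (\<lambda>y. 0)" by (induct ks) simp_all
  moreover have "hpd ks e x = hpd ks (\<lambda>y. 0) x"
    by (rule hpd_cong[OF assms(1) _ assms(2)]) (rule assms(3))
  ultimately show ?thesis by simp
qed

text \<open>The case in which one expression governs a neighbourhood of the origin: the difference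
  is 0 there, and farther out r is smooth, so switching between the expressions is harmless.\<close>

lemma E_inf_glue_near:
  assumes a: "0 < a" and E: "E_inf a \<Phi>" "E_inf a \<Phi>'"
    and loc: "\<And>x. x \<in> ball 0 a - {0} \<Longrightarrow> \<exists>W. open W \<and> x \<in> W \<and> ((\<forall>y\<in>W. f y = \<Phi> y) \<or> (\<forall>y\<in>W. f y = \<Phi>' y))"
    and near: "0 < d" "\<And>x. x \<in> ball 0 d - {0} \<Longrightarrow> f x = \<Phi> x"
  shows "E_inf a f"
proof -
  let ?V = "ball 0 a - {0::real^3}"
  obtain p1 p2 where p: "Cinf_on (ball 0 a) p1" "Cinf_on (ball 0 a) p2"
    and \<Phi>: "\<And>x. x \<in> ?V \<Longrightarrow> \<Phi> x = p1 x + cr x * p2 x" using E(1) unfolding E_inf_def by blast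
  obtain q1 q2 where q: "Cinf_on (ball 0 a) q1" "Cinf_on (ball 0 a) q2"
    and \<Phi>': "\<And>x. x \<in> ?V \<Longrightarrow> \<Phi>' x = q1 x + cr x * q2 x" using E(2) unfolding E_inf_def by blast
  let ?p = "\<lambda>x. p1 x + cr x * p2 x" and ?q = "\<lambda>x. q1 x + cr x * q2 x"
  let ?e = "\<lambda>x. f x - ?p x"
  have V: "open ?V" "0 \<notin> ?V" by (auto simp: open_punctured)
  have sub: "Cinf_on ?V p1" "Cinf_on ?V p2" "Cinf_on ?V q1" "Cinf_on ?V q2"
    using p q Cinf_subset by blast+
  have D: "Cinf_on ?V (\<lambda>x. ?q x - ?p x)" by (intro cinf V sub)
  have e: "Cinf_on ?V ?e"
  proof (rule Cinf_local)
    fix x assume x: "x \<in> ?V"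
    obtain W where W: "open W" "x \<in> W" "(\<forall>y\<in>W. f y = \<Phi> y) \<or> (\<forall>y\<in>W. f y = \<Phi>' y)" using loc[OF x] by blast
    let ?W = "W \<inter> ?V"
    have oW: "open ?W" using W V by blast
    have "Cinf_on ?W ?e"
      using W(3)
    proof
      assume "\<forall>y\<in>W. f y = \<Phi> y"
      then have "0 = ?e y" if "y \<in> ?W" for y using that \<Phi> by auto
      then show ?thesis by (rule Cinf_cong[OF oW _ Cinf_const])
    next
      assume "\<forall>y\<in>W. f y = \<Phi>' y"
      then have "?q y - ?p y = ?e y" if "y \<in> ?W" for y using that \<Phi>' by auto
      then show ?thesis by (rule Cinf_cong[OF oW _ Cinf_subset[OF D]]) auto
    qed
    then show "\<exists>W. x \<in> W \<and> Cinf_on W ?e" using W(2) x by (intro exI[of _ ?W]) simp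
  qed
  have "vanishing (hpd ks ?e)" for ks
    unfolding vanishing_def
  proof (intro allI impI exI[of _ "min d a"] conjI)
    fix \<epsilon> :: real and x :: "real^3" assume \<epsilon>: "\<epsilon> > 0" and x: "0 < norm x \<and> norm x < min d a"
    have "hpd ks ?e x = 0"
      by (rule hpd_zero_open[of "ball 0 (min d a) - {0}"]) (use x near \<Phi> in \<open>auto simp: open_punctured\<close>)
    then show "norm (hpd ks ?e x) \<le> \<epsilon>" using \<epsilon> by simp
  qed (use near a in auto)
  then show ?thesis by (rule E_inf_vanishing_difference[OF a p e]) simp
qed

text \<open>The orientation of the local frames may differ from point to point. Where both
  orientations accumulate at the origin they overlap there, by connectedness of punctured balls, and
  then the difference of the two candidate expressions is flat at the origin.\<close>

lemma E_inf_glue: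
  assumes E: "E_inf a \<Phi>" "E_inf a \<Phi>'"
    and loc: "\<And>x. x \<in> ball 0 a - {0} \<Longrightarrow> \<exists>W. open W \<and> x \<in> W \<and> ((\<forall>y\<in>W. f y = \<Phi> y) \<or> (\<forall>y\<in>W. f y = \<Phi>' y))"
  shows "E_inf a f"
proof (cases "0 < a")
  case False
  then have empty: "ball 0 a = ({} :: (real^3) set)" by simp
  show ?thesis unfolding E_inf_def empty
    by (intro exI[of _ "\<lambda>_. 0"] conjI cinf) simp
next
  case a: True
  let ?V = "ball 0 a - {0::real^3}"
  define S S' where "S = {x\<in>?V. \<exists>W. open W \<and> x \<in> W \<and> (\<forall>y\<in>W. f y = \<Phi> y)}"
    and "S' = {x\<in>?V. \<exists>W. open W \<and> x \<in> W \<and> (\<forall>y\<in>W. f y = \<Phi>' y)}"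
  have V: "open ?V" "0 \<notin> ?V" by (auto simp: open_punctured)
  have op: "open {x\<in>?V. \<exists>W. open W \<and> x \<in> W \<and> (\<forall>y\<in>W. f y = \<Psi> y)}" for \<Psi>
  proof (subst open_subopen, intro ballI)
    fix x assume "x \<in> {x\<in>?V. \<exists>W. open W \<and> x \<in> W \<and> (\<forall>y\<in>W. f y = \<Psi> y)}"
    then obtain W where "x \<in> ?V" "open W" "x \<in> W" "\<forall>y\<in>W. f y = \<Psi> y" by blast
    then show "\<exists>T. open T \<and> x \<in> T \<and> T \<subseteq> {x\<in>?V. \<exists>W. open W \<and> x \<in> W \<and> (\<forall>y\<in>W. f y = \<Psi> y)}"
      using V by (intro exI[of _ "W \<inter> ?V"]) blast
  qed
  have cover: "x \<in> S \<or> x \<in> S'" if x: "x \<in> ?V" for x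
    using loc[OF x] x unfolding S_def S'_def by blast
  have oS: "open S" "open S'" unfolding S_def S'_def by (rule op)+
  have sV: "S \<subseteq> ?V" "S' \<subseteq> ?V" unfolding S_def S'_def by (rule Collect_restrict)+
  have "S \<union> S' = ?V"
  proof
    show "?V \<subseteq> S \<union> S'" using cover by (auto simp only: subset_iff Un_iff)
  qed (use sV in simp)
  note S = oS this sV
  have fS: "f x = \<Phi> x" if "x \<in> S" for x using that unfolding S_def by blast
  have fS': "f x = \<Phi>' x" if "x \<in> S'" for x using that unfolding S'_def by blast
  consider (1) d where "0 < d" "ball 0 d - {0} \<subseteq> S" | (2) d where "0 < d" "ball 0 d - {0} \<subseteq> S'"
    | (3) "\<And>d. 0 < d \<Longrightarrow> \<not> ball 0 d - {0} \<subseteq> S \<and> \<not> ball 0 d - {0} \<subseteq> S'" by blast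
  then show ?thesis
  proof cases
    case 1
    show ?thesis by (rule E_inf_glue_near[OF a E loc 1(1)]) (use 1 fS in auto)
  next
    case 2
    have loc': "\<exists>W. open W \<and> x \<in> W \<and> ((\<forall>y\<in>W. f y = \<Phi>' y) \<or> (\<forall>y\<in>W. f y = \<Phi> y))" if "x \<in> ?V" for x
      using loc[OF that] by blast
    show ?thesis by (rule E_inf_glue_near[OF a E(2,1) loc' 2(1)]) (use 2 fS' in auto)
  next
    case 3
    have "\<exists>y\<in>S \<inter> S'. dist y 0 < d" if d: "0 < d" for d
    proof (rule ccontr)
      assume no: "\<not> (\<exists>y\<in>S \<inter> S'. dist y 0 < d)"
      define B where "B = ball 0 (min a d) - {0::real^3}"
      have BV: "B \<subseteq> ?V" by (auto simp: B_def)
      have "connected B" unfolding B_def by (rule connected_punctured_ball) simp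
      moreover have "B \<subseteq> S \<union> S'" using S(3) BV by blast
      moreover have "S \<inter> S' \<inter> B = {}" using no by (auto simp: B_def)
      ultimately have "S \<inter> B = {} \<or> S' \<inter> B = {}" using connectedD[OF _ S(1,2)] by metis
      then have "B \<subseteq> S \<or> B \<subseteq> S'" using S(3) BV by blast
      then show False using 3[of "min a d"] a d unfolding B_def by auto
    qed
    then have cl: "0 \<in> closure (S \<inter> S')" unfolding closure_approachable by blast
    obtain p1 p2 where p: "Cinf_on (ball 0 a) p1" "Cinf_on (ball 0 a) p2"
      and \<Phi>: "\<And>x. x \<in> ?V \<Longrightarrow> \<Phi> x = p1 x + cr x * p2 x" using E(1) unfolding E_inf_def by blast
    obtain q1 q2 where q: "Cinf_on (ball 0 a) q1" "Cinf_on (ball 0 a) q2"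
      and \<Phi>': "\<And>x. x \<in> ?V \<Longrightarrow> \<Phi>' x = q1 x + cr x * q2 x" using E(2) unfolding E_inf_def by blast
    \<comment> \<open>The error \<open>?e\<close> of the first expression is 0 on \<open>S\<close>
      and equals the difference \<open>?d\<close> of the two expressions on \<open>S'\<close>; once
      \<open>?d\<close> is known to be flat, all derivatives of \<open>?e\<close> tend to 0 on
      either set.\<close>
    let ?d = "\<lambda>x. (q1 x - p1 x) + cr x * (q2 x - p2 x)"
    let ?e = "\<lambda>x. f x - (p1 x + cr x * p2 x)"
    have sub: "Cinf_on ?V p1" "Cinf_on ?V p2" "Cinf_on ?V q1" "Cinf_on ?V q2"
      using p q Cinf_subset by blast+
    have D: "Cinf_on ?V ?d" by (intro cinf V sub)
    have d12: "Cinf_on (ball 0 a) (\<lambda>x. q1 x - p1 x)" "Cinf_on (ball 0 a) (\<lambda>x. q2 x - p2 x)"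
      by (intro cinf open_ball p q)+
    have "(q1 x - p1 x) + cr x * (q2 x - p2 x) = 0" if x: "x \<in> S \<inter> S'" for x
    proof -
      have xV: "x \<in> ?V" using x S by blast
      show ?thesis using fS[of x] fS'[of x] \<Phi>[OF xV] \<Phi>'[OF xV] x by (simp add: algebra_simps)
    qed
    then have fl: "flat (\<lambda>x. q1 x - p1 x)" "flat (\<lambda>x. q2 x - p2 x)"
      using flat_of_vanishing[OF a d12 _ _ cl] S by blast+
    have e1: "0 = ?e y" if "y \<in> S" for y using fS[OF that] \<Phi>[OF subsetD[OF S(4) that]] by simp
    have e2: "?d y = ?e y" if "y \<in> S'" for y using fS'[OF that] \<Phi>'[OF subsetD[OF S(5) that]] by (simp add: algebra_simps)
    have e: "Cinf_on ?V ?e"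
    proof (rule Cinf_local)
      fix x assume "x \<in> ?V"
      moreover have "Cinf_on S ?e" by (rule Cinf_cong[OF S(1) e1 Cinf_const])
      moreover have "Cinf_on S' ?e" by (rule Cinf_cong[OF S(2) e2 Cinf_subset[OF D S(5)]])
      ultimately show "\<exists>W. x \<in> W \<and> Cinf_on W ?e" using S(3) by blast
    qed
    have "vanishing (hpd ks ?e)" for ks
      unfolding vanishing_def
    proof (intro allI impI)
      fix \<epsilon> :: real assume \<epsilon>: "\<epsilon> > 0"
      have "vanishing (hpd ks ?d)" by (rule flat_hpd_vanishing[OF a D d12 fl]) simp
      then obtain \<delta> where \<delta>: "\<delta> > 0" "\<And>x. 0 < norm x \<Longrightarrow> norm x < \<delta> \<Longrightarrow> norm (hpd ks ?d x) \<le> \<epsilon>"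
        using \<epsilon> unfolding vanishing_def by blast
      show "\<exists>\<delta>>0. \<forall>x. 0 < norm x \<and> norm x < \<delta> \<longrightarrow> norm (hpd ks ?e x) \<le> \<epsilon>"
      proof (intro exI[of _ "min \<delta> a"] conjI allI impI)
        fix x :: "real^3" assume x: "0 < norm x \<and> norm x < min \<delta> a"
        then have "x \<in> ?V" by simp
        then have "x \<in> S \<or> x \<in> S'" by (rule cover)
        then show "norm (hpd ks ?e x) \<le> \<epsilon>"
        proof
          assume "x \<in> S"
          then have "hpd ks ?e x = 0" by (rule hpd_zero_open[OF S(1)]) (simp add: e1[symmetric])
          then show ?thesis using \<epsilon> by simp
        next
          assume "x \<in> S'"
          then have "hpd ks ?d x = hpd ks ?e x" by (rule hpd_cong[OF S(2) e2, rotated])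
          then show ?thesis using \<delta>(2)[of x] x by simp
        qed
      qed (use \<delta> a in auto)
    qed
    then show ?thesis by (rule E_inf_vanishing_difference[OF a p e]) simp
  qed
qed

section \<open>Assembly over the local frames\<close>

theorem theorem4:
  fixes a A :: real and P J Q :: "real^3" and lam :: "real^3 \<Rightarrow> complex"
    and Psi :: "real^3 \<Rightarrow> 3 \<Rightarrow> 3 \<Rightarrow> complex"
  assumes lam_smooth: "Cinf_on (ball 0 a - {0}) lam"
    and Psi_def: "\<forall>x\<in>ball 0 a - {0}. \<exists>U m. x \<in> U \<and> U \<subseteq> ball 0 a - {0} \<and> adapted_frame U m \<and>
         (\<forall>y\<in>U. \<forall>i j. Psi y i j =
            complex_of_real (PsiP P y i j + PsiJ J y i j + PsiA A y i j + PsiQ Q y i j)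
            + PsiLam m lam y i j)"
    and P0: "P = 0"
    and rlam: "E_inf a (\<lambda>x. complex_of_real (norm x) * lam x)"
  shows "E_inf a (\<lambda>x. complex_of_real (norm x ^ 8) * (\<Sum>i\<in>UNIV. \<Sum>j\<in>UNIV. Psi x i j * Psi x i j))"
proof -
  have r: "rE a lam" using lam_smooth rlam by (simp add: rE_def)
  \<comment> \<open>Chosen before any frame, so that all frames of equal orientation lead to the
    same function.\<close>
  obtain T where T: "\<And>k. E_inf a (T k)"
    "\<And>x v. x \<in> ball 0 a - {0} \<Longrightarrow> (\<Sum>k\<in>UNIV. cx k x * v k) = 0 \<Longrightarrow>
      cr x * (\<Sum>k\<in>UNIV. v k * pd k (gpot lam) x) = (\<Sum>k\<in>UNIV. v k * T k x)"
    by (rule rE_grad[OF rE_gpot[OF r]], rule that)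
  obtain V where V: "\<And>j k. E_inf a (V j k)"
    "\<And>x v. x \<in> ball 0 a - {0} \<Longrightarrow> (\<Sum>k\<in>UNIV. cx k x * v k) = 0 \<Longrightarrow> (\<Sum>k\<in>UNIV. v k * v k) = 0 \<Longrightarrow>
      cr x * (\<Sum>j\<in>UNIV. \<Sum>k\<in>UNIV. v j * v k * pd j (pd k (hpot lam)) x) = (\<Sum>j\<in>UNIV. \<Sum>k\<in>UNIV. v j * v k * V j k x)"
    by (rule rE_hess[OF rE_hpot[OF r]], rule that)
  let ?F = "density (xi_tot A Q lam) (eta_tot J Q T) V"
  have E: "E_inf a (?F t)" for t
    by (intro E_inf_density E_inf_xi_tot r E_inf_eta_tot T V)
  show ?thesis
  proof (rule E_inf_glue[OF E[of \<i>] E[of "- \<i>"]])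
    fix x :: "real^3" assume "x \<in> ball 0 a - {0}"
    then obtain U m where x: "x \<in> U" and U: "U \<subseteq> ball 0 a - {0}" and ad: "adapted_frame U m"
      and Psi: "\<And>y i j. y \<in> U \<Longrightarrow> Psi y i j = complex_of_real (PsiP 0 y i j + PsiJ J y i j + PsiA A y i j + PsiQ Q y i j)
            + PsiLam m lam y i j"
      using Psi_def unfolding P0 by meson
    interpret frame U m by unfold_locales (rule ad)
    \<comment> \<open>The orientation takes only the values \<i> and -\<i>, at distance 2; within
      radius 1 it is constant.\<close>
    define W where "W = U \<inter> orient -` ball (orient x) 1"
    have W: "open W" "x \<in> W"
      unfolding W_def using continuous_open_preimage[OF orient_continuous openU open_ball] x by auto
    have "orient y = orient x" if "y \<in> W" for y
      using that orient_cases[of y] orient_cases[OF x] by (auto simp: W_def dist_norm)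
    moreover have "complex_of_real (norm y ^ 8) * (\<Sum>i\<in>UNIV. \<Sum>j\<in>UNIV. Psi y i j * Psi y i j) = ?F (orient y) y"
      if y: "y \<in> W" for y
    proof -
      have yU: "y \<in> U" using y by (simp add: W_def)
      then have yV: "y \<in> ball 0 a - {0}" using U by blast
      show ?thesis
        by (rule Psi_density[OF yU Cinf_subset[OF lam_smooth U]])
          (rule Psi[OF yU] T(2)[OF yV M_rel(3)[OF yU]] V(2)[OF yV M_rel(3)[OF yU] M_rel(1)[OF yU]])+
    qed
    ultimately have "\<forall>y\<in>W. complex_of_real (norm y ^ 8) * (\<Sum>i\<in>UNIV. \<Sum>j\<in>UNIV. Psi y i j * Psi y i j) = ?F (orient x) y"
      by simp
    then show "\<exists>W. open W \<and> x \<in> W \<and>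
        ((\<forall>y\<in>W. complex_of_real (norm y ^ 8) * (\<Sum>i\<in>UNIV. \<Sum>j\<in>UNIV. Psi y i j * Psi y i j) = ?F \<i> y) \<or>
         (\<forall>y\<in>W. complex_of_real (norm y ^ 8) * (\<Sum>i\<in>UNIV. \<Sum>j\<in>UNIV. Psi y i j * Psi y i j) = ?F (- \<i>) y))"
      using W orient_cases[OF x] by (intro exI[of _ W]) auto
  qed
qed

end
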